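(* Let $\mathcal{G}$ be an ample groupoid and let $M$ be a $\mathcal{G}$-module, identified with $\Gamma_c(\mathcal{M},\pi)$, where $\mathcal{M}$ is the $\mathcal{G}$-sheaf associated to $M$. For each $n\ge 0$ there is an isomorphism of abelian groups $\theta^n:\mathrm{Hom}_{\mathcal{G}}(\mathbb{Z}[\mathcal{G}^{(n+1)}],M)\to C^n(\mathcal{G},M)$ determined by $$(\theta^n\varphi)(g_1,\dots,g_n)=\varphi(\langle r(g_1),g_1,\dots,g_n\rangle_V)(r(g_1))$$ for all $\varphi\in \mathrm{Hom}_{\mathcal{G}}(\mathbb{Z}[\mathcal{G}^{(n+1)}],M)$ and $(g_1,\dots,g_n)\in\mathcal{G}^{(n)}$, where $V$ is a compact open subset of $\mathcal{G}^{(n+1)}$ such that $(r(g_1),g_1,\dots,g_n)\in V$ and $p|_V$ is a homeomorphism onto $p(V)$, and $\langle r(g_1),g_1,\dots,g_n\rangle_V$ is the indicator function of $V$. The maps $\theta^n$ are compatible with the boundary maps, i.e. $\delta_c^n\circ\theta^n=\theta^{n+1}\circ\delta_n$, and induce isomorphisms $H^n(\mathcal{G},M)\cong H^n_c(\mathcal{G},M)$. The inverse is induced by $\rho^n:C^n(\mathcal{G},M)\to\mathrm{Hom}_{\mathcal{G}}(\mathbb{Z}[\mathcal{G}^{(n+1)}],M)$ determined by $$(\rho^nf)(\langle g_0,g_1,\dots,g_n\rangle_W)(x)=\begin{cases}h_0\cdot f(h_1,\dots,h_n)&\text{if }(h_0,\dots,h_n)\in W\text{ and }p(h_0,\dots,h_n)=x,\\0&\text{otherwise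 (i.e. if }x\notin p(W)),\end{cases}$$ for $f\in C^n(\mathcal{G},M)$ and $W$ a compact open subset of $\mathcal{G}^{(n+1)}$ such that $p|_W$ is a homeomorphism onto $p(W)$ and $(g_0,\dots,g_n)\in W$.
   Context: All spaces and groupoids are Hausdorff (and locally compact). An ample groupoid $\mathcal{G}$ is an étale groupoid whose unit space $\mathcal{G}^{(0)}$ is totally disconnected; $r,s$ denote range and source. $\mathcal{G}^{(1)}=\mathcal{G}$ and, for $n\ge2$, $\mathcal{G}^{(n)}$ is the space of composable $n$-tuples. For a totally disconnected space $X$, $\mathbb{Z}[X]=C_c(X,\mathbb{Z})$ is the group of continuous compactly supported functions $X\to\mathbb{Z}$. $\mathbb{Z}[\mathcal{G}]$ is a ring under convolution $(f_1f_2)(g)=\sum_{s(h)=r(g)}f_1(h^{-1})f_2(hg)$. A $\mathcal{G}$-module is a left $\mathbb{Z}[\mathcal{G}]$-module $M$ with $\mathbb{Z}[\mathcal{G}]M=M$; $\mathrm{Hom}_{\mathcal{G}}$ means $\mathrm{Hom}_{\mathbb{Z}[\mathcal{G}]}$. $\chi_U$ is the indicator function of $U$. For $n\ge 1$, $\mathcal{G}$ acts on the left of $\mathcal{G}^{(n)}$ with anchor map $p(g_1,\dots,g_n)=r(g_1)$ by $g\cdot(g_1,\dots,g_n)=(gg_1,g_2,\dots,g_n)$, and $\mathbb{Z}[\mathcal{G}^{(n)}]$ is a $\mathcal{G}$-module via $(f\cdot m)(y)=\sum_{s(g)=p(y)}f(g^{-1})m(g\cdot y)$. For $n\ge1$,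 $0\le i\le n$, let $b^n_i:\mathcal{G}^{(n+1)}\to\mathcal{G}^{(n)}$ be $b^n_i(g_0,\dots,g_n)=(g_0,\dots,g_ig_{i+1},\dots,g_n)$ for $i<n$ and $b^n_n(g_0,\dots,g_n)=(g_0,\dots,g_{n-1})$. For a local homeomorphism $\tau:X\to Y$ put $\tau_*(f)(y)=\sum_{\tau(x)=y}f(x)$. Let $b_n=\sum_{i=0}^n(-1)^ib^n_{i*}:\mathbb{Z}[\mathcal{G}^{(n+1)}]\to\mathbb{Z}[\mathcal{G}^{(n)}]$ for $n\ge 1$. For $n\ge0$ let $\delta_n:\mathrm{Hom}_{\mathcal{G}}(\mathbb{Z}[\mathcal{G}^{(n+1)}],M)\to\mathrm{Hom}_{\mathcal{G}}(\mathbb{Z}[\mathcal{G}^{(n+2)}],M)$, $\delta_n(\varphi)=\varphi\circ b_{n+1}$, and $\delta_{-1}=0$. Then $H^n(\mathcal{G},M)=\ker\delta_n/\mathrm{im}\,\delta_{n-1}$. A $\mathcal{G}$-sheaf is a sheaf of abelian groups $\pi:\mathcal{A}\to\mathcal{G}^{(0)}$ (as an étale space: $\pi$ a local homeomorphism, fibers abelian groups, continuous operations) with group isomorphisms $\mathcal{A}_{s(g)}\to\mathcal{A}_{r(g)}$, $a\mapsto g\cdot a$, which are functorial in $g$ and jointly continuous in $(g,a)$. The $\mathcal{G}$-sheaf $\mathcal{M}$ associated to a $\mathcal{G}$-module $M$ has fibers $M_x=\varinjlim_{x\in U}\chi_UM$ ($U$ ranging over compact open subsets of $\mathcal{G}^{(0)}$),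 with $[m]_x\in M_x$ the class of $m$; a basis of the topology is given by the sets $\{[m]_x:x\in U\}$ with $U\subseteq\mathcal{G}^{(0)}$ compact open and $m\in\chi_UM$; the action is $g\cdot[m]_{s(g)}=[\chi_Vm]_{r(g)}$ for any compact open bisection $V\ni g$. The compactly supported continuous sections $\Gamma_c(\mathcal{M},\pi)$ form a $\mathcal{G}$-module via $(f\xi)(x)=\sum_{r(g)=x}f(g)(g\cdot\xi(s(g)))$, and $M\cong\Gamma_c(\mathcal{M},\pi)$ via $m\mapsto(x\mapsto[m]_x)$; under this identification elements of $M$ are evaluated at points $x\in\mathcal{G}^{(0)}$. $C^n(\mathcal{G},M)$ is the group (pointwise addition) of continuous $f:\mathcal{G}^{(n)}\to\mathcal{M}$ with $f(g_1,\dots,g_n)\in M_{r(g_1)}$ (for $n=0$: continuous sections $f:\mathcal{G}^{(0)}\to\mathcal{M}$). For $n\ge1$, $$(\delta_c^nf)(g_0,\dots,g_n)=g_0\cdot f(g_1,\dots,g_n)+\sum_{i=1}^n(-1)^if(g_0,\dots,g_{i-1}g_i,\dots,g_n)+(-1)^{n+1}f(g_0,\dots,g_{n-1}),$$ $(\delta_c^0f)(g_0)=g_0\cdot f(s(g_0))-f(r(g_0))$, $\delta_c^{-1}=0$, and $H_c^n(\mathcal{G},M)=\ker\delta_c^n/\mathrm{im}\,\delta_c^{n-1}$. For $n=0$ the formulas are read as $(\theta^0\varphi)(x)=\varphi(\langle x\rangle_V)(x)$ with $x\in\mathcal{G}^{(0)}\subseteq\mathcal{G}$, and $h_0\cdot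 f(s(h_0))$ in the definition of $\rho^0$. For $(g_0,\dots,g_n)\in W$ as in the claim, $\langle g_0,\dots,g_n\rangle_W=\chi_W\in\mathbb{Z}[\mathcal{G}^{(n+1)}]$. *)

theory Defs
  imports "HOL-Analysis.Analysis" "HOL-Algebra.Module" "HOL-Algebra.Generated_Groups"
begin

section \<open>Ample groupoids\<close>

text \<open>The set of arrows is the underlying set of \<open>gtop\<close>; objects are identified with their
  identity arrows. The product \<open>mul G g h\<close> is meaningful when \<open>src G g = rng G h\<close>.\<close>

record 'g groupoid =
  gtop :: "'g topology"
  units :: "'g set"
  rng :: "'g \<Rightarrow> 'g"
  src :: "'g \<Rightarrow> 'g"
  mul :: "'g \<Rightarrow> 'g \<Rightarrow> 'g"
  ginv :: "'g \<Rightarrow> 'g"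

definition arrows :: "'g groupoid \<Rightarrow> 'g set" where
  "arrows G = topspace (gtop G)"

definition unit_top :: "'g groupoid \<Rightarrow> 'g topology" where
  "unit_top G = subtopology (gtop G) (units G)"

definition local_homeomorphism :: "'a topology \<Rightarrow> 'b topology \<Rightarrow> ('a \<Rightarrow> 'b) \<Rightarrow> bool" where
  "local_homeomorphism X Y \<tau> \<longleftrightarrow>
    \<tau> \<in> topspace X \<rightarrow> topspace Y \<and>
    (\<forall>x\<in>topspace X. \<exists>U. openin X U \<and> x \<in> U \<and> openin Y (\<tau> ` U) \<and>
       homeomorphic_map (subtopology X U) (subtopology Y (\<tau> ` U)) \<tau>)"

definition totally_disconnected_space :: "'a topology \<Rightarrow> bool" where
  "totally_disconnected_space X \<longleftrightarrow> (\<forall>C. connectedin X C \<longrightarrow> (\<exists>x. C \<subseteq> {x}))"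

locale ample_groupoid =
  fixes G :: "'g groupoid"
  assumes units_subset: "units G \<subseteq> arrows G"
    and rng_in_units: "g \<in> arrows G \<Longrightarrow> rng G g \<in> units G"
    and src_in_units: "g \<in> arrows G \<Longrightarrow> src G g \<in> units G"
    and rng_unit: "x \<in> units G \<Longrightarrow> rng G x = x"
    and src_unit: "x \<in> units G \<Longrightarrow> src G x = x"
    and mul_in_arrows: "\<lbrakk>g \<in> arrows G; h \<in> arrows G; src G g = rng G h\<rbrakk> \<Longrightarrow> mul G g h \<in> arrows G"
    and rng_mul: "\<lbrakk>g \<in> arrows G; h \<in> arrows G; src G g = rng G h\<rbrakk> \<Longrightarrow> rng G (mul G g h) = rng G g"
    and src_mul: "\<lbrakk>g \<in> arrows G; h \<in> arrows G; src G g = rng G h\<rbrakk> \<Longrightarrow> src G (mul G g h) = src G h"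
    and mul_assoc:
      "\<lbrakk>g \<in> arrows G; h \<in> arrows G; k \<in> arrows G; src G g = rng G h; src G h = rng G k\<rbrakk>
        \<Longrightarrow> mul G (mul G g h) k = mul G g (mul G h k)"
    and mul_rng_left: "g \<in> arrows G \<Longrightarrow> mul G (rng G g) g = g"
    and mul_src_right: "g \<in> arrows G \<Longrightarrow> mul G g (src G g) = g"
    and ginv_in_arrows: "g \<in> arrows G \<Longrightarrow> ginv G g \<in> arrows G"
    and rng_ginv: "g \<in> arrows G \<Longrightarrow> rng G (ginv G g) = src G g"
    and src_ginv: "g \<in> arrows G \<Longrightarrow> src G (ginv G g) = rng G g"
    and mul_ginv_right: "g \<in> arrows G \<Longrightarrow> mul G g (ginv G g) = rng G g"
    and mul_ginv_left: "g \<in> arrows G \<Longrightarrow> mul G (ginv G g) g = src G g"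
    and continuous_mul:
      "continuous_map
         (subtopology (prod_topology (gtop G) (gtop G))
            {(g, h). g \<in> arrows G \<and> h \<in> arrows G \<and> src G g = rng G h})
         (gtop G) (\<lambda>(g, h). mul G g h)"
    and continuous_ginv: "continuous_map (gtop G) (gtop G) (ginv G)"
    and Hausdorff: "Hausdorff_space (gtop G)"
    and locally_compact: "locally_compact_space (gtop G)"
    and etale_rng: "local_homeomorphism (gtop G) (unit_top G) (rng G)"
    and etale_src: "local_homeomorphism (gtop G) (unit_top G) (src G)"
    and totally_disconnected_units: "totally_disconnected_space (unit_top G)"

definition compact_open_bisection :: "'g groupoid \<Rightarrow> 'g set \<Rightarrow> bool" where
  "compact_open_bisection G V \<longleftrightarrow>
    openin (gtop G) V \<and> compactin (gtop G) V \<and> inj_on (rng G) V \<and> inj_on (src G) V"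

text \<open>Composable tuples are lists. For \<open>n = 0\<close> the list \<open>[x]\<close> encodes the unit \<open>x\<close>,
  so that the anchor map is \<open>rng G \<circ> hd\<close> for every \<open>n\<close>.\<close>

definition tuples :: "'g groupoid \<Rightarrow> nat \<Rightarrow> 'g list set" where
  "tuples G n =
    (if n = 0 then {[x] | x. x \<in> units G}
     else {gs. length gs = n \<and> set gs \<subseteq> arrows G \<and>
               (\<forall>i. Suc i < n \<longrightarrow> src G (gs ! i) = rng G (gs ! Suc i))})"

text \<open>The subspace topology of the product topology on the \<open>n\<close>-fold power of the space of
  arrows (of the space of arrows itself for \<open>n = 0\<close>).\<close>

definition tuple_top :: "'g groupoid \<Rightarrow> nat \<Rightarrow> 'g list topology" where
  "tuple_top G n =
    pullback_topology (tuples G n) (\<lambda>gs. \<lambda>i\<in>{..<length gs}. gs ! i)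
      (product_topology (\<lambda>_. gtop G) {..<max n 1})"

definition anchor :: "'g groupoid \<Rightarrow> 'g list \<Rightarrow> 'g" where
  "anchor G gs = rng G (hd gs)"

definition compact_open_slice :: "'g groupoid \<Rightarrow> nat \<Rightarrow> 'g list set \<Rightarrow> bool" where
  "compact_open_slice G n V \<longleftrightarrow>
    openin (tuple_top G n) V \<and> compactin (tuple_top G n) V \<and>
    homeomorphic_map (subtopology (tuple_top G n) V)
      (subtopology (unit_top G) (anchor G ` V)) (anchor G)"

section \<open>The convolution ring and its modules\<close>

text \<open>Compactly supported continuous integer-valued functions, extended by \<open>0\<close> outside the space.\<close>

definition Cc :: "'a topology \<Rightarrow> ('a \<Rightarrow> int) set" where
  "Cc X = {f. (\<forall>x. x \<notin> topspace X \<longrightarrow> f x = 0) \<and>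
              continuous_map X (discrete_topology UNIV) f \<and>
              compactin X (X closure_of {x \<in> topspace X. f x \<noteq> 0})}"

text \<open>Below, \<open>sum'\<close> is the library's sum over a possibly infinite index set with finitely many
  nonzero summands.\<close>

definition convolution :: "'g groupoid \<Rightarrow> ('g \<Rightarrow> int) \<Rightarrow> ('g \<Rightarrow> int) \<Rightarrow> ('g \<Rightarrow> int)" where
  "convolution G f1 f2 =
    (\<lambda>g. if g \<in> arrows G
         then sum' (\<lambda>h. f1 (ginv G h) * f2 (mul G h g)) {h \<in> arrows G. src G h = rng G g}
         else 0)"

text \<open>The convolution ring has no unit in general, so the locale \<open>module\<close> does not apply. Only the
  additive group and the scalar multiplication of the record \<open>module\<close> are used.\<close>

locale groupoid_module = abelian_group M
  for G :: "'g groupoid" and M :: "('g \<Rightarrow> int, 'm) module" (structure) +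
  assumes smult_closed: "\<lbrakk>f \<in> Cc (gtop G); m \<in> carrier M\<rbrakk> \<Longrightarrow> f \<odot> m \<in> carrier M"
    and smult_l_distr:
      "\<lbrakk>f \<in> Cc (gtop G); h \<in> Cc (gtop G); m \<in> carrier M\<rbrakk>
        \<Longrightarrow> (\<lambda>g. f g + h g) \<odot> m = f \<odot> m \<oplus> h \<odot> m"
    and smult_r_distr:
      "\<lbrakk>f \<in> Cc (gtop G); m \<in> carrier M; m' \<in> carrier M\<rbrakk>
        \<Longrightarrow> f \<odot> (m \<oplus> m') = f \<odot> m \<oplus> f \<odot> m'"
    and smult_assoc:
      "\<lbrakk>f \<in> Cc (gtop G); h \<in> Cc (gtop G); m \<in> carrier M\<rbrakk>
        \<Longrightarrow> convolution G f h \<odot> m = f \<odot> (h \<odot> m)"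
    and nondegenerate:
      "generate (add_monoid M) {f \<odot> m | f m. f \<in> Cc (gtop G) \<and> m \<in> carrier M} = carrier M"

definition tuple_module :: "'g groupoid \<Rightarrow> nat \<Rightarrow> ('g \<Rightarrow> int, 'g list \<Rightarrow> int) module" where
  "tuple_module G n =
    \<lparr>carrier = Cc (tuple_top G n), mult = undefined, one = undefined,
     zero = (\<lambda>_. 0), add = (\<lambda>m m' gs. m gs + m' gs),
     smult = (\<lambda>f m gs. if gs \<in> tuples G n
       then sum' (\<lambda>g. f (ginv G g) * m (mul G g (hd gs) # tl gs))
              {g \<in> arrows G. src G g = anchor G gs}
       else 0)\<rparr>"

definition module_homs ::
  "'g groupoid \<Rightarrow> ('g \<Rightarrow> int, 'a) module \<Rightarrow> ('g \<Rightarrow> int, 'b) module \<Rightarrow> ('a \<Rightarrow> 'b) monoid" where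
  "module_homs G A B =
    \<lparr>carrier = {\<phi> \<in> hom (add_monoid A) (add_monoid B) \<inter> extensional (carrier A).
                 \<forall>f\<in>Cc (gtop G). \<forall>a\<in>carrier A. \<phi> (f \<odot>\<^bsub>A\<^esub> a) = f \<odot>\<^bsub>B\<^esub> \<phi> a},
     mult = (\<lambda>\<phi> \<psi>. \<lambda>a\<in>carrier A. \<phi> a \<oplus>\<^bsub>B\<^esub> \<psi> a),
     one = (\<lambda>a\<in>carrier A. \<zero>\<^bsub>B\<^esub>)\<rparr>"

section \<open>Cohomology via the bar resolution\<close>

definition pushforward :: "'a set \<Rightarrow> ('a \<Rightarrow> 'b) \<Rightarrow> ('a \<Rightarrow> int) \<Rightarrow> ('b \<Rightarrow> int)" where
  "pushforward X \<tau> f = (\<lambda>y. sum' f {x \<in> X. \<tau> x = y})"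

text \<open>\<open>merge_at G i [g\<^sub>0, \<dots>] = [g\<^sub>0, \<dots>, g\<^sub>i g\<^sub>i\<^sub>+\<^sub>1, \<dots>]\<close>\<close>

definition merge_at :: "'g groupoid \<Rightarrow> nat \<Rightarrow> 'g list \<Rightarrow> 'g list" where
  "merge_at G i gs = take i gs @ mul G (gs ! i) (gs ! Suc i) # drop (i + 2) gs"

definition bar_face :: "'g groupoid \<Rightarrow> nat \<Rightarrow> nat \<Rightarrow> 'g list \<Rightarrow> 'g list" where
  "bar_face G n i gs = (if i < n then merge_at G i gs else butlast gs)"

definition bar_boundary :: "'g groupoid \<Rightarrow> nat \<Rightarrow> ('g list \<Rightarrow> int) \<Rightarrow> ('g list \<Rightarrow> int)" where
  "bar_boundary G n f =
    (\<lambda>gs. \<Sum>i\<le>n. (-1) ^ i * pushforward (tuples G (Suc n)) (bar_face G n i) f gs)"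

definition hom_cochains ::
  "'g groupoid \<Rightarrow> ('g \<Rightarrow> int, 'm) module \<Rightarrow> nat \<Rightarrow> (('g list \<Rightarrow> int) \<Rightarrow> 'm) monoid" where
  "hom_cochains G M n = module_homs G (tuple_module G (Suc n)) M"

definition hom_coboundary ::
  "'g groupoid \<Rightarrow> nat \<Rightarrow> (('g list \<Rightarrow> int) \<Rightarrow> 'm) \<Rightarrow> (('g list \<Rightarrow> int) \<Rightarrow> 'm)" where
  "hom_coboundary G n \<phi> =
    compose (carrier (tuple_module G (n + 2))) \<phi> (bar_boundary G (Suc n))"

definition cocycles :: "(nat \<Rightarrow> 'a monoid) \<Rightarrow> (nat \<Rightarrow> 'a \<Rightarrow> 'a) \<Rightarrow> nat \<Rightarrow> 'a set" where
  "cocycles C d n = kernel (C n) (C (Suc n)) (d n)"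

definition coboundaries :: "(nat \<Rightarrow> 'a monoid) \<Rightarrow> (nat \<Rightarrow> 'a \<Rightarrow> 'a) \<Rightarrow> nat \<Rightarrow> 'a set" where
  "coboundaries C d n =
    (case n of 0 \<Rightarrow> {\<one>\<^bsub>C 0\<^esub>} | Suc k \<Rightarrow> d k ` carrier (C k))"

definition cohomology :: "(nat \<Rightarrow> 'a monoid) \<Rightarrow> (nat \<Rightarrow> 'a \<Rightarrow> 'a) \<Rightarrow> nat \<Rightarrow> 'a set monoid" where
  "cohomology C d n = ((C n)\<lparr>carrier := cocycles C d n\<rparr>) Mod coboundaries C d n"

definition cohomology_class :: "(nat \<Rightarrow> 'a monoid) \<Rightarrow> (nat \<Rightarrow> 'a \<Rightarrow> 'a) \<Rightarrow> nat \<Rightarrow> 'a \<Rightarrow> 'a set" where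
  "cohomology_class C d n c = coboundaries C d n #>\<^bsub>C n\<^esub> c"

section \<open>The sheaf associated to a module\<close>

definition unit_nhds :: "'g groupoid \<Rightarrow> 'g \<Rightarrow> 'g set set" where
  "unit_nhds G x = {U. openin (unit_top G) U \<and> compactin (unit_top G) U \<and> x \<in> U}"

definition cut :: "('g \<Rightarrow> int, 'm) module \<Rightarrow> 'g set \<Rightarrow> 'm set" where
  "cut M U = (\<lambda>m. indicator U \<odot>\<^bsub>M\<^esub> m) ` carrier M"

text \<open>The direct limit of the groups \<open>\<chi>\<^sub>U M\<close>, with transition maps \<open>m \<mapsto> \<chi>\<^sub>W m\<close>
  for \<open>W \<subseteq> U\<close>, is the quotient of their disjoint union by the following relation.\<close>

definition germ_rel ::
  "'g groupoid \<Rightarrow> ('g \<Rightarrow> int, 'm) module \<Rightarrow> 'g \<Rightarrow> (('g set \<times> 'm) \<times> ('g set \<times> 'm)) set" where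
  "germ_rel G M x =
    {((U, m), (U', m')). U \<in> unit_nhds G x \<and> m \<in> cut M U \<and> U' \<in> unit_nhds G x \<and> m' \<in> cut M U' \<and>
       (\<exists>W\<in>unit_nhds G x. W \<subseteq> U \<inter> U' \<and> indicator W \<odot>\<^bsub>M\<^esub> m = indicator W \<odot>\<^bsub>M\<^esub> m')}"

text \<open>A point of the sheaf is a pair of its base point and an element of the direct limit there.\<close>

type_synonym ('g, 'm) germ = "'g \<times> ('g set \<times> 'm) set"

text \<open>The class of \<open>m\<close> at \<open>x\<close>, for arbitrary \<open>m\<close> in \<open>M\<close>: all pairs \<open>(U, \<chi>\<^sub>U m)\<close> are equivalent, and
  \<open>\<chi>\<^sub>U m = m\<close> if \<open>m \<in> \<chi>\<^sub>U M\<close>.\<close>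

definition germ_at ::
  "'g groupoid \<Rightarrow> ('g \<Rightarrow> int, 'm) module \<Rightarrow> 'g \<Rightarrow> 'm \<Rightarrow> ('g, 'm) germ" where
  "germ_at G M x m =
    (x, germ_rel G M x `` {(U, indicator U \<odot>\<^bsub>M\<^esub> m) | U. U \<in> unit_nhds G x})"

text \<open>The fiber as an additive group (the multiplicative part of the record is not used). Addition
  is computed on representatives; the unions run over all of them, which give the same class.\<close>

definition fiber :: "'g groupoid \<Rightarrow> ('g \<Rightarrow> int, 'm) module \<Rightarrow> 'g \<Rightarrow> ('g, 'm) germ ring" where
  "fiber G M x =
    \<lparr>carrier = {x} \<times> ((SIGMA U:unit_nhds G x. cut M U) // germ_rel G M x),
     mult = undefined, one = undefined,
     zero = germ_at G M x \<zero>\<^bsub>M\<^esub>,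
     add = (\<lambda>a b. (x, \<Union>(U, m)\<in>snd a. \<Union>(U', m')\<in>snd b. snd (germ_at G M x (m \<oplus>\<^bsub>M\<^esub> m'))))\<rparr>"

text \<open>The generating sets form a basis.\<close>

definition sheaf_top ::
  "'g groupoid \<Rightarrow> ('g \<Rightarrow> int, 'm) module \<Rightarrow> ('g, 'm) germ topology" where
  "sheaf_top G M =
    topology_generated_by
      {(\<lambda>x. germ_at G M x m) ` U | U m.
         openin (unit_top G) U \<and> compactin (unit_top G) U \<and> m \<in> cut M U}"

text \<open>\<open>g \<cdot> [m]\<^bsub>s(g)\<^esub> = [\<chi>\<^sub>V m]\<^bsub>r(g)\<^esub>\<close> for any compact open bisection \<open>V\<close> containing \<open>g\<close>.\<close>

definition sheaf_act ::
  "'g groupoid \<Rightarrow> ('g \<Rightarrow> int, 'm) module \<Rightarrow> 'g \<Rightarrow> ('g, 'm) germ \<Rightarrow> ('g, 'm) germ" where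
  "sheaf_act G M g a =
    (rng G g, \<Union>V\<in>{V. compact_open_bisection G V \<and> g \<in> V}. \<Union>(U, m)\<in>snd a.
       snd (germ_at G M (rng G g) (indicator V \<odot>\<^bsub>M\<^esub> m)))"

text \<open>The identification of \<open>M\<close> with the compactly supported continuous sections of its sheaf.\<close>

definition as_section ::
  "'g groupoid \<Rightarrow> ('g \<Rightarrow> int, 'm) module \<Rightarrow> 'm \<Rightarrow> 'g \<Rightarrow> ('g, 'm) germ" where
  "as_section G M m = (\<lambda>x\<in>units G. germ_at G M x m)"

section \<open>Cohomology via continuous cochains\<close>

definition continuous_cochains ::
  "'g groupoid \<Rightarrow> ('g \<Rightarrow> int, 'm) module \<Rightarrow> nat \<Rightarrow> ('g list \<Rightarrow> ('g, 'm) germ) monoid" where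
  "continuous_cochains G M n =
    \<lparr>carrier = {f \<in> extensional (tuples G n). continuous_map (tuple_top G n) (sheaf_top G M) f \<and>
                 (\<forall>gs\<in>tuples G n. f gs \<in> carrier (fiber G M (anchor G gs)))},
     mult = (\<lambda>f h. \<lambda>gs\<in>tuples G n. f gs \<oplus>\<^bsub>fiber G M (anchor G gs)\<^esub> h gs),
     one = (\<lambda>gs\<in>tuples G n. \<zero>\<^bsub>fiber G M (anchor G gs)\<^esub>)\<rparr>"

text \<open>\<open>(g\<^sub>0, \<dots>, g\<^sub>n) \<mapsto> (g\<^sub>1, \<dots>, g\<^sub>n)\<close>, read as \<open>g\<^sub>0 \<mapsto> s(g\<^sub>0)\<close> for \<open>n = 0\<close>\<close>

definition tuple_tail :: "'g groupoid \<Rightarrow> 'g list \<Rightarrow> 'g list" where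
  "tuple_tail G gs = (if tl gs = [] then [src G (hd gs)] else tl gs)"

text \<open>\<open>(g\<^sub>1, \<dots>, g\<^sub>n) \<mapsto> (r(g\<^sub>1), g\<^sub>1, \<dots>, g\<^sub>n)\<close>, read as \<open>x \<mapsto> x\<close> for \<open>n = 0\<close>\<close>

definition unit_cons :: "'g groupoid \<Rightarrow> nat \<Rightarrow> 'g list \<Rightarrow> 'g list" where
  "unit_cons G n gs = (if n = 0 then gs else rng G (hd gs) # gs)"

definition continuous_coboundary ::
  "'g groupoid \<Rightarrow> ('g \<Rightarrow> int, 'm) module \<Rightarrow> nat \<Rightarrow>
    ('g list \<Rightarrow> ('g, 'm) germ) \<Rightarrow> ('g list \<Rightarrow> ('g, 'm) germ)" where
  "continuous_coboundary G M n f = (\<lambda>gs\<in>tuples G (Suc n).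
    let A = fiber G M (anchor G gs) in
    if n = 0 then sheaf_act G M (hd gs) (f [src G (hd gs)]) \<ominus>\<^bsub>A\<^esub> f [rng G (hd gs)]
    else sheaf_act G M (hd gs) (f (tl gs))
      \<oplus>\<^bsub>A\<^esub> (\<Oplus>\<^bsub>A\<^esub>i\<in>{1..n}. [((-1) ^ i :: int)] \<cdot>\<^bsub>A\<^esub> f (merge_at G (i - 1) gs))
      \<oplus>\<^bsub>A\<^esub> [((-1) ^ (n + 1) :: int)] \<cdot>\<^bsub>A\<^esub> f (butlast gs))"

end

theory Submission
  imports Defs
begin

text \<open>A homomorphism \<open>\<phi>\<close> on \<open>\<int>[\<G>\<^sup>(\<^sup>n\<^sup>+\<^sup>1\<^sup>)]\<close> is determined by its values on indicators of slices, that is,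
  of compact open sets on which the anchor map is injective. For a slice \<open>V\<close> through \<open>y\<close> the germ
  of \<open>\<phi>(\<chi>\<^sub>V)\<close> at \<open>p(y)\<close> does not depend on \<open>V\<close>, and \<open>y \<mapsto> [\<phi>(\<chi>\<^sub>V)]\<^bsub>p(y)\<^esub>\<close> is a continuous equivariant map
  to the sheaf. Conversely a continuous equivariant map \<open>E\<close> yields the homomorphism that sends \<open>f\<close> to
  the element of the module with germs \<open>\<Sum>\<^bsub>p(y) = x\<^esub> f(y) E(y)\<close>; it exists since sections of the sheaf can be
  glued over compact open sets. Finally, an equivariant map on \<open>\<G>\<^sup>(\<^sup>n\<^sup>+\<^sup>1\<^sup>)\<close> is the same as a cochain on
  \<open>\<G>\<^sup>(\<^sup>n\<^sup>)\<close>, because \<open>(g\<^sub>0, \<dots>, g\<^sub>n) = g\<^sub>0 \<cdot> (s(g\<^sub>0), g\<^sub>1, \<dots>, g\<^sub>n)\<close>. The face maps are anchor preserving local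
  homeomorphisms, so they push \<open>\<chi>\<^sub>V\<close> forward to the indicator of the image slice, and the
  coboundaries can be compared face by face.\<close>

section \<open>Compact open sets and compactly supported functions\<close>

text \<open>The convolution ring has no unit, so nondegeneracy has to supply what a unit would give:
  every element of \<open>M\<close> is fixed by the indicators of all sufficiently large compact
  open sets of units (\<open>local_unit\<close>). This is what makes an element determined by its
  germs. The identification of \<open>M\<close> with the compactly supported sections thus becomes
  two statements, uniqueness (\<open>germ_ext\<close>) and gluing (\<open>germ_glue\<close>).

  The inverse is not defined on indicators of slices and then extended: a function is a combination
  of such indicators in many ways, and independence of the choice would have to be proved. The fibre
  sum makes sense for every function at once, so additivity is checked fibrewise; slices serve to
  show that the sum is realised by an element of \<open>M\<close> and that it respects scalars.

  Statements linear in each function are reduced to indicators of bisections and slices, where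
  products become products of sets. One setting, an action of \<open>G\<close> on an etale space,
  covers \<open>G\<close> itself and all tuple spaces.\<close>

definition compact_open :: "'a topology \<Rightarrow> 'a set \<Rightarrow> bool" where
  "compact_open X U \<longleftrightarrow> openin X U \<and> compactin X U"

lemma compact_open_subset: "compact_open X U \<Longrightarrow> U \<subseteq> topspace X"
  by (simp add: compact_open_def openin_subset)

lemma compact_open_empty [simp]: "compact_open X {}"
  by (simp add: compact_open_def)

lemma compact_open_Un: "compact_open X U \<Longrightarrow> compact_open X V \<Longrightarrow> compact_open X (U \<union> V)"
  by (auto simp: compact_open_def compactin_Un)

lemma compact_open_Int:
  "Hausdorff_space X \<Longrightarrow> compact_open X U \<Longrightarrow> compact_open X V \<Longrightarrow> compact_open X (U \<inter> V)"
  by (auto simp: compact_open_def compactin_Int)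

lemma compact_open_Int_clopen:
  "compact_open X U \<Longrightarrow> openin X V \<Longrightarrow> closedin X V \<Longrightarrow> compact_open X (U \<inter> V)"
  by (auto simp: compact_open_def compact_Int_closedin)

lemma compact_open_Diff:
  assumes "Hausdorff_space X" "compact_open X U" "compact_open X V"
  shows "compact_open X (U - V)"
proof -
  have "closedin X V"
    using assms by (simp add: compact_open_def compactin_imp_closedin)
  moreover have "U - V = U \<inter> (topspace X - V)"
    using compact_open_subset assms by blast
  moreover have "closedin X (topspace X - V)"
    using assms(3) by (auto simp: compact_open_def)
  ultimately show ?thesis
    using assms(2) compact_open_Int_clopen by (metis openin_diff openin_topspace)
qed

text \<open>By compactness finitely many good sets cover \<open>U\<close>. Since goodness passes to
  compact open subsets, they can be made disjoint one after the other, so that \<open>un\<close> has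
  to treat disjoint unions only.\<close>

lemma compact_open_induct [consumes 2, case_names local empty subset union]:
  assumes "Hausdorff_space X" "compact_open X U"
    and loc: "\<And>x. x \<in> U \<Longrightarrow> \<exists>W. compact_open X W \<and> x \<in> W \<and> P W"
    and emp: "P {}"
    and sub: "\<And>V W. P V \<Longrightarrow> compact_open X V \<Longrightarrow> compact_open X W \<Longrightarrow> W \<subseteq> V \<Longrightarrow> P W"
    and un: "\<And>V W. P V \<Longrightarrow> P W \<Longrightarrow> compact_open X V \<Longrightarrow> compact_open X W \<Longrightarrow> V \<inter> W = {}
              \<Longrightarrow> P (V \<union> W)"
  shows "P U"
proof -
  have "\<exists>F. finite F \<and> F \<subseteq> {W. compact_open X W \<and> P W} \<and> U \<subseteq> \<Union>F"
  proof -
    have "compactin X U" "\<forall>W\<in>{W. compact_open X W \<and> P W}. openin X W"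
      using assms(2) by (auto simp: compact_open_def)
    moreover have "U \<subseteq> \<Union>{W. compact_open X W \<and> P W}"
      using loc by auto
    ultimately show ?thesis
      unfolding compactin_def by meson
  qed
  then obtain F where F: "finite F" "F \<subseteq> {W. compact_open X W \<and> P W}" "U \<subseteq> \<Union>F"
    by blast
  have "compact_open X (\<Union>F) \<and> P (\<Union>F)"
    using F(1,2)
  proof (induction F)
    case (insert W F)
    then have W: "compact_open X W" "P W" and IH: "compact_open X (\<Union>F)" "P (\<Union>F)"
      by auto
    let ?D = "\<Union>F - W"
    have D: "compact_open X ?D" "P ?D"
      using IH W compact_open_Diff[OF assms(1) IH(1) W(1)] sub[OF IH(2,1), of ?D] by auto
    then have "P (W \<union> ?D)"
      using un W by blast
    then show ?case
      using W IH by (simp add: compact_open_Un)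
  qed (auto simp: emp)
  then show ?thesis
    using sub assms(2) F(3) by blast
qed

lemma compact_open_base:
  assumes "locally_compact_space X" "Hausdorff_space X" "totally_disconnected_space X"
    and "openin X S" "x \<in> S"
  shows "\<exists>U. compact_open X U \<and> x \<in> U \<and> U \<subseteq> S"
proof -
  have "x \<in> topspace X"
    using assms(4,5) openin_subset by blast
  then obtain N K where NK: "openin X N" "compactin X K" "x \<in> N" "N \<subseteq> K"
    using assms(1) by (auto simp: locally_compact_space_def)
  define S' where "S' = S \<inter> N"
  have S': "openin X S'" "x \<in> S'" "S' \<subseteq> K" "S' \<subseteq> S"
    using NK assms(4,5) by (auto simp: S'_def)
  let ?K = "subtopology X K"
  have tK: "topspace ?K = K"
    using NK(2) compactin_subset_topspace by fastforce
  have op: "openin ?K S'"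
    using S' by (metis Int_absorb2 openin_subtopology_Int)
  \<comment> \<open>Total disconnectedness enters here: in the compact space \<open>K\<close>, closed sets that no connected set
    meets simultaneously are separated by a clopen set.\<close>
  have "separated_between ?K {x} (K - S')"
  proof (rule cut_wire_fence_theorem)
    show "compact_space ?K" "Hausdorff_space ?K"
      using NK(2) assms(2) by (auto simp: compactin_subspace Hausdorff_space_subtopology)
    show "closedin ?K {x}"
      using S' tK Hausdorff_space_subtopology[OF assms(2), of K]
      by (intro closedin_Hausdorff_singleton) auto
    show "closedin ?K (K - S')"
      using op tK by (metis closedin_diff closedin_topspace)
    show "disjnt C {x} \<or> disjnt C (K - S')" if "connectedin ?K C" for C
    proof -
      have "connectedin X C"
        using that by (simp add: connectedin_subtopology)
      then obtain z where "C \<subseteq> {z}"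
        using assms(3) unfolding totally_disconnected_space_def by blast
      then show ?thesis
        using S' by (auto simp: disjnt_def)
    qed
  qed
  then obtain A where A: "openin ?K A" "closedin ?K A" "x \<in> A" "disjnt A (K - S')"
    unfolding separated_between by (auto simp: disjnt_def)
  have sub: "A \<subseteq> S'"
    using A closedin_subset[OF A(2)] tK by (auto simp: disjnt_def)
  obtain T where T: "openin X T" "A = T \<inter> K"
    using A(1) openin_subtopology by metis
  \<comment> \<open>\<open>A\<close> is open in \<open>K\<close> only, and \<open>K\<close> is a
    mere compact neighbourhood. But \<open>A\<close> lies in \<open>S'\<close>, which is open in
    \<open>X\<close> and contained in \<open>K\<close>, so \<open>K\<close> may be replaced by
    \<open>S'\<close> here.\<close>
  have "A = T \<inter> S'"
    using T S' sub by blast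
  then have "openin X A"
    using T S' by blast
  moreover have "compactin X A"
  proof (rule closed_compactin[OF NK(2)])
    show "A \<subseteq> K"
      using sub S'(3) by blast
    show "closedin X A"
      using A(2) compactin_imp_closedin[OF assms(2) NK(2)] by (rule closedin_trans_full)
  qed
  ultimately show ?thesis
    using A(3) sub S'(4) by (auto simp: compact_open_def)
qed

lemma continuous_map_discrete_iff:
  "continuous_map X (discrete_topology UNIV) f \<longleftrightarrow>
    (\<forall>x\<in>topspace X. \<exists>U k. openin X U \<and> x \<in> U \<and> (\<forall>z\<in>U. f z = k))" (is "?l \<longleftrightarrow> ?r")
proof
  assume l: ?l
  show ?r
  proof
    fix x assume x: "x \<in> topspace X"
    have "openin X {z \<in> topspace X. f z \<in> {f x}}"
      using l openin_continuous_map_preimage[of X "discrete_topology UNIV" f "{f x}"] by simp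
    then show "\<exists>U k. openin X U \<and> x \<in> U \<and> (\<forall>z\<in>U. f z = k)"
      using x by (intro exI[of _ "{z \<in> topspace X. f z \<in> {f x}}"] exI[of _ "f x"]) simp
  qed
next
  assume r: ?r
  have "openin X {x \<in> topspace X. f x \<in> U}" for U
  proof (subst openin_subopen, safe)
    fix x assume x: "x \<in> topspace X" "f x \<in> U"
    then obtain W k where W: "openin X W" "x \<in> W" "\<forall>z\<in>W. f z = k"
      using r by blast
    then have "W \<subseteq> {x \<in> topspace X. f x \<in> U}"
      using x openin_subset[OF W(1)] by auto
    then show "\<exists>T. openin X T \<and> x \<in> T \<and> T \<subseteq> {x \<in> topspace X. f x \<in> U}"
      using W by blast
  qed
  then show ?l
    by (simp add: continuous_map_def)
qed

text \<open>A continuous map to a discrete space has a clopen nonvanishing set, so taking the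
  closure in \<open>Cc\<close> changes nothing.\<close>

lemma Cc_iff:
  "f \<in> Cc X \<longleftrightarrow> (\<forall>x. x \<notin> topspace X \<longrightarrow> f x = 0) \<and>
    continuous_map X (discrete_topology UNIV) f \<and> compactin X {x \<in> topspace X. f x \<noteq> 0}"
proof -
  have "X closure_of {x \<in> topspace X. f x \<noteq> 0} = {x \<in> topspace X. f x \<noteq> 0}"
    if "continuous_map X (discrete_topology UNIV) f"
  proof -
    have "closedin X {x \<in> topspace X. f x \<in> - {0}}"
      using that closedin_continuous_map_preimage[of X "discrete_topology UNIV" f "- {0}"]
      by simp
    then show ?thesis
      by (simp add: closure_of_closedin)
  qed
  then show ?thesis
    unfolding Cc_def by auto
qed

lemma Cc_level_clopen:
  assumes "f \<in> Cc X"
  shows "openin X {x \<in> topspace X. f x \<in> S}" "closedin X {x \<in> topspace X. f x \<in> S}"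
  using assms openin_continuous_map_preimage[of X "discrete_topology UNIV" f]
    closedin_continuous_map_preimage[of X "discrete_topology UNIV" f]
  by (auto simp: Cc_iff)

lemma Cc_support: "f \<in> Cc X \<Longrightarrow> compact_open X {x \<in> topspace X. f x \<noteq> 0}"
  using Cc_level_clopen(1)[of f X "- {0}"] by (auto simp: compact_open_def Cc_iff)

lemma Cc_outside: "f \<in> Cc X \<Longrightarrow> x \<notin> topspace X \<Longrightarrow> f x = 0"
  by (simp add: Cc_iff)

lemma Cc_zero [simp]: "(\<lambda>_. 0) \<in> Cc X"
  by (simp add: Cc_iff)

text \<open>The condition on \<open>h\<close> confines the new support to the union of the two old
  ones. Sums, negatives, multiples and products are all special cases.\<close>

lemma Cc_combine:
  assumes "f \<in> Cc X" "g \<in> Cc X" and h0: "h 0 0 = 0"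
  shows "(\<lambda>x. h (f x) (g x)) \<in> Cc X"
proof -
  have cont: "continuous_map X (discrete_topology UNIV) (\<lambda>x. h (f x) (g x))"
    unfolding continuous_map_discrete_iff
  proof
    fix x assume x: "x \<in> topspace X"
    have "\<exists>U k. openin X U \<and> x \<in> U \<and> (\<forall>z\<in>U. f z = k)" 
      "\<exists>V k. openin X V \<and> x \<in> V \<and> (\<forall>z\<in>V. g z = k)"
      using assms x by (simp_all add: Cc_iff continuous_map_discrete_iff)
    then obtain U k V l where "openin X U" "x \<in> U" "\<forall>z\<in>U. f z = k"
      "openin X V" "x \<in> V" "\<forall>z\<in>V. g z = l"
      by blast
    then show "\<exists>U k. openin X U \<and> x \<in> U \<and> (\<forall>z\<in>U. h (f z) (g z) = k)"
      by (intro exI[of _ "U \<inter> V"] exI[of _ "h k l"]) auto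
  qed
  let ?S = "{x \<in> topspace X. f x \<noteq> 0} \<union> {x \<in> topspace X. g x \<noteq> 0}"
  have "closedin X {x \<in> topspace X. h (f x) (g x) \<in> - {0}}"
    using cont closedin_continuous_map_preimage[of X "discrete_topology UNIV" "\<lambda>x. h (f x) (g x)" "- {0}"]
    by simp
  moreover have "compactin X ?S"
    using assms by (auto simp: Cc_iff intro: compactin_Un)
  moreover have "{x \<in> topspace X. h (f x) (g x) \<in> - {0}} \<subseteq> ?S"
    using h0 by auto
  ultimately have "compactin X {x \<in> topspace X. h (f x) (g x) \<in> - {0}}"
    using closed_compactin by blast
  then show ?thesis
    using cont assms h0 by (simp add: Cc_iff)
qed

lemma Cc_add: "f \<in> Cc X \<Longrightarrow> g \<in> Cc X \<Longrightarrow> (\<lambda>x. f x + g x) \<in> Cc X"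
  by (rule Cc_combine) auto

lemma Cc_uminus: "f \<in> Cc X \<Longrightarrow> (\<lambda>x. - f x) \<in> Cc X"
  using Cc_combine[of f X f "\<lambda>a b. - a"] by simp

lemma Cc_mult: "f \<in> Cc X \<Longrightarrow> g \<in> Cc X \<Longrightarrow> (\<lambda>x. f x * g x) \<in> Cc X"
  by (rule Cc_combine) auto

lemma Cc_scale: "f \<in> Cc X \<Longrightarrow> (\<lambda>x. c * f x) \<in> Cc X"
  using Cc_combine[of f X f "\<lambda>a b. c * a"] by simp

lemma indicator_in_Cc:
  assumes "Hausdorff_space X" "compact_open X U"
  shows "indicator U \<in> Cc X"
proof -
  have cl: "openin X U" "openin X (topspace X - U)" and sub: "U \<subseteq> topspace X"
    using assms compactin_imp_closedin compact_open_subset[OF assms(2)]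
    by (auto simp: compact_open_def openin_diff)
  have "continuous_map X (discrete_topology UNIV) (indicator U :: _ \<Rightarrow> int)"
    unfolding continuous_map_discrete_iff
  proof
    fix x assume "x \<in> topspace X"
    then show "\<exists>V k. openin X V \<and> x \<in> V \<and> (\<forall>z\<in>V. indicator U z = (k :: int))"
      using cl
      by (intro exI[of _ "if x \<in> U then U else topspace X - U"] exI[of _ "if x \<in> U then 1 else 0"])
        (auto simp: indicator_def)
  qed
  moreover have "{x \<in> topspace X. indicator U x \<noteq> (0 :: int)} = U"
    using sub by (auto simp: indicator_def)
  ultimately show ?thesis
    using assms sub by (auto simp: Cc_iff compact_open_def indicator_def)
qed

text \<open>\<open>B\<close> stands for the slices or the bisections. As \<open>f\<close> is locally
  constant, its support splits into finitely many disjoint members of \<open>B\<close> on each of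
  which \<open>f\<close> is constant, so \<open>f\<close> is an integer combination of their
  indicators.\<close>

lemma Cc_induct [consumes 2, case_names base cover subset indicator add uminus zero]:
  assumes Y: "Hausdorff_space Y" and f: "f \<in> Cc Y"
    and base: "\<And>V. B V \<Longrightarrow> compact_open Y V"
    and cover: "\<And>y. y \<in> topspace Y \<Longrightarrow> \<exists>V. B V \<and> y \<in> V"
    and Bsub: "\<And>V W. B V \<Longrightarrow> compact_open Y W \<Longrightarrow> W \<subseteq> V \<Longrightarrow> B W"
    and ind: "\<And>V. B V \<Longrightarrow> P (indicator V)"
    and add: "\<And>f g. f \<in> Cc Y \<Longrightarrow> g \<in> Cc Y \<Longrightarrow> P f \<Longrightarrow> P g \<Longrightarrow> P (\<lambda>y. f y + g y)"
    and um: "\<And>f. f \<in> Cc Y \<Longrightarrow> P f \<Longrightarrow> P (\<lambda>y. - f y)"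
    and zero: "P (\<lambda>_. 0)"
  shows "P f"
proof -
  \<comment> \<open>The quantification over all compact open subsets \<open>W'\<close> makes the
    property hereditary, as the induction over compact open sets demands.\<close>
  define Q where "Q W \<longleftrightarrow> (\<forall>W'. compact_open Y W' \<longrightarrow> W' \<subseteq> W \<longrightarrow> P (\<lambda>y. f y * indicator W' y))" for W
  have ind_Cc: "(\<lambda>y. f y * indicator W y) \<in> Cc Y" if "compact_open Y W" for W
    using Cc_mult[OF f indicator_in_Cc[OF Y that]] .
  have scale: "P (\<lambda>y. k * indicator V y)" if V: "B V" for k V
  proof -
    have iV: "indicator V \<in> Cc Y"
      using Y V base indicator_in_Cc by blast
    have nat: "P (\<lambda>y. int n * indicator V y)" for n
    proof (induction n)
      case (Suc n)
      have "P (\<lambda>y. int n * indicator V y + indicator V y)"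
        by (rule add) (use Suc iV ind[OF V] Cc_scale in auto)
      then show ?case
        by (simp add: algebra_simps)
    qed (simp add: zero)
    show ?thesis
    proof (cases "k \<ge> 0")
      case True
      then show ?thesis using nat[of "nat k"] by simp
    next
      case False
      have "P (\<lambda>y. - (int (nat (- k)) * indicator V y))"
        using Cc_scale[OF iV] nat by (rule um)
      then show ?thesis using False by simp
    qed
  qed
  have "Q {y \<in> topspace Y. f y \<noteq> 0}"
    using Y Cc_support[OF f]
  proof (induction rule: compact_open_induct)
    case (local y)
    then have y: "y \<in> topspace Y" by simp
    then obtain V where V: "B V" "y \<in> V"
      using cover by blast
    \<comment> \<open>Level sets of \<open>f\<close> are clopen, so \<open>W\<close> is still
      compact open, and \<open>f\<close> has the constant value \<open>f y\<close> on it.\<close>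
    define W where "W = V \<inter> {z \<in> topspace Y. f z \<in> {f y}}"
    have W: "compact_open Y W"
      unfolding W_def using Cc_level_clopen[OF f] base V by (blast intro: compact_open_Int_clopen)
    have "Q W"
      unfolding Q_def
    proof safe
      fix W' assume W': "compact_open Y W'" "W' \<subseteq> W"
      then have "B W'"
        using Bsub[OF V(1) W'(1)] by (auto simp: W_def)
      moreover have "(\<lambda>z. f z * indicator W' z) = (\<lambda>z. f y * indicator W' z)"
        using W'(2) by (auto simp: W_def indicator_def fun_eq_iff)
      ultimately show "P (\<lambda>z. f z * indicator W' z)"
        using scale by simp
    qed
    then show ?case
      using W V(2) y by (intro exI[of _ W]) (auto simp: W_def)
  next
    case empty
    then show ?case by (auto simp: Q_def zero)
  next
    case (subset V W)
    then show ?case by (auto simp: Q_def)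
  next
    case (union V W)
    show ?case
      unfolding Q_def
    proof safe
      fix U assume U: "compact_open Y U" "U \<subseteq> V \<union> W"
      have "P (\<lambda>y. f y * indicator (U \<inter> V) y + f y * indicator (U \<inter> W) y)"
        by (rule add) (use union U ind_Cc compact_open_Int[OF Y] in \<open>auto simp: Q_def\<close>)
      moreover have "(\<lambda>y. f y * indicator (U \<inter> V) y + f y * indicator (U \<inter> W) y)
          = (\<lambda>y. f y * indicator U y)"
        using U(2) union(5) by (auto simp: indicator_def fun_eq_iff)
      ultimately show "P (\<lambda>y. f y * indicator U y)"
        by simp
    qed
  qed
  then have "P (\<lambda>y. f y * indicator {y \<in> topspace Y. f y \<noteq> 0} y)"
    using Cc_support[OF f] by (auto simp: Q_def)
  moreover have "(\<lambda>y. f y * indicator {y \<in> topspace Y. f y \<noteq> 0} y) = f"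
    using Cc_outside[OF f] by (auto simp: indicator_def fun_eq_iff)
  ultimately show ?thesis by simp
qed

section \<open>Etale spaces\<close>

text \<open>A local homeomorphism over a base with enough compact open sets, in the form in which it
  is used: an open continuous map whose source is covered by compact open sets of injectivity. The
  instances are \<open>rng\<close>, \<open>src\<close> and the anchor maps of the tuple
  spaces.\<close>

locale etale_space =
  fixes X :: "'x topology" and Y :: "'y topology" and p :: "'y \<Rightarrow> 'x"
  assumes Hausdorff_X: "Hausdorff_space X"
    and Hausdorff_Y: "Hausdorff_space Y"
    and base_X: "\<lbrakk>openin X S; x \<in> S\<rbrakk> \<Longrightarrow> \<exists>U. compact_open X U \<and> x \<in> U \<and> U \<subseteq> S"
    and continuous_p: "continuous_map Y X p"
    and open_p: "open_map Y X p"
    and local_slice: "y \<in> topspace Y \<Longrightarrow> \<exists>V. compact_open Y V \<and> inj_on p V \<and> y \<in> V"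
begin

definition slice :: "'y set \<Rightarrow> bool" where
  "slice V \<longleftrightarrow> compact_open Y V \<and> inj_on p V"

lemma slice_compact_open: "slice V \<Longrightarrow> compact_open Y V"
  by (simp add: slice_def)

lemma slice_inj: "slice V \<Longrightarrow> y \<in> V \<Longrightarrow> z \<in> V \<Longrightarrow> p y = p z \<Longrightarrow> y = z"
  by (auto simp: slice_def inj_on_def)

lemma slice_subset: "slice V \<Longrightarrow> V \<subseteq> topspace Y"
  by (simp add: slice_def compact_open_subset)

lemma slice_openin: "slice V \<Longrightarrow> openin Y V"
  by (simp add: slice_def compact_open_def)

lemma slice_empty [simp]: "slice {}"
  by (simp add: slice_def)

lemma p_in: "y \<in> topspace Y \<Longrightarrow> p y \<in> topspace X"
  using continuous_p by (auto simp: continuous_map_def)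

lemma slice_mono: "slice V \<Longrightarrow> compact_open Y W \<Longrightarrow> W \<subseteq> V \<Longrightarrow> slice W"
  by (auto simp: slice_def intro: inj_on_subset)

lemma slice_Int: "slice V \<Longrightarrow> slice W \<Longrightarrow> slice (V \<inter> W)"
  by (meson Hausdorff_Y compact_open_Int inf_le1 slice_compact_open slice_mono)

lemma slice_image: "slice V \<Longrightarrow> compact_open X (p ` V)"
  using continuous_p open_p
  by (auto simp: slice_def compact_open_def open_map_def intro: image_compactin)

lemma indicator_slice_in_Cc: "slice V \<Longrightarrow> indicator V \<in> Cc Y"
  by (simp add: indicator_in_Cc Hausdorff_Y slice_compact_open)

lemma slice_restrict:
  assumes "slice V" "compact_open X U"
  shows "slice {y \<in> V. p y \<in> U}"
proof -
  have "openin Y {y \<in> topspace Y. p y \<in> U}" "closedin Y {y \<in> topspace Y. p y \<in> U}"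
    using assms continuous_p Hausdorff_X
    by (auto simp: compact_open_def compactin_imp_closedin
        intro: openin_continuous_map_preimage closedin_continuous_map_preimage)
  then have "compact_open Y (V \<inter> {y \<in> topspace Y. p y \<in> U})"
    using assms(1) by (simp add: slice_def compact_open_Int_clopen)
  moreover have "V \<inter> {y \<in> topspace Y. p y \<in> U} = {y \<in> V. p y \<in> U}"
    using slice_subset assms by blast
  ultimately show ?thesis
    using slice_mono[OF assms(1)] by (metis (no_types, lifting) mem_Collect_eq subsetI)
qed

text \<open>The shrinking is done in the base: a compact open \<open>U\<close> around
  \<open>p y\<close> inside the image of \<open>V \<inter> S\<close> is lifted to \<open>V\<close>,
  and injectivity of \<open>p\<close> on \<open>V\<close> forces the lift into
  \<open>S\<close>.\<close>

lemma slice_base: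
  assumes "openin Y S" "y \<in> S"
  shows "\<exists>V. slice V \<and> y \<in> V \<and> V \<subseteq> S"
proof -
  have "y \<in> topspace Y"
    using assms openin_subset by blast
  then obtain V where V: "slice V" "y \<in> V"
    using local_slice by (auto simp: slice_def)
  have "openin X (p ` (V \<inter> S))"
    using open_p assms V by (simp add: open_map_def slice_openin openin_Int)
  then obtain U where U: "compact_open X U" "p y \<in> U" "U \<subseteq> p ` (V \<inter> S)"
    using base_X[of "p ` (V \<inter> S)" "p y"] assms V by blast
  have "{z \<in> V. p z \<in> U} \<subseteq> S"
  proof
    fix z assume "z \<in> {z \<in> V. p z \<in> U}"
    then obtain w where "z \<in> V" "w \<in> V" "w \<in> S" "p z = p w"
      using U by blast
    then show "z \<in> S"
      using slice_inj[OF V(1)] by metis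
  qed
  then show ?thesis
    using slice_restrict[OF V(1) U(1)] V(2) U(2) by blast
qed

lemma Cc_slice_induct [consumes 1, case_names indicator add uminus]:
  assumes "f \<in> Cc Y"
    and ind: "\<And>V. slice V \<Longrightarrow> P (indicator V)"
    and "\<And>f g. f \<in> Cc Y \<Longrightarrow> g \<in> Cc Y \<Longrightarrow> P f \<Longrightarrow> P g \<Longrightarrow> P (\<lambda>y. f y + g y)"
    and "\<And>f. f \<in> Cc Y \<Longrightarrow> P f \<Longrightarrow> P (\<lambda>y. - f y)"
  shows "P f"
  using Hausdorff_Y assms(1)
proof (rule Cc_induct[where B = slice])
  show "P (\<lambda>_. 0)"
    using ind[of "{}"] by (simp add: indicator_def[abs_def])
qed (use assms slice_compact_open slice_mono local_slice in \<open>auto simp: slice_def\<close>)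

text \<open>A slice meets every fibre at most once, and \<open>f\<close> is a finite combination of
  indicators of slices. This makes the sums over fibres finite.\<close>

lemma finite_fibre: "f \<in> Cc Y \<Longrightarrow> finite {y. p y = x \<and> f y \<noteq> 0}"
proof (induction rule: Cc_slice_induct)
  case (indicator V)
  have "{y. p y = x \<and> indicator V y \<noteq> (0 :: int)} = {y \<in> V. p y = x}"
    by (auto simp: indicator_def)
  moreover have "\<exists>z. {y \<in> V. p y = x} \<subseteq> {z}"
    using slice_inj[OF indicator] by blast
  ultimately show ?case
    using finite_subset by (metis finite.emptyI finite.insertI)
next
  case (add f g)
  then show ?case
    by (rule_tac finite_subset[of _ "{y. p y = x \<and> f y \<noteq> 0} \<union> {y. p y = x \<and> g y \<noteq> 0}"]) auto
qed auto

text \<open>On a compact set a continuous injection into a Hausdorff space is a homeomorphism onto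
  its image. So injectivity captures the condition that \<open>compact_open_slice\<close> states
  with \<open>homeomorphic_map\<close>.\<close>

lemma slice_iff_homeomorphic:
  "slice V \<longleftrightarrow> openin Y V \<and> compactin Y V \<and>
    homeomorphic_map (subtopology Y V) (subtopology X (p ` V)) p"
proof
  assume V: "slice V"
  have sub: "V \<subseteq> topspace Y" "p ` V \<subseteq> topspace X"
    using slice_subset[OF V] p_in by auto
  have "homeomorphic_map (subtopology Y V) (subtopology X (p ` V)) p"
  proof (rule continuous_imp_homeomorphic_map)
    show "compact_space (subtopology Y V)"
      using V by (simp add: slice_def compact_open_def compact_space_subtopology)
    show "Hausdorff_space (subtopology X (p ` V))"
      by (simp add: Hausdorff_X Hausdorff_space_subtopology)
    show "continuous_map (subtopology Y V) (subtopology X (p ` V)) p"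
      using continuous_p by (auto simp: continuous_map_in_subtopology continuous_map_from_subtopology)
    show "p ` topspace (subtopology Y V) = topspace (subtopology X (p ` V))"
      using sub by (simp add: Int_absorb1)
    show "inj_on p (topspace (subtopology Y V))"
      using V by (auto simp: slice_def inj_on_def)
  qed
  then show "openin Y V \<and> compactin Y V \<and>
    homeomorphic_map (subtopology Y V) (subtopology X (p ` V)) p"
    using V by (simp add: slice_def compact_open_def)
next
  assume V: "openin Y V \<and> compactin Y V \<and>
    homeomorphic_map (subtopology Y V) (subtopology X (p ` V)) p"
  then have "inj_on p (topspace (subtopology Y V))"
    using homeomorphic_imp_injective_map by blast
  moreover have "topspace (subtopology Y V) = V"
    using V openin_subset[of Y V] by auto
  ultimately show "slice V"
    using V by (simp add: slice_def compact_open_def)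
qed

end

lemma sum'_uminus: "sum' (\<lambda>x. - f x) A = - sum' f A" for f :: "'a \<Rightarrow> int"
proof -
  have "{x \<in> A. - f x \<noteq> 0} = {x \<in> A. f x \<noteq> 0}"
    by auto
  then show ?thesis
    unfolding sum.G_def by (simp only: sum_negf) simp
qed

lemma pushforward_uminus: "pushforward X \<tau> (\<lambda>x. - f x) = (\<lambda>y. - pushforward X \<tau> f y)"
  by (simp add: pushforward_def sum'_uminus)

text \<open>A continuous map over a common base. That it is open comes out in
  \<open>slice_image\<close>: it sends slices to slices, which is what \<open>pushforward\<close>
  needs.\<close>

locale etale_morphism = E: etale_space X Y p + E': etale_space X Y' p'
  for X :: "'x topology" and Y :: "'y topology" and p and Y' :: "'z topology" and p' +
  fixes \<tau> :: "'z \<Rightarrow> 'y"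
  assumes continuous_\<tau>: "continuous_map Y' Y \<tau>"
    and p_\<tau>: "y \<in> topspace Y' \<Longrightarrow> p (\<tau> y) = p' y"
begin

lemma slice_image: assumes V: "E'.slice V" shows "E.slice (\<tau> ` V)"
proof -
  have sub: "V \<subseteq> topspace Y'"
    by (simp add: E'.slice_subset V)
  have "compactin Y (\<tau> ` V)"
    using V continuous_\<tau> by (auto simp: E'.slice_def compact_open_def intro: image_compactin)
  moreover have "inj_on p (\<tau> ` V)"
    using sub p_\<tau> E'.slice_inj[OF V] by (auto simp: inj_on_def subset_iff)
  moreover have "openin Y (\<tau> ` V)"
  proof (subst openin_subopen, safe)
    fix v assume v: "v \<in> V"
    then have vY: "v \<in> topspace Y'" "\<tau> v \<in> topspace Y"
      using sub continuous_\<tau> by (auto simp: continuous_map_def)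
    \<comment> \<open>Near \<open>\<tau> v\<close> the image of \<open>V\<close> is cut out of a slice \<open>W\<close> by an open condition on \<open>p\<close>.\<close>
    obtain W where W: "E.slice W" "\<tau> v \<in> W"
      using E.slice_base[of "topspace Y" "\<tau> v"] vY by auto
    define V' where "V' = V \<inter> {y \<in> topspace Y'. \<tau> y \<in> W}"
    have "openin Y' V'"
      unfolding V'_def using V W continuous_\<tau>
      by (auto intro: openin_Int openin_continuous_map_preimage E.slice_openin E'.slice_openin)
    then have "openin X (p' ` V')"
      using E'.open_p by (simp add: open_map_def)
    then have "openin Y {y \<in> topspace Y. p y \<in> p' ` V'}"
      by (rule openin_continuous_map_preimage[OF E.continuous_p])
    then have "openin Y (W \<inter> {y \<in> topspace Y. p y \<in> p' ` V'})"
      using W E.slice_openin by blast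
    moreover have "\<tau> v \<in> W \<inter> {y \<in> topspace Y. p y \<in> p' ` V'}"
      using W v vY p_\<tau> by (auto simp: V'_def)
    moreover have "W \<inter> {y \<in> topspace Y. p y \<in> p' ` V'} \<subseteq> \<tau> ` V"
    proof
      fix w assume "w \<in> W \<inter> {y \<in> topspace Y. p y \<in> p' ` V'}"
      then obtain z where z: "w \<in> W" "z \<in> V" "\<tau> z \<in> W" "p w = p' z"
        by (auto simp: V'_def)
      then have "p w = p (\<tau> z)"
        using p_\<tau> sub by auto
      then have "w = \<tau> z"
        using E.slice_inj[OF W(1)] z by blast
      then show "w \<in> \<tau> ` V"
        using z by blast
    qed
    ultimately show "\<exists>T. openin Y T \<and> \<tau> v \<in> T \<and> T \<subseteq> \<tau> ` V"
      by blast
  qed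
  ultimately show ?thesis
    by (simp add: E.slice_def compact_open_def)
qed

text \<open>The map \<open>p'\<close> is injective on \<open>V\<close> and factors through
  \<open>\<tau>\<close>, so every fibre of \<open>\<tau>\<close> meets \<open>V\<close> at most once
  and the sum has at most one nonzero term.\<close>

lemma pushforward_indicator:
  assumes V: "E'.slice V"
  shows "pushforward (topspace Y') \<tau> (indicator V) = indicator (\<tau> ` V)"
proof
  fix y
  have sub: "V \<subseteq> topspace Y'"
    by (simp add: E'.slice_subset V)
  have "pushforward (topspace Y') \<tau> (indicator V) y
      = sum' (\<lambda>_. 1 :: int) {x \<in> V. \<tau> x = y}"
    unfolding pushforward_def
    by (rule sum.mono_neutral_cong_right') (use sub in \<open>auto simp: indicator_def\<close>)
  also have "\<dots> = indicator (\<tau> ` V) y"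
  proof (cases "y \<in> \<tau> ` V")
    case True
    then obtain v where v: "v \<in> V" "y = \<tau> v"
      by blast
    then have "{x \<in> V. \<tau> x = y} = {v}"
      using E'.slice_inj[OF V] p_\<tau> sub by (auto simp: subset_iff) metis
    then show ?thesis
      using True by simp
  next
    case False
    then have E: "{x \<in> V. \<tau> x = y} = {}"
      by auto
    show ?thesis
      unfolding E using False by simp
  qed
  finally show "pushforward (topspace Y') \<tau> (indicator V) y = indicator (\<tau> ` V) y" .
qed

lemma finite_pushforward: "f \<in> Cc Y' \<Longrightarrow> finite {x \<in> {x \<in> topspace Y'. \<tau> x = y}. f x \<noteq> 0}"
  by (rule finite_subset[OF _ E'.finite_fibre[of f "p y"]]) (auto simp: p_\<tau>)

lemma pushforward_add:
  "f \<in> Cc Y' \<Longrightarrow> g \<in> Cc Y' \<Longrightarrow>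
    pushforward (topspace Y') \<tau> (\<lambda>x. f x + g x) =
    (\<lambda>y. pushforward (topspace Y') \<tau> f y + pushforward (topspace Y') \<tau> g y)"
  unfolding pushforward_def by (rule ext, rule sum.distrib') (rule finite_pushforward; assumption)+

lemma pushforward_in_Cc: "f \<in> Cc Y' \<Longrightarrow> pushforward (topspace Y') \<tau> f \<in> Cc Y"
proof (induction rule: E'.Cc_slice_induct)
  case (indicator V)
  then show ?case
    by (simp add: pushforward_indicator slice_image E.indicator_slice_in_Cc)
next
  case (add f g)
  then show ?case
    by (simp add: pushforward_add Cc_add)
next
  case (uminus f)
  then show ?case
    by (simp add: pushforward_uminus Cc_uminus)
qed

end

section \<open>From local homeomorphisms to etale spaces\<close>

lemma local_homeomorphism_continuous:
  assumes "local_homeomorphism Y X p" shows "continuous_map Y X p"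
  unfolding continuous_map_def
proof (intro conjI allI impI)
  show "p \<in> topspace Y \<rightarrow> topspace X"
    using assms by (simp add: local_homeomorphism_def)
  fix W assume W: "openin X W"
  show "openin Y {x \<in> topspace Y. p x \<in> W}"
  proof (subst openin_subopen, safe)
    fix x assume x: "x \<in> topspace Y" "p x \<in> W"
    then obtain U where U: "openin Y U" "x \<in> U"
        "homeomorphic_map (subtopology Y U) (subtopology X (p ` U)) p"
      using assms unfolding local_homeomorphism_def by blast
    then have "continuous_map (subtopology Y U) X p"
      using continuous_map_in_subtopology homeomorphic_imp_continuous_map by blast
    then have "openin (subtopology Y U) {z \<in> topspace (subtopology Y U). p z \<in> W}"
      using W by (rule openin_continuous_map_preimage)
    then have "openin Y {z \<in> topspace (subtopology Y U). p z \<in> W}"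
      using U(1) openin_trans_full by blast
    then show "\<exists>T. openin Y T \<and> x \<in> T \<and> T \<subseteq> {x \<in> topspace Y. p x \<in> W}"
      using x U(2) by (intro exI[of _ "{z \<in> topspace (subtopology Y U). p z \<in> W}"]) auto
  qed
qed

lemma local_homeomorphism_open_map:
  assumes "local_homeomorphism Y X p" shows "open_map Y X p"
  unfolding open_map_def
proof (intro allI impI)
  fix S assume S: "openin Y S"
  show "openin X (p ` S)"
  proof (subst openin_subopen, safe)
    fix x assume x: "x \<in> S"
    then have "x \<in> topspace Y"
      using S openin_subset by blast
    then obtain U where U: "openin Y U" "x \<in> U" "openin X (p ` U)"
        "homeomorphic_map (subtopology Y U) (subtopology X (p ` U)) p"
      using assms unfolding local_homeomorphism_def by blast
    have "openin (subtopology X (p ` U)) (p ` (U \<inter> S))"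
      using homeomorphic_imp_open_map[OF U(4)] S by (simp add: open_map_def openin_subtopology_Int2)
    then have "openin X (p ` (U \<inter> S))"
      using U(3) openin_trans_full by blast
    then show "\<exists>T. openin X T \<and> p x \<in> T \<and> T \<subseteq> p ` S"
      using x U(2) by (intro exI[of _ "p ` (U \<inter> S)"]) auto
  qed
qed

text \<open>The required sets of injectivity are obtained by pulling a compact open subset
  \<open>T\<close> of the open image of \<open>U\<close> back along the homeomorphism that
  \<open>loc\<close> gives on \<open>U\<close>.\<close>

lemma etale_spaceI:
  assumes "Hausdorff_space X" "Hausdorff_space Y"
    and base: "\<And>S x. \<lbrakk>openin X S; x \<in> S\<rbrakk> \<Longrightarrow> \<exists>U. compact_open X U \<and> x \<in> U \<and> U \<subseteq> S"
    and loc: "local_homeomorphism Y X p"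
  shows "etale_space X Y p"
proof
  fix y assume "y \<in> topspace Y"
  then obtain U where U: "openin Y U" "y \<in> U" "openin X (p ` U)"
      "homeomorphic_map (subtopology Y U) (subtopology X (p ` U)) p"
    using loc unfolding local_homeomorphism_def by blast
  have tU: "topspace (subtopology Y U) = U"
    using openin_subset[OF U(1)] by auto
  have inj: "inj_on p U"
    using homeomorphic_imp_injective_map[OF U(4)] tU by simp
  obtain T where T: "compact_open X T" "p y \<in> T" "T \<subseteq> p ` U"
    using base[OF U(3)] U(2) by blast
  define V where "V = {z \<in> U. p z \<in> T}"
  have "p ` V = T"
    using T by (auto simp: V_def)
  then have "compactin (subtopology X (p ` U)) (p ` V)"
    using T by (simp add: compactin_subtopology compact_open_def)
  moreover have VU: "V \<subseteq> U"
    by (auto simp: V_def)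
  ultimately have "compactin (subtopology Y U) V"
    using homeomorphic_map_compactness[OF U(4)] tU by blast
  then have "compactin Y V"
    by (simp add: compactin_subtopology)
  moreover have "openin Y V"
  proof -
    have "openin Y {z \<in> topspace Y. p z \<in> T}"
      using local_homeomorphism_continuous[OF loc] T
      by (auto simp: compact_open_def intro: openin_continuous_map_preimage)
    then have "openin Y (U \<inter> {z \<in> topspace Y. p z \<in> T})"
      using U(1) by blast
    moreover have "U \<inter> {z \<in> topspace Y. p z \<in> T} = V"
      using openin_subset[OF U(1)] by (auto simp: V_def)
    ultimately show ?thesis by simp
  qed
  ultimately show "\<exists>V. compact_open Y V \<and> inj_on p V \<and> y \<in> V"
    using U(2) T(2) inj VU by (intro exI[of _ V]) (auto simp: compact_open_def V_def inj_on_def)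
qed (simp_all add: assms(1,2) base local_homeomorphism_continuous[OF loc]
    local_homeomorphism_open_map[OF loc])

section \<open>Bisections of an ample groupoid\<close>

context ample_groupoid
begin

lemma units_arrows: "x \<in> units G \<Longrightarrow> x \<in> arrows G"
  using units_subset by blast

lemma topspace_gtop [simp]: "topspace (gtop G) = arrows G"
  by (simp add: arrows_def)

lemma topspace_unit_top [simp]: "topspace (unit_top G) = units G"
  using units_subset by (auto simp: unit_top_def)

lemma Hausdorff_unit_top: "Hausdorff_space (unit_top G)"
  by (simp add: Hausdorff Hausdorff_space_subtopology unit_top_def)

lemma continuous_rng: "continuous_map (gtop G) (gtop G) (rng G)"
  and continuous_src: "continuous_map (gtop G) (gtop G) (src G)"
  using local_homeomorphism_continuous[OF etale_rng] local_homeomorphism_continuous[OF etale_src]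
  by (simp_all add: unit_top_def continuous_map_in_subtopology)

lemma unit_iff: "g \<in> arrows G \<Longrightarrow> g \<in> units G \<longleftrightarrow> rng G g = g"
  using rng_in_units rng_unit by metis

lemma closedin_units: "closedin (gtop G) (units G)"
proof -
  have "closedin (gtop G) {g \<in> topspace (gtop G). rng G g = id g}"
    by (rule closedin_continuous_maps_eq) (use Hausdorff continuous_rng in auto)
  moreover have "{g \<in> topspace (gtop G). rng G g = id g} = units G"
    using unit_iff units_arrows by auto
  ultimately show ?thesis by simp
qed

text \<open>Let \<open>rng G\<close> be injective on an open neighbourhood \<open>U\<close> of a
  unit. If \<open>g\<close> and \<open>rng G g\<close> both lie in \<open>U\<close>, they have the
  same range and hence coincide, so \<open>g\<close> is a unit. By continuity these \<open>g\<close>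
  form a neighbourhood.\<close>

lemma openin_units: "openin (gtop G) (units G)"
proof (subst openin_subopen, safe)
  fix x assume x: "x \<in> units G"
  then have "x \<in> topspace (gtop G)"
    using units_arrows by simp
  then obtain U where U: "openin (gtop G) U" "x \<in> U"
      "homeomorphic_map (subtopology (gtop G) U) (subtopology (unit_top G) (rng G ` U)) (rng G)"
    using etale_rng unfolding local_homeomorphism_def by blast
  have sub: "U \<subseteq> arrows G"
    using openin_subset[OF U(1)] by simp
  then have inj: "inj_on (rng G) U"
    using homeomorphic_imp_injective_map[OF U(3)] by (simp add: Int_absorb1)
  have "openin (gtop G) (U \<inter> {g \<in> topspace (gtop G). rng G g \<in> U})"
    using U(1) continuous_rng by (blast intro: openin_continuous_map_preimage)
  moreover have "U \<inter> {g \<in> topspace (gtop G). rng G g \<in> U} \<subseteq> units G"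
  proof
    fix g assume "g \<in> U \<inter> {g \<in> topspace (gtop G). rng G g \<in> U}"
    then have g: "g \<in> U" "rng G g \<in> U" "g \<in> arrows G"
      by auto
    then have "rng G g = g"
      using inj_onD[OF inj _ g(2,1)] rng_unit[OF rng_in_units] by blast
    then show "g \<in> units G"
      using g unit_iff by blast
  qed
  ultimately show "\<exists>T. openin (gtop G) T \<and> x \<in> T \<and> T \<subseteq> units G"
    using U(2) x units_arrows rng_unit
    by (intro exI[of _ "U \<inter> {g \<in> topspace (gtop G). rng G g \<in> U}"]) auto
qed

lemma unit_base:
  "openin (unit_top G) S \<Longrightarrow> x \<in> S \<Longrightarrow> \<exists>U. compact_open (unit_top G) U \<and> x \<in> U \<and> U \<subseteq> S"
  using compact_open_base[OF _ Hausdorff_unit_top totally_disconnected_units]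
    locally_compact_space_closed_subset[OF locally_compact closedin_units]
  by (simp add: unit_top_def)

sublocale R: etale_space "unit_top G" "gtop G" "rng G"
  by (rule etale_spaceI[OF Hausdorff_unit_top Hausdorff _ etale_rng]) (rule unit_base)

sublocale S: etale_space "unit_top G" "gtop G" "src G"
  by (rule etale_spaceI[OF Hausdorff_unit_top Hausdorff _ etale_src]) (rule unit_base)

abbreviation bisection :: "'g set \<Rightarrow> bool" where
  "bisection \<equiv> compact_open_bisection G"

lemma bisection_iff: "bisection B \<longleftrightarrow> R.slice B \<and> S.slice B"
  by (auto simp: compact_open_bisection_def R.slice_def S.slice_def compact_open_def)

lemma bisection_compact_open: "bisection B \<Longrightarrow> compact_open (gtop G) B"
  by (simp add: bisection_iff R.slice_compact_open)

lemma bisection_arrows: "bisection B \<Longrightarrow> g \<in> B \<Longrightarrow> g \<in> arrows G"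
  using bisection_compact_open compact_open_subset by fastforce

lemma bisection_mono: "bisection V \<Longrightarrow> compact_open (gtop G) W \<Longrightarrow> W \<subseteq> V \<Longrightarrow> bisection W"
  by (meson bisection_iff R.slice_mono S.slice_mono)

lemma bisection_Int: "bisection V \<Longrightarrow> bisection W \<Longrightarrow> bisection (V \<inter> W)"
  by (simp add: bisection_iff R.slice_Int S.slice_Int)

lemma bisection_base:
  assumes "openin (gtop G) S" "g \<in> S"
  shows "\<exists>B. bisection B \<and> g \<in> B \<and> B \<subseteq> S"
proof -
  obtain V W where "R.slice V" "g \<in> V" "V \<subseteq> S" "S.slice W" "g \<in> W"
    using R.slice_base[OF assms] S.slice_base[OF assms] by blast
  moreover from this have "compact_open (gtop G) (V \<inter> W)"
    by (simp add: compact_open_Int Hausdorff R.slice_compact_open S.slice_compact_open)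
  ultimately show ?thesis
    unfolding bisection_iff using R.slice_mono S.slice_mono
    by (intro exI[of _ "V \<inter> W"]) (meson IntI Int_lower1 Int_lower2 subset_trans)
qed

lemma indicator_bisection_in_Cc: "bisection B \<Longrightarrow> indicator B \<in> Cc (gtop G)"
  by (simp add: bisection_iff R.indicator_slice_in_Cc)

lemma Cc_bisection_induct [consumes 1, case_names indicator add uminus]:
  assumes "f \<in> Cc (gtop G)"
    and ind: "\<And>V. bisection V \<Longrightarrow> P (indicator V)"
    and "\<And>f g. f \<in> Cc (gtop G) \<Longrightarrow> g \<in> Cc (gtop G) \<Longrightarrow> P f \<Longrightarrow> P g \<Longrightarrow> P (\<lambda>y. f y + g y)"
    and "\<And>f. f \<in> Cc (gtop G) \<Longrightarrow> P f \<Longrightarrow> P (\<lambda>y. - f y)"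
  shows "P f"
  using Hausdorff assms(1)
proof (rule Cc_induct[where B = bisection])
  have "bisection {}"
    by (simp add: bisection_iff)
  then show "P (\<lambda>_. 0)"
    using ind[of "{}"] by (simp add: indicator_def[abs_def])
  show "\<exists>V. bisection V \<and> g \<in> V" if "g \<in> topspace (gtop G)" for g
    using bisection_base[OF openin_topspace that] by blast
qed (erule (2) bisection_mono | rule bisection_compact_open assms; assumption)+

lemma compact_open_unit_top:
  "compact_open (unit_top G) U \<longleftrightarrow> compact_open (gtop G) U \<and> U \<subseteq> units G"
  using openin_units unfolding compact_open_def unit_top_def
  by (auto simp: compactin_subtopology openin_open_subtopology)

lemma unit_bisection:
  assumes "compact_open (unit_top G) U"
  shows "bisection U"
proof -
  have "U \<subseteq> units G"
    using assms compact_open_unit_top by blast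
  then have "inj_on (rng G) U" "inj_on (src G) U"
    using rng_unit src_unit by (auto simp: inj_on_def subset_iff)
  then show ?thesis
    using assms compact_open_unit_top by (simp add: bisection_iff R.slice_def S.slice_def)
qed

lemma ginv_ginv: "g \<in> arrows G \<Longrightarrow> ginv G (ginv G g) = g"
proof -
  assume g: "g \<in> arrows G"
  let ?h = "ginv G g" and ?k = "ginv G (ginv G g)"
  have ar: "?h \<in> arrows G" "?k \<in> arrows G"
    using g by (simp_all add: ginv_in_arrows)
  have "mul G (mul G g ?h) ?k = mul G g (mul G ?h ?k)"
    using g ar by (intro mul_assoc) (simp_all add: rng_ginv src_ginv)
  also have "\<dots> = g"
    using g ar mul_src_right by (simp add: mul_ginv_right rng_ginv)
  finally have "mul G (rng G g) ?k = g"
    using g by (simp add: mul_ginv_right)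
  moreover have "rng G ?k = rng G g"
    using g ar by (simp add: rng_ginv src_ginv)
  ultimately show ?thesis
    using mul_rng_left[OF ar(2)] by simp
qed

end

section \<open>Spaces with a groupoid action\<close>

locale groupoid_space = ample_groupoid G + etale_space "unit_top G" Y p
  for G :: "'g groupoid" and Y :: "'y topology" and p :: "'y \<Rightarrow> 'g" +
  fixes act :: "'g \<Rightarrow> 'y \<Rightarrow> 'y"
  assumes act_in: "\<lbrakk>g \<in> arrows G; y \<in> topspace Y; src G g = p y\<rbrakk> \<Longrightarrow> act g y \<in> topspace Y"
    and p_act: "\<lbrakk>g \<in> arrows G; y \<in> topspace Y; src G g = p y\<rbrakk> \<Longrightarrow> p (act g y) = rng G g"
    and act_unit: "y \<in> topspace Y \<Longrightarrow> act (p y) y = y"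
    and act_mul: "\<lbrakk>g \<in> arrows G; h \<in> arrows G; y \<in> topspace Y; src G g = rng G h; src G h = p y\<rbrakk>
      \<Longrightarrow> act g (act h y) = act (mul G g h) y"
    and continuous_act: "continuous_map
      (subtopology (prod_topology (gtop G) Y) {(g, y). src G g = p y}) Y (\<lambda>(g, y). act g y)"
begin

definition act_set :: "'g set \<Rightarrow> 'y set \<Rightarrow> 'y set" where
  "act_set B V = {act b v | b v. b \<in> B \<and> v \<in> V \<and> src G b = p v}"

lemma act_ginv_act: "\<lbrakk>g \<in> arrows G; y \<in> topspace Y; src G g = p y\<rbrakk> \<Longrightarrow> act (ginv G g) (act g y) = y"
  by (simp add: act_mul ginv_in_arrows src_ginv mul_ginv_left act_unit)

lemma act_act_ginv: "\<lbrakk>g \<in> arrows G; y \<in> topspace Y; rng G g = p y\<rbrakk> \<Longrightarrow> act g (act (ginv G g) y) = y"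
  by (simp add: act_mul ginv_in_arrows rng_ginv src_ginv mul_ginv_right act_unit)

text \<open>The anchor of \<open>act b v\<close> is \<open>rng G b\<close>; it determines
  \<open>b\<close> in \<open>B\<close>, and then \<open>v\<close> as the point of \<open>V\<close>
  over \<open>src G b\<close>. Compactness holds because the composable pairs form a closed part of
  the product of \<open>B\<close> and \<open>V\<close>.\<close>

lemma slice_act_set:
  assumes B: "R.slice B" and V: "slice V"
  shows "slice (act_set B V)"
proof -
  have subB: "B \<subseteq> arrows G" and subV: "V \<subseteq> topspace Y"
    using R.slice_subset[OF B] slice_subset[OF V] by auto
  let ?F = "{(g, y). src G g = p y}" and ?P = "prod_topology (gtop G) Y"
  have "act_set B V = (\<lambda>(g, y). act g y) ` ((B \<times> V) \<inter> ?F)"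
    by (auto simp: act_set_def)
  moreover have "compactin (subtopology ?P ?F) ((B \<times> V) \<inter> ?F)"
  proof -
    have "closedin ?P {z \<in> topspace ?P. (src G \<circ> fst) z = (p \<circ> snd) z}"
      by (rule closedin_continuous_maps_eq[OF Hausdorff_unit_top])
        (rule continuous_map_compose[OF continuous_map_fst S.continuous_p]
          continuous_map_compose[OF continuous_map_snd continuous_p])+
    moreover have "compactin ?P (B \<times> V)"
      using B V by (simp add: compactin_Times R.slice_def slice_def compact_open_def)
    ultimately have "compactin ?P ((B \<times> V) \<inter> {z \<in> topspace ?P. (src G \<circ> fst) z = (p \<circ> snd) z})"
      by (rule compact_Int_closedin[rotated])
    moreover have "(B \<times> V) \<inter> {z \<in> topspace ?P. (src G \<circ> fst) z = (p \<circ> snd) z} = (B \<times> V) \<inter> ?F"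
      using subB subV by auto
    ultimately show ?thesis
      by (simp add: compactin_subtopology)
  qed
  ultimately have "compactin Y (act_set B V)"
    using image_compactin continuous_act by metis
  moreover have "inj_on p (act_set B V)"
  proof (rule inj_onI)
    fix y z assume "y \<in> act_set B V" "z \<in> act_set B V" and yz: "p y = p z"
    then obtain b v c w where bc: "y = act b v" "b \<in> B" "v \<in> V" "src G b = p v"
        "z = act c w" "c \<in> B" "w \<in> V" "src G c = p w"
      by (auto simp: act_set_def)
    then have "rng G b = rng G c"
      using yz p_act subB subV by (metis subsetD)
    then have "b = c"
      using R.slice_inj[OF B] bc by blast
    then show "y = z"
      using bc slice_inj[OF V] by metis
  qed
  moreover have "openin Y (act_set B V)"
  proof (subst openin_subopen, safe)
    fix y assume "y \<in> act_set B V"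
    then obtain b v where bv: "y = act b v" "b \<in> B" "v \<in> V" "src G b = p v"
      by (auto simp: act_set_def)
    then have yY: "y \<in> topspace Y"
      using act_in subB subV by blast
    then obtain W where W: "slice W" "y \<in> W"
      using slice_base[OF openin_topspace] by blast
    have "openin (subtopology ?P ?F)
        {z \<in> topspace (subtopology ?P ?F). (\<lambda>(g, y). act g y) z \<in> W}"
      by (rule openin_continuous_map_preimage[OF continuous_act slice_openin[OF W(1)]])
    then obtain T where T: "openin ?P T"
        "{z \<in> topspace (subtopology ?P ?F). (\<lambda>(g, y). act g y) z \<in> W} = T \<inter> ?F"
      by (auto simp: openin_subtopology)
    have "(b, v) \<in> {z \<in> topspace (subtopology ?P ?F). (\<lambda>(g, y). act g y) z \<in> W}"
      using bv W subB subV by auto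
    then have "(b, v) \<in> T"
      using T(2) by blast
    then obtain O1 O2 where O: "openin (gtop G) O1" "openin Y O2" "b \<in> O1" "v \<in> O2" "O1 \<times> O2 \<subseteq> T"
      using T(1)[unfolded openin_prod_topology_alt, rule_format, of b v] by blast
    \<comment> \<open>\<open>A\<close> collects the arrows \<open>c\<close> of \<open>B\<close> near
      \<open>b\<close> whose source lies under a point \<open>u\<close> of \<open>V\<close> near
      \<open>v\<close>, so that \<open>act c u\<close> lies in \<open>W\<close>. A point of
      \<open>W\<close> with anchor \<open>rng G c\<close> must then equal \<open>act c u\<close>,
      because \<open>W\<close> is a slice.\<close>
    define A where "A = O1 \<inter> B \<inter> {g \<in> topspace (gtop G). src G g \<in> p ` (O2 \<inter> V)}"
    have "openin (unit_top G) (p ` (O2 \<inter> V))"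
      using open_p O(2) slice_openin[OF V] by (simp add: open_map_def openin_Int)
    then have "openin (gtop G) A"
      unfolding A_def using O(1) R.slice_openin[OF B]
      by (intro openin_Int openin_continuous_map_preimage[OF S.continuous_p]) auto
    then have "openin (unit_top G) (rng G ` A)"
      using R.open_p by (simp add: open_map_def)
    then have opn: "openin Y (W \<inter> {z \<in> topspace Y. p z \<in> rng G ` A})"
      by (rule openin_Int[OF slice_openin[OF W(1)] openin_continuous_map_preimage[OF continuous_p]])
    have "b \<in> A"
      using bv O subB by (auto simp: A_def)
    moreover have "p y = rng G b"
      using bv p_act subB subV by blast
    ultimately have "y \<in> W \<inter> {z \<in> topspace Y. p z \<in> rng G ` A}"
      using W(2) yY by blast
    moreover have "W \<inter> {z \<in> topspace Y. p z \<in> rng G ` A} \<subseteq> act_set B V"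
    proof
      fix w assume "w \<in> W \<inter> {z \<in> topspace Y. p z \<in> rng G ` A}"
      then obtain c u where cu: "w \<in> W" "p w = rng G c" "c \<in> O1" "c \<in> B" "u \<in> O2" "u \<in> V"
          "src G c = p u"
        by (auto simp: A_def)
      then have "(c, u) \<in> T \<inter> ?F"
        using O(5) by blast
      then have "act c u \<in> W"
        using T(2)[symmetric] by auto
      moreover have "p (act c u) = p w"
        using cu p_act subB subV by (metis subsetD)
      ultimately have "w = act c u"
        using slice_inj[OF W(1)] cu(1) by metis
      then show "w \<in> act_set B V"
        using cu by (auto simp: act_set_def)
    qed
    ultimately show "\<exists>T. openin Y T \<and> y \<in> T \<and> T \<subseteq> act_set B V"
      using opn by blast
  qed
  ultimately show ?thesis
    by (simp add: slice_def compact_open_def)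
qed

text \<open>Convolution and the module structure on functions on tuples are both of this form.\<close>

definition smul :: "('g \<Rightarrow> int) \<Rightarrow> ('y \<Rightarrow> int) \<Rightarrow> 'y \<Rightarrow> int" where
  "smul f m = (\<lambda>y. if y \<in> topspace Y
     then sum' (\<lambda>g. f (ginv G g) * m (act g y)) {g \<in> arrows G. src G g = p y} else 0)"

text \<open>Only one term survives: \<open>ginv G g\<close> has range \<open>p y\<close>, and
  \<open>b\<close> is the only element of \<open>B\<close> with this range, so \<open>g\<close> is
  the inverse of \<open>b\<close>.\<close>

lemma smul_indicator:
  assumes B: "R.slice B" and b: "b \<in> B" "rng G b = p y" and y: "y \<in> topspace Y"
  shows "smul (indicator B) m y = m (act (ginv G b) y)"
proof -
  have bG: "b \<in> arrows G"
    using b R.slice_subset[OF B] by auto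
  have uniq: "g = ginv G b" if "g \<in> arrows G" "src G g = p y" "ginv G g \<in> B" for g
  proof -
    have "ginv G g = b"
      using R.slice_inj[OF B that(3) b(1)] that b(2) by (simp add: rng_ginv)
    then show ?thesis
      using that ginv_ginv by metis
  qed
  have "smul (indicator B) m y = sum' (\<lambda>g. indicator B (ginv G g) * m (act g y)) {ginv G b}"
    unfolding smul_def if_P[OF y]
    by (intro sum.mono_neutral_cong_right')
      (use uniq b in \<open>auto simp: indicator_def ginv_in_arrows[OF bG] src_ginv[OF bG]\<close>)
  then show ?thesis
    using b(1) by (simp add: ginv_ginv[OF bG])
qed

lemma smul_indicator_outside:
  assumes "\<And>b. b \<in> B \<Longrightarrow> rng G b \<noteq> p y"
  shows "smul (indicator B) m y = 0"
proof -
  have "ginv G g \<notin> B" if "g \<in> arrows G" "src G g = p y" for g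
    using assms rng_ginv[OF that(1)] that(2) by metis
  then have "sum' (\<lambda>g. indicator B (ginv G g) * m (act g y)) {g \<in> arrows G. src G g = p y}
      = sum' (\<lambda>_ :: 'g. 0) {}"
    by (intro sum.mono_neutral_cong_right') (auto simp: indicator_def)
  then show ?thesis
    by (simp add: smul_def)
qed

text \<open>This turns the scalar action into a calculus of sets. Together with induction over
  \<open>Cc\<close> in both arguments it settles the identities that are additive in each of
  them.\<close>

lemma smul_indicators:
  assumes B: "R.slice B" and V: "slice V"
  shows "smul (indicator B) (indicator V) = indicator (act_set B V)"
proof
  fix y
  have sub: "B \<subseteq> arrows G" "V \<subseteq> topspace Y"
    using R.slice_subset[OF B] slice_subset[OF V] by auto
  consider (out) "y \<notin> topspace Y" | (no) "y \<in> topspace Y" "\<And>b. b \<in> B \<Longrightarrow> rng G b \<noteq> p y"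
    | (yes) b where "y \<in> topspace Y" "b \<in> B" "rng G b = p y"
    by blast
  then show "smul (indicator B) (indicator V) y = indicator (act_set B V) y"
  proof cases
    case out
    then have "y \<notin> act_set B V"
      using slice_subset[OF slice_act_set[OF B V]] by blast
    then show ?thesis
      using out by (simp add: smul_def)
  next
    case no
    then have "y \<notin> act_set B V"
      using p_act sub by (force simp: act_set_def)
    then show ?thesis
      using smul_indicator_outside[OF no(2)] by simp
  next
    case yes
    have b: "b \<in> arrows G"
      using sub yes by blast
    have "act (ginv G b) y \<in> V \<longleftrightarrow> y \<in> act_set B V"
    proof
      assume "act (ginv G b) y \<in> V"
      moreover have "y = act b (act (ginv G b) y)" "src G b = p (act (ginv G b) y)"
        using b yes by (simp_all add: act_act_ginv p_act ginv_in_arrows src_ginv rng_ginv)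
      ultimately show "y \<in> act_set B V"
        using yes(2) unfolding act_set_def by blast
    next
      assume "y \<in> act_set B V"
      then obtain c v where cv: "y = act c v" "c \<in> B" "v \<in> V" "src G c = p v"
        by (auto simp: act_set_def)
      then have "rng G c = rng G b"
        using yes p_act sub by (metis subsetD)
      then have "c = b"
        using R.slice_inj[OF B] yes cv by blast
      then show "act (ginv G b) y \<in> V"
        using cv act_ginv_act b sub by (metis subsetD)
    qed
    then show ?thesis
      using smul_indicator[OF B yes(2,3,1), of "indicator V"] by (simp add: indicator_def)
  qed
qed

text \<open>Inversion carries the relevant arrows into a fibre of \<open>rng\<close> over which
  \<open>f\<close> has finite support.\<close>

lemma finite_smul_support:
  assumes "f \<in> Cc (gtop G)"
  shows "finite {g \<in> {g \<in> arrows G. src G g = x}. f (ginv G g) * m g \<noteq> 0}"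
proof (rule finite_subset)
  show "{g \<in> {g \<in> arrows G. src G g = x}. f (ginv G g) * m g \<noteq> 0}
    \<subseteq> ginv G ` {h. rng G h = x \<and> f h \<noteq> 0}"
  proof
    fix g assume g: "g \<in> {g \<in> {g \<in> arrows G. src G g = x}. f (ginv G g) * m g \<noteq> 0}"
    then have "g = ginv G (ginv G g)" "rng G (ginv G g) = x" "f (ginv G g) \<noteq> 0"
      by (auto simp: ginv_ginv rng_ginv)
    then show "g \<in> ginv G ` {h. rng G h = x \<and> f h \<noteq> 0}"
      by blast
  qed
  show "finite (ginv G ` {h. rng G h = x \<and> f h \<noteq> 0})"
    using R.finite_fibre[OF assms] by simp
qed

lemma smul_add_left:
  assumes "f \<in> Cc (gtop G)" "h \<in> Cc (gtop G)"
  shows "smul (\<lambda>g. f g + h g) m = (\<lambda>y. smul f m y + smul h m y)"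
  using sum.distrib'[OF finite_smul_support[OF assms(1)] finite_smul_support[OF assms(2)]]
  by (auto simp: smul_def fun_eq_iff distrib_right)

lemma smul_add_right:
  assumes "f \<in> Cc (gtop G)"
  shows "smul f (\<lambda>y. m y + m' y) = (\<lambda>y. smul f m y + smul f m' y)"
  using sum.distrib'[OF finite_smul_support[OF assms] finite_smul_support[OF assms]]
  by (auto simp: smul_def fun_eq_iff distrib_left)

lemma smul_uminus_left: "smul (\<lambda>g. - f g) m = (\<lambda>y. - smul f m y)"
  by (auto simp: smul_def fun_eq_iff sum'_uminus)

lemma smul_uminus_right: "smul f (\<lambda>y. - m y) = (\<lambda>y. - smul f m y)"
  by (auto simp: smul_def fun_eq_iff sum'_uminus)

lemma smul_in_Cc: "f \<in> Cc (gtop G) \<Longrightarrow> m \<in> Cc Y \<Longrightarrow> smul f m \<in> Cc Y"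
proof (induction rule: Cc_bisection_induct)
  case (indicator B)
  from indicator(2) indicator(1) show ?case
  proof (induction rule: Cc_slice_induct)
    case (indicator V)
    then show ?case
      by (simp add: smul_indicators slice_act_set indicator_slice_in_Cc bisection_iff)
  qed (simp_all add: smul_add_right smul_uminus_right indicator_bisection_in_Cc Cc_add Cc_uminus)
qed (simp_all add: smul_add_left smul_uminus_left Cc_add Cc_uminus)

end

context ample_groupoid
begin

sublocale A: groupoid_space G "gtop G" "rng G" "mul G"
proof
  have "{(g, h). g \<in> arrows G \<and> h \<in> arrows G \<and> src G g = rng G h}
      = topspace (prod_topology (gtop G) (gtop G)) \<inter> {(g, h). src G g = rng G h}"
    by auto
  then show "continuous_map (subtopology (prod_topology (gtop G) (gtop G)) {(g, h). src G g = rng G h})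
      (gtop G) (\<lambda>(g, h). mul G g h)"
    using continuous_mul by (metis subtopology_restrict)
qed (auto simp: mul_in_arrows rng_mul mul_rng_left mul_assoc)

lemma convolution_eq_smul: "convolution G = A.smul"
  by (intro ext) (simp add: convolution_def A.smul_def)

text \<open>For the source the argument runs in the other direction: the source of
  \<open>mul G b v\<close> is that of \<open>v\<close>, which determines \<open>v\<close> and then,
  through \<open>rng G v\<close>, also \<open>b\<close>.\<close>

lemma bisection_act_set:
  assumes "bisection B" "bisection V"
  shows "bisection (A.act_set B V)"
proof -
  have "inj_on (src G) (A.act_set B V)"
  proof (rule inj_onI)
    fix y z assume "y \<in> A.act_set B V" "z \<in> A.act_set B V" and yz: "src G y = src G z"
    then obtain b v c w where bc: "y = mul G b v" "b \<in> B" "v \<in> V" "src G b = rng G v"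
        "z = mul G c w" "c \<in> B" "w \<in> V" "src G c = rng G w"
      by (auto simp: A.act_set_def)
    then have "src G v = src G w"
      using yz src_mul assms bisection_arrows by metis
    then have "v = w"
      using S.slice_inj assms bc bisection_iff by blast
    then show "y = z"
      using bc S.slice_inj assms bisection_iff by metis
  qed
  then show ?thesis
    using A.slice_act_set[of B V] assms by (simp add: bisection_iff R.slice_def S.slice_def)
qed

end

section \<open>Composable tuples\<close>

definition tuple_act :: "'g groupoid \<Rightarrow> 'g \<Rightarrow> 'g list \<Rightarrow> 'g list" where
  "tuple_act G g gs = mul G g (hd gs) # tl gs"

lemma nth_merge_at:
  assumes "Suc i < length gs" "Suc j < length gs"
  shows "merge_at G i gs ! j =
    (if j < i then gs ! j else if j = i then mul G (gs ! i) (gs ! Suc i) else gs ! Suc j)"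
proof (cases "j \<le> i")
  case True
  then show ?thesis
    using assms by (auto simp: merge_at_def nth_append)
next
  case False
  then obtain k where "j = Suc (i + k)"
    by (metis less_imp_Suc_add not_le)
  then show ?thesis
    using assms by (simp add: merge_at_def nth_append)
qed

lemma length_merge_at: "Suc i < length gs \<Longrightarrow> length (merge_at G i gs) = length gs - 1"
  by (simp add: merge_at_def)

context ample_groupoid
begin

lemma length_tuples: "gs \<in> tuples G n \<Longrightarrow> length gs = max n 1"
  by (auto simp: tuples_def split: if_splits)

lemma tuples_nonempty: "gs \<in> tuples G n \<Longrightarrow> gs \<noteq> []"
  using length_tuples by fastforce

lemma tuples_Suc: "gs \<in> tuples G (Suc n) \<longleftrightarrow>
    length gs = Suc n \<and> (\<forall>i\<le>n. gs ! i \<in> arrows G) \<and> (\<forall>i<n. src G (gs ! i) = rng G (gs ! Suc i))"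
proof -
  have "set gs \<subseteq> arrows G \<longleftrightarrow> (\<forall>i<length gs. gs ! i \<in> arrows G)"
    by (auto simp: subset_iff in_set_conv_nth)
  then show ?thesis
    by (auto simp: tuples_def less_Suc_eq_le)
qed

lemma tuples_nth: "gs \<in> tuples G n \<Longrightarrow> i < max n 1 \<Longrightarrow> gs ! i \<in> arrows G"
  by (cases n) (auto simp: tuples_Suc, auto simp: tuples_def units_arrows)

lemma tuples_src: "gs \<in> tuples G n \<Longrightarrow> Suc i < n \<Longrightarrow> src G (gs ! i) = rng G (gs ! Suc i)"
  by (cases n) (auto simp: tuples_Suc)

lemma hd_tuples: "gs \<in> tuples G n \<Longrightarrow> hd gs \<in> arrows G"
  using tuples_nth[of gs n 0] tuples_nonempty by (simp add: hd_conv_nth)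

lemma anchor_in_units: "gs \<in> tuples G n \<Longrightarrow> anchor G gs \<in> units G"
  by (simp add: anchor_def hd_tuples rng_in_units)

lemma tuples_Cons: "g # gs \<in> tuples G (Suc (Suc n)) \<longleftrightarrow>
    g \<in> arrows G \<and> gs \<in> tuples G (Suc n) \<and> src G g = anchor G gs"
proof (cases gs)
  case (Cons h hs)
  then show ?thesis
    by (simp add: tuples_Suc anchor_def All_less_Suc2 nth_Cons' flip: less_Suc_eq_le)
      (auto simp: less_Suc_eq_0_disj)
qed (simp add: tuples_Suc)

lemma singleton_tuples: "[g] \<in> tuples G (Suc 0) \<longleftrightarrow> g \<in> arrows G"
  by (simp add: tuples_Suc)

lemma topspace_tuple_top [simp]: "topspace (tuple_top G n) = tuples G n"
proof -
  have "(\<lambda>i\<in>{..<length gs}. gs ! i) \<in> (\<Pi>\<^sub>E i\<in>{..<max n 1}. arrows G)" if "gs \<in> tuples G n" for gs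
    using that length_tuples[OF that] tuples_nth[OF that] by (auto simp: PiE_iff)
  then show ?thesis
    unfolding tuple_top_def topspace_pullback_topology by auto
qed

lemma continuous_nth:
  assumes "i < max n 1"
  shows "continuous_map (tuple_top G n) (gtop G) (\<lambda>gs. gs ! i)"
proof -
  let ?e = "\<lambda>gs. \<lambda>i\<in>{..<length gs}. gs ! i"
  have "continuous_map (tuple_top G n) (gtop G) ((\<lambda>h. h i) \<circ> ?e)"
    unfolding tuple_top_def
    by (rule continuous_map_pullback, rule continuous_map_product_projection) (use assms in simp)
  then show ?thesis
    by (rule continuous_map_eq) (use assms length_tuples in auto)
qed

lemma continuous_into_tuple_top:
  assumes f: "\<And>z. z \<in> topspace Z \<Longrightarrow> f z \<in> tuples G n"
    and cont: "\<And>i. i < max n 1 \<Longrightarrow> continuous_map Z (gtop G) (\<lambda>z. f z ! i)"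
  shows "continuous_map Z (tuple_top G n) f"
  unfolding tuple_top_def
proof (rule continuous_map_pullback')
  show "topspace Z \<subseteq> f -` tuples G n"
    using f by blast
  let ?e = "\<lambda>gs. \<lambda>i\<in>{..<length gs}. gs ! i"
  show "continuous_map Z (product_topology (\<lambda>_. gtop G) {..<max n 1}) (?e \<circ> f)"
  proof (rule continuous_map_coordinatewise_then_product)
    show "continuous_map Z (gtop G) (\<lambda>z. (?e \<circ> f) z i)" if "i \<in> {..<max n 1}" for i
      by (rule continuous_map_eq[OF cont[of i]]) (use that f length_tuples in fastforce)+
    show "(?e \<circ> f) z i = undefined" if "i \<notin> {..<max n 1}" "z \<in> topspace Z" for i z
      using that length_tuples[OF f[OF that(2)]] by simp
  qed
qed

lemma Hausdorff_tuple_top: "Hausdorff_space (tuple_top G n)"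
proof (rule Hausdorff_space_injective_preimage)
  let ?P = "product_topology (\<lambda>_. gtop G) {..<max n 1}" and ?e = "\<lambda>gs. \<lambda>i\<in>{..<length gs}. gs ! i"
  show "Hausdorff_space ?P"
    by (simp add: Hausdorff_space_product_topology Hausdorff)
  show "continuous_map (tuple_top G n) ?P ?e"
    using continuous_map_pullback[OF continuous_map_id, of "tuples G n" ?e ?P]
    by (simp add: tuple_top_def)
  show "inj_on ?e (topspace (tuple_top G n))"
  proof (rule inj_onI)
    fix gs hs assume gh: "gs \<in> topspace (tuple_top G n)" "hs \<in> topspace (tuple_top G n)" "?e gs = ?e hs"
    then have l: "length gs = length hs"
      using length_tuples by force
    have "gs ! i = hs ! i" if "i < length gs" for i
      using fun_cong[OF gh(3), of i] that l by simp
    then show "gs = hs"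
      using l by (simp add: nth_equalityI)
  qed
qed

lemma continuous_mul_comp:
  assumes "continuous_map Z (gtop G) f" "continuous_map Z (gtop G) h"
    and "\<And>z. z \<in> topspace Z \<Longrightarrow> src G (f z) = rng G (h z)"
  shows "continuous_map Z (gtop G) (\<lambda>z. mul G (f z) (h z))"
proof -
  have "f z \<in> arrows G \<and> h z \<in> arrows G" if "z \<in> topspace Z" for z
    using assms(1,2) that by (auto simp: continuous_map_def)
  then have "continuous_map Z (subtopology (prod_topology (gtop G) (gtop G))
      {(g, h). g \<in> arrows G \<and> h \<in> arrows G \<and> src G g = rng G h}) (\<lambda>z. (f z, h z))"
    using assms by (auto simp: continuous_map_in_subtopology continuous_map_paired)
  then show ?thesis
    using continuous_map_compose[OF _ continuous_mul] by (force simp: o_def)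
qed

lemma continuous_anchor: "continuous_map (tuple_top G n) (unit_top G) (anchor G)"
proof -
  have "continuous_map (tuple_top G n) (unit_top G) (rng G \<circ> (\<lambda>gs. gs ! 0))"
    by (rule continuous_map_compose[OF continuous_nth R.continuous_p]) simp
  then show ?thesis
    by (rule continuous_map_eq) (auto simp: anchor_def hd_conv_nth dest: tuples_nonempty)
qed

section \<open>Boxes of bisections: the tuple spaces are etale over the units\<close>

definition box :: "nat \<Rightarrow> (nat \<Rightarrow> 'g set) \<Rightarrow> 'g list set" where
  "box n V = {gs \<in> tuples G n. \<forall>i<n. gs ! i \<in> V i}"

lemma openin_box:
  assumes "\<And>i. openin (gtop G) (V i)"
  shows "openin (tuple_top G (Suc n)) (box (Suc n) V)"
proof -
  have "openin (tuple_top G (Suc n)) ((\<Inter>i\<in>{..n}. {gs \<in> topspace (tuple_top G (Suc n)). gs ! i \<in> V i}))"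
    by (rule openin_INT2) (auto intro!: openin_continuous_map_preimage[OF continuous_nth] assms
        simp del: topspace_tuple_top)
  moreover have "(\<Inter>i\<in>{..n}. {gs \<in> topspace (tuple_top G (Suc n)). gs ! i \<in> V i}) = box (Suc n) V"
    by (auto simp: box_def less_Suc_eq_le)
  ultimately show ?thesis by simp
qed

text \<open>Splitting off the first entry, the anchors of a box are the ranges of those arrows in
  \<open>V 0\<close> whose source is an anchor of the remaining box. This gives openness of the
  anchor map.\<close>

lemma openin_anchor_box:
  assumes "\<And>i. openin (gtop G) (V i)"
  shows "openin (unit_top G) (anchor G ` box (Suc n) V)"
  using assms
proof (induction n arbitrary: V)
  case 0
  have "anchor G ` box (Suc 0) V = rng G ` V 0"
  proof safe
    fix g assume "g \<in> V 0"
    then have "[g] \<in> box (Suc 0) V"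
      using openin_subset[OF 0[of 0]] by (auto simp: box_def singleton_tuples)
    moreover have "anchor G [g] = rng G g"
      by (simp add: anchor_def)
    ultimately show "rng G g \<in> anchor G ` box (Suc 0) V"
      by (metis imageI)
  next
    fix gs assume gs: "gs \<in> box (Suc 0) V"
    then have "gs \<noteq> []"
      using tuples_nonempty by (auto simp: box_def)
    then show "anchor G gs \<in> rng G ` V 0"
      using gs by (auto simp: box_def anchor_def hd_conv_nth)
  qed
  then show ?case
    using R.open_p 0 by (simp add: open_map_def)
next
  case (Suc n)
  let ?V = "\<lambda>i. V (Suc i)"
  have "anchor G ` box (Suc (Suc n)) V
      = rng G ` (V 0 \<inter> {g \<in> topspace (gtop G). src G g \<in> anchor G ` box (Suc n) ?V})"
  proof (intro subset_antisym subsetI)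
    fix x assume "x \<in> anchor G ` box (Suc (Suc n)) V"
    then obtain gs where gs: "gs \<in> box (Suc (Suc n)) V" "x = anchor G gs"
      by blast
    then obtain g hs where gh: "gs = g # hs"
      using tuples_nonempty by (metis (no_types, lifting) box_def list.exhaust mem_Collect_eq)
    then have "g \<in> arrows G" "hs \<in> tuples G (Suc n)" "src G g = anchor G hs"
      using gs tuples_Cons by (auto simp: box_def)
    moreover have "g \<in> V 0" "\<forall>i<Suc n. hs ! i \<in> V (Suc i)"
      using gs gh by (auto simp: box_def)
    ultimately show "x \<in> rng G ` (V 0 \<inter> {g \<in> topspace (gtop G). src G g \<in> anchor G ` box (Suc n) ?V})"
      using gs(2) gh by (auto simp: box_def anchor_def)
  next
    fix x assume "x \<in> rng G ` (V 0 \<inter> {g \<in> topspace (gtop G). src G g \<in> anchor G ` box (Suc n) ?V})"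
    then obtain g hs where g: "g \<in> V 0" "g \<in> arrows G" "src G g = anchor G hs" "hs \<in> box (Suc n) ?V"
        "x = rng G g"
      by auto
    then have "g # hs \<in> box (Suc (Suc n)) V"
      by (auto simp: box_def tuples_Cons nth_Cons split: nat.split)
    then show "x \<in> anchor G ` box (Suc (Suc n)) V"
      using g(5) by (force simp: anchor_def)
  qed
  moreover have "openin (gtop G) (V 0 \<inter> {g \<in> topspace (gtop G). src G g \<in> anchor G ` box (Suc n) ?V})"
    using Suc.IH[of ?V] Suc.prems by (intro openin_Int openin_continuous_map_preimage[OF S.continuous_p]) auto
  ultimately show ?case
    using R.open_p by (simp add: open_map_def)
qed

lemma box_base:
  assumes S: "openin (tuple_top G (Suc n)) S" and gs: "gs \<in> S"
  shows "\<exists>V. (\<forall>i. openin (gtop G) (V i)) \<and> (\<forall>i\<le>n. bisection (V i)) \<and>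
    gs \<in> box (Suc n) V \<and> box (Suc n) V \<subseteq> S"
proof -
  let ?e = "\<lambda>gs. \<lambda>i\<in>{..<length gs}. gs ! i"
  have gsT: "gs \<in> tuples G (Suc n)"
    using openin_subset[OF S] gs by auto
  have len: "length hs = Suc n" if "hs \<in> tuples G (Suc n)" for hs
    using length_tuples[OF that] by simp
  obtain U where U: "openin (product_topology (\<lambda>_. gtop G) {..<Suc n}) U"
      "S = ?e -` U \<inter> tuples G (Suc n)"
    using S by (auto simp: tuple_top_def openin_pullback_topology)
  have "?e gs \<in> U"
    using gs U(2) by blast
  with U(1) obtain W where W: "?e gs \<in> (\<Pi>\<^sub>E i\<in>{..<Suc n}. W i)" "\<And>i. openin (gtop G) (W i)"
      "(\<Pi>\<^sub>E i\<in>{..<Suc n}. W i) \<subseteq> U"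
    using product_topology_open_contains_basis[of "\<lambda>_. gtop G" "{..<Suc n}" U "?e gs"] by blast
  have "\<exists>B. bisection B \<and> gs ! i \<in> B \<and> B \<subseteq> W i" if "i \<le> n" for i
  proof (rule bisection_base[OF W(2)])
    have "?e gs i \<in> W i"
      using W(1) that by (meson PiE_mem le_imp_less_Suc lessThan_iff)
    then show "gs ! i \<in> W i"
      using that len[OF gsT] by simp
  qed
  then obtain B where B: "\<And>i. i \<le> n \<Longrightarrow> bisection (B i) \<and> gs ! i \<in> B i \<and> B i \<subseteq> W i"
    by metis
  \<comment> \<open>The value for indices beyond \<open>n\<close> does not affect the box; the empty
    set is taken so that every \<open>V i\<close> is open.\<close>
  define V where "V i = (if i \<le> n then B i else {})" for i
  have "box (Suc n) V \<subseteq> S"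
  proof
    fix hs assume hs: "hs \<in> box (Suc n) V"
    then have "hs \<in> tuples G (Suc n)"
      by (simp add: box_def)
    moreover have "?e hs \<in> (\<Pi>\<^sub>E i\<in>{..<Suc n}. W i)"
      using hs B len[OF \<open>hs \<in> tuples G (Suc n)\<close>] unfolding box_def V_def
      by (auto simp: PiE_iff less_Suc_eq_le subset_iff)
    ultimately show "hs \<in> S"
      using W(3) U(2) by blast
  qed
  moreover have "gs \<in> box (Suc n) V"
    using gsT B by (auto simp: box_def V_def)
  moreover have "openin (gtop G) (V i)" for i
    using B by (auto simp: V_def compact_open_bisection_def)
  ultimately show ?thesis
    using B by (intro exI[of _ V]) (auto simp: V_def)
qed

text \<open>The anchor determines the first entry in the bisection \<open>V 0\<close>, the source of
  that entry is the range of the second one, and so on along the tuple.\<close>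

lemma inj_on_box:
  assumes V: "\<And>i. i \<le> n \<Longrightarrow> bisection (V i)"
  shows "inj_on (anchor G) (box (Suc n) V)"
proof (rule inj_onI)
  fix gs hs assume gh: "gs \<in> box (Suc n) V" "hs \<in> box (Suc n) V" "anchor G gs = anchor G hs"
  then have T: "gs \<in> tuples G (Suc n)" "hs \<in> tuples G (Suc n)"
    by (auto simp: box_def)
  have eq: "gs ! i = hs ! i" if "i \<le> n" for i
    using that
  proof (induction i)
    case 0
    have "rng G (gs ! 0) = rng G (hs ! 0)"
      using gh(3) T tuples_nonempty by (metis anchor_def hd_conv_nth)
    moreover have "gs ! 0 \<in> V 0" "hs ! 0 \<in> V 0"
      using gh by (auto simp: box_def)
    ultimately show ?case
      using R.slice_inj V[of 0] bisection_iff by blast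
  next
    case (Suc i)
    then have "rng G (gs ! Suc i) = rng G (hs ! Suc i)"
      using T tuples_src[of gs "Suc n" i] tuples_src[of hs "Suc n" i] by simp
    moreover have "gs ! Suc i \<in> V (Suc i)" "hs ! Suc i \<in> V (Suc i)"
      using gh Suc.prems by (auto simp: box_def)
    ultimately show ?case
      using R.slice_inj V[of "Suc i"] Suc.prems bisection_iff by blast
  qed
  have "length gs = Suc n" "length hs = Suc n"
    using T length_tuples by fastforce+
  then show "gs = hs"
    using eq by (intro nth_equalityI) auto
qed

text \<open>In the product space the box is a product of compact sets cut by the closed conditions
  of composability; the compact set found there is carried over to lists by the continuous map
  \<open>?l\<close>.\<close>

lemma compactin_box:
  assumes V: "\<And>i. i \<le> n \<Longrightarrow> bisection (V i)"
  shows "compactin (tuple_top G (Suc n)) (box (Suc n) V)"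
proof -
  let ?P = "product_topology (\<lambda>_. gtop G) {..<Suc n}"
  let ?C = "\<lambda>i. {h \<in> topspace ?P. (src G \<circ> (\<lambda>h. h i)) h = (rng G \<circ> (\<lambda>h. h (Suc i))) h}"
  let ?F = "\<Inter>i\<in>{..<n}. ?C i" and ?l = "\<lambda>h :: nat \<Rightarrow> 'g. map h [0..<Suc n]"
  have comp: "compactin ?P ((\<Pi>\<^sub>E i\<in>{..<Suc n}. V i) \<inter> ?F)"
  \<comment> \<open>For \<open>n = 0\<close> there is no composability condition, and the empty
    intersection \<open>?F\<close> is \<open>UNIV\<close>, not a closed subset of the space.\<close>
  proof (cases "n = 0")
    case True
    have "compactin ?P (\<Pi>\<^sub>E i\<in>{..<Suc n}. V i)"
      using V by (simp add: compactin_PiE less_Suc_eq_le compact_open_bisection_def)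
    then show ?thesis
      using True by simp
  next
    case False
    have proj: "continuous_map ?P (gtop G) (\<lambda>h. h i)" if "i \<le> n" for i
      using that continuous_map_product_projection[of i "{..<Suc n}" "\<lambda>_. gtop G"] by simp
    have "closedin ?P (?C i)" if "i < n" for i
      using that
      by (intro closedin_continuous_maps_eq[OF Hausdorff_unit_top]
          continuous_map_compose[OF proj S.continuous_p] continuous_map_compose[OF proj R.continuous_p])
        auto
    then have "closedin ?P ?F"
      using False by (intro closedin_INT) auto
    moreover have "compactin ?P (\<Pi>\<^sub>E i\<in>{..<Suc n}. V i)"
      using V by (simp add: compactin_PiE less_Suc_eq_le compact_open_bisection_def)
    ultimately show ?thesis
      by (rule compact_Int_closedin[rotated])
  qed
  define K where "K = (\<Pi>\<^sub>E i\<in>{..<Suc n}. V i) \<inter> ?F"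
  have nth: "?l h ! i = h i" if "i \<le> n" for h i
    using that by (simp del: upt_Suc)
  have K: "h i \<in> V i" "h i \<in> arrows G" if "h \<in> K" "i \<le> n" for h i
  proof -
    show "h i \<in> V i"
      using that PiE_mem[of h "{..<Suc n}" V i] by (auto simp: K_def)
    then show "h i \<in> arrows G"
      using V bisection_arrows that(2) by blast
  qed
  have K': "src G (h i) = rng G (h (Suc i))" if "h \<in> K" "i < n" for h i
    using that by (auto simp: K_def)
  have lK: "?l h \<in> tuples G (Suc n)" if "h \<in> K" for h
    unfolding tuples_Suc using K[OF that] K'[OF that] by (simp add: nth del: upt_Suc)
  have "continuous_map (subtopology ?P K) (tuple_top G (Suc n)) ?l"
  proof (rule continuous_into_tuple_top)
    show "?l h \<in> tuples G (Suc n)" if "h \<in> topspace (subtopology ?P K)" for h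
      using that lK by simp
    show "continuous_map (subtopology ?P K) (gtop G) (\<lambda>h. ?l h ! i)" if "i < max (Suc n) 1" for i
    proof -
      have "continuous_map (subtopology ?P K) (gtop G) (\<lambda>h. h i)"
        using that by (intro continuous_map_from_subtopology continuous_map_product_projection) auto
      then show ?thesis
        using that by (simp add: nth del: upt_Suc)
    qed
  qed
  moreover have "compactin (subtopology ?P K) K"
    using comp by (simp add: compactin_subtopology K_def)
  ultimately have "compactin (tuple_top G (Suc n)) (?l ` K)"
    using image_compactin by blast
  moreover have "?l ` K = box (Suc n) V"
  proof (intro subset_antisym subsetI)
    fix gs assume "gs \<in> ?l ` K"
    then show "gs \<in> box (Suc n) V"
      using K lK nth by (auto simp: box_def less_Suc_eq_le simp del: upt_Suc)
  next
    fix gs assume gs: "gs \<in> box (Suc n) V"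
    then have T: "gs \<in> tuples G (Suc n)"
      by (simp add: box_def)
    let ?h = "\<lambda>i\<in>{..<Suc n}. gs ! i"
    have "?l ?h = gs"
      using T by (intro nth_equalityI) (auto simp: tuples_Suc nth less_Suc_eq_le simp del: upt_Suc)
    moreover have "?h \<in> K"
      using gs T by (auto simp: K_def box_def tuples_Suc PiE_iff less_Suc_eq_le)
    ultimately show "gs \<in> ?l ` K"
      by (metis imageI)
  qed
  ultimately show ?thesis by simp
qed

lemma etale_tuple_top: "etale_space (unit_top G) (tuple_top G (Suc n)) (anchor G)"
proof
  show "Hausdorff_space (unit_top G)" "Hausdorff_space (tuple_top G (Suc n))"
    by (rule Hausdorff_unit_top Hausdorff_tuple_top)+
  show "\<exists>U. compact_open (unit_top G) U \<and> x \<in> U \<and> U \<subseteq> S" if "openin (unit_top G) S" "x \<in> S" for S x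
    using unit_base that .
  show "continuous_map (tuple_top G (Suc n)) (unit_top G) (anchor G)"
    by (rule continuous_anchor)
  show "open_map (tuple_top G (Suc n)) (unit_top G) (anchor G)"
    unfolding open_map_def
  proof (intro allI impI)
    fix S assume S: "openin (tuple_top G (Suc n)) S"
    show "openin (unit_top G) (anchor G ` S)"
    proof (subst openin_subopen, safe)
      fix gs assume "gs \<in> S"
      then obtain V where "\<forall>i. openin (gtop G) (V i)" "gs \<in> box (Suc n) V" "box (Suc n) V \<subseteq> S"
        using box_base[OF S] by blast
      then show "\<exists>T. openin (unit_top G) T \<and> anchor G gs \<in> T \<and> T \<subseteq> anchor G ` S"
        using openin_anchor_box[of V n] by (intro exI[of _ "anchor G ` box (Suc n) V"]) blast
    qed
  qed
  show "\<exists>V. compact_open (tuple_top G (Suc n)) V \<and> inj_on (anchor G) V \<and> gs \<in> V"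
    if gs: "gs \<in> topspace (tuple_top G (Suc n))" for gs
  proof -
    obtain V where "\<forall>i. openin (gtop G) (V i)" "\<forall>i\<le>n. bisection (V i)" "gs \<in> box (Suc n) V"
      using box_base[OF openin_topspace gs] by blast
    then show ?thesis
      using openin_box[of V n] compactin_box[of n V] inj_on_box[of n V]
      by (intro exI[of _ "box (Suc n) V"]) (auto simp: compact_open_def)
  qed
qed

lemma tuple_act_in:
  assumes "g \<in> arrows G" "gs \<in> tuples G (Suc n)" "src G g = anchor G gs"
  shows "tuple_act G g gs \<in> tuples G (Suc n)"
proof -
  obtain h hs where gs: "gs = h # hs"
    using tuples_nonempty[OF assms(2)] list.exhaust by blast
  then show ?thesis
    using assms by (cases n; cases hs) (auto simp: tuple_act_def singleton_tuples tuples_Cons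
        anchor_def mul_in_arrows src_mul, auto simp: tuples_Suc)
qed

lemma anchor_tuple_act:
  assumes "g \<in> arrows G" "gs \<in> tuples G n" "src G g = anchor G gs"
  shows "anchor G (tuple_act G g gs) = rng G g"
  using assms hd_tuples by (simp add: tuple_act_def anchor_def rng_mul)

sublocale T: groupoid_space G "tuple_top G (Suc n)" "anchor G" "tuple_act G" for n
proof (intro groupoid_space.intro etale_tuple_top groupoid_space_axioms.intro)
  show "ample_groupoid G" ..
  fix g h gs
  show "tuple_act G g gs \<in> topspace (tuple_top G (Suc n))"
    if "g \<in> arrows G" "gs \<in> topspace (tuple_top G (Suc n))" "src G g = anchor G gs"
    using that tuple_act_in by simp
  show "anchor G (tuple_act G g gs) = rng G g"
    if "g \<in> arrows G" "gs \<in> topspace (tuple_top G (Suc n))" "src G g = anchor G gs"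
    using that anchor_tuple_act[of g gs "Suc n"] by simp
  show "tuple_act G (anchor G gs) gs = gs" if "gs \<in> topspace (tuple_top G (Suc n))"
  proof -
    have "gs \<noteq> []" "hd gs \<in> arrows G"
      using that tuples_nonempty hd_tuples by auto
    then show ?thesis
      by (simp add: tuple_act_def anchor_def mul_rng_left)
  qed
  show "tuple_act G g (tuple_act G h gs) = tuple_act G (mul G g h) gs"
    if "g \<in> arrows G" "h \<in> arrows G" "gs \<in> topspace (tuple_top G (Suc n))" "src G g = rng G h"
      "src G h = anchor G gs"
  proof -
    have "hd gs \<in> arrows G"
      using that hd_tuples by auto
    then show ?thesis
      using that by (simp add: tuple_act_def anchor_def mul_assoc)
  qed
  let ?Z = "subtopology (prod_topology (gtop G) (tuple_top G (Suc n))) {(g, gs). src G g = anchor G gs}"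
  show "continuous_map ?Z (tuple_top G (Suc n)) (\<lambda>(g, gs). tuple_act G g gs)"
  proof (rule continuous_into_tuple_top)
    show "(\<lambda>(g, gs). tuple_act G g gs) z \<in> tuples G (Suc n)" if "z \<in> topspace ?Z" for z
      using that tuple_act_in by auto
    have c1: "continuous_map ?Z (gtop G) fst"
      by (intro continuous_map_from_subtopology continuous_map_fst)
    have c2: "continuous_map ?Z (gtop G) (\<lambda>z. snd z ! i)" if "i < max (Suc n) 1" for i
      using continuous_map_compose[OF continuous_map_from_subtopology[OF continuous_map_snd] continuous_nth[OF that]]
      by (simp add: o_def)
    show "continuous_map ?Z (gtop G) (\<lambda>z. (\<lambda>(g, gs). tuple_act G g gs) z ! i)"
      if i: "i < max (Suc n) 1" for i
    proof (cases "i = 0")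
      case True
      have "continuous_map ?Z (gtop G) (\<lambda>z. mul G (fst z) (snd z ! 0))"
        by (rule continuous_mul_comp[OF c1 c2])
          (auto simp: anchor_def hd_conv_nth dest: tuples_nonempty)
      then show ?thesis
        using True by (elim continuous_map_eq)
          (auto simp: tuple_act_def hd_conv_nth dest: tuples_nonempty)
    next
      case False
      show ?thesis
        by (rule continuous_map_eq[OF c2[OF i]])
          (use False i in \<open>auto simp: tuple_act_def nth_tl nth_Cons dest!: length_tuples split: nat.split\<close>)
    qed
  qed
qed

lemma compact_open_slice_iff: "compact_open_slice G (Suc n) V \<longleftrightarrow> T.slice n V"
  by (simp add: compact_open_slice_def T.slice_iff_homeomorphic)

lemma smult_tuple_module: "smult (tuple_module G (Suc n)) = T.smul n"
  by (intro ext) (simp add: tuple_module_def T.smul_def tuple_act_def)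

section \<open>The face maps of the bar resolution\<close>

lemma bar_face_in:
  assumes gs: "gs \<in> tuples G (Suc (Suc n))" and i: "i \<le> Suc n"
  shows "bar_face G (Suc n) i gs \<in> tuples G (Suc n)"
proof -
  have len: "length gs = Suc (Suc n)" and ar: "\<And>j. j \<le> Suc n \<Longrightarrow> gs ! j \<in> arrows G"
    and sr: "\<And>j. j \<le> n \<Longrightarrow> src G (gs ! j) = rng G (gs ! Suc j)"
    using gs by (auto simp: tuples_Suc)
  show ?thesis
  proof (cases "i \<le> n")
    case True
    have nth: "merge_at G i gs ! j = (if j < i then gs ! j else if j = i
        then mul G (gs ! i) (gs ! Suc i) else gs ! Suc j)" if "j \<le> n" for j
      using True that len by (simp add: nth_merge_at)
    have "merge_at G i gs ! j \<in> arrows G" if "j \<le> n" for j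
      using that True ar sr by (simp add: nth mul_in_arrows)
    moreover have "src G (merge_at G i gs ! j) = rng G (merge_at G i gs ! Suc j)" if "j < n" for j
    proof -
      consider "Suc j < i" | "Suc j = i" | "j = i" | "i < j" by linarith
      then show ?thesis
        by cases (use that True ar sr in \<open>simp_all add: nth rng_mul src_mul\<close>)
    qed
    ultimately show ?thesis
      using True len by (simp add: bar_face_def tuples_Suc length_merge_at)
  next
    case False
    then show ?thesis
      using i len ar sr by (simp add: bar_face_def tuples_Suc nth_butlast)
  qed
qed

lemma continuous_bar_face:
  assumes i: "i \<le> Suc n"
  shows "continuous_map (tuple_top G (Suc (Suc n))) (tuple_top G (Suc n)) (bar_face G (Suc n) i)"
proof (rule continuous_into_tuple_top)
  show "bar_face G (Suc n) i gs \<in> tuples G (Suc n)" if "gs \<in> topspace (tuple_top G (Suc (Suc n)))" for gs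
    using that i bar_face_in by simp
  fix j assume j: "j < max (Suc n) 1"
  let ?Z = "tuple_top G (Suc (Suc n))"
  have len: "length gs = Suc (Suc n)" if "gs \<in> tuples G (Suc (Suc n))" for gs
    using length_tuples[OF that] by simp
  have c: "continuous_map ?Z (gtop G) (\<lambda>gs. gs ! k)" if "k \<le> Suc n" for k
    using that by (intro continuous_nth) simp
  consider "i = Suc n \<or> j < i" | "i \<le> n" "j = i" | "i \<le> n" "i < j"
    using i by linarith
  then show "continuous_map ?Z (gtop G) (\<lambda>gs. bar_face G (Suc n) i gs ! j)"
  proof cases
    case 1
    show ?thesis
      by (rule continuous_map_eq[OF c[of j]])
        (use 1 i j len in \<open>auto simp: bar_face_def nth_merge_at nth_butlast\<close>)
  next
    case 2
    have "continuous_map ?Z (gtop G) (\<lambda>gs. mul G (gs ! i) (gs ! Suc i))"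
      by (intro continuous_mul_comp c) (use 2 in \<open>auto simp: tuples_Suc\<close>)
    then show ?thesis
      by (rule continuous_map_eq) (use 2 i j len in \<open>auto simp: bar_face_def nth_merge_at\<close>)
  next
    case 3
    show ?thesis
      by (rule continuous_map_eq[OF c[of "Suc j"]])
        (use 3 i j len in \<open>auto simp: bar_face_def nth_merge_at\<close>)
  qed
qed

lemma anchor_bar_face:
  assumes gs: "gs \<in> tuples G (Suc (Suc n))" and i: "i \<le> Suc n"
  shows "anchor G (bar_face G (Suc n) i gs) = anchor G gs"
proof -
  have len: "length gs = Suc (Suc n)" and ar: "\<And>j. j \<le> Suc n \<Longrightarrow> gs ! j \<in> arrows G"
    and sr: "\<And>j. j \<le> n \<Longrightarrow> src G (gs ! j) = rng G (gs ! Suc j)"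
    using gs by (auto simp: tuples_Suc)
  have "rng G (bar_face G (Suc n) i gs ! 0) = rng G (gs ! 0)"
    using i len ar sr by (auto simp: bar_face_def nth_merge_at nth_butlast rng_mul)
  moreover have "bar_face G (Suc n) i gs \<noteq> []" "gs \<noteq> []"
    using tuples_nonempty bar_face_in assms by blast+
  ultimately show ?thesis
    by (simp add: anchor_def hd_conv_nth)
qed

lemma bar_face_morphism:
  "i \<le> Suc n \<Longrightarrow> etale_morphism (unit_top G) (tuple_top G (Suc n)) (anchor G)
    (tuple_top G (Suc (Suc n))) (anchor G) (bar_face G (Suc n) i)"
  by (intro etale_morphism.intro etale_tuple_top etale_morphism_axioms.intro)
    (simp_all add: continuous_bar_face anchor_bar_face)

text \<open>Only the face \<open>0\<close> changes the first entry, and there the claim is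
  associativity. The last face keeps the first entry because the tuple has at least two.\<close>

lemma bar_face_act:
  assumes g: "g \<in> arrows G" and gs: "gs \<in> tuples G (Suc (Suc n))" and sg: "src G g = anchor G gs"
  shows "bar_face G (Suc n) i (tuple_act G g gs) = tuple_act G g (bar_face G (Suc n) i gs)"
proof -
  obtain h hs where gs': "gs = h # hs"
    using tuples_nonempty[OF gs] list.exhaust by blast
  then have h: "h \<in> arrows G" "hs \<in> tuples G (Suc n)" "src G h = anchor G hs"
    using gs tuples_Cons by auto
  then obtain k ks where hs: "hs = k # ks"
    using tuples_nonempty list.exhaust by blast
  have "mul G (mul G g h) k = mul G g (mul G h k)"
    using g h sg gs' hs hd_tuples[OF h(2)] by (intro mul_assoc) (auto simp: anchor_def)
  then show ?thesis
    by (cases i) (auto simp: gs' hs bar_face_def merge_at_def tuple_act_def)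
qed

section \<open>Prefixing a unit and removing the first entry\<close>

lemma unit_cons_in: "gs \<in> tuples G n \<Longrightarrow> unit_cons G n gs \<in> tuples G (Suc n)"
  using hd_tuples[of gs n]
  by (cases n) (auto simp: unit_cons_def tuples_Cons anchor_def rng_in_units units_arrows src_unit,
      auto simp: tuples_def units_arrows)

lemma anchor_unit_cons: "gs \<in> tuples G n \<Longrightarrow> anchor G (unit_cons G n gs) = anchor G gs"
  using hd_tuples[of gs n] by (simp add: unit_cons_def anchor_def rng_in_units rng_unit)

lemma continuous_unit_cons: "continuous_map (tuple_top G n) (tuple_top G (Suc n)) (unit_cons G n)"
proof (rule continuous_into_tuple_top)
  show "unit_cons G n gs \<in> tuples G (Suc n)" if "gs \<in> topspace (tuple_top G n)" for gs
    using that unit_cons_in by simp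
  fix i assume i: "i < max (Suc n) 1"
  consider "n = 0" "i = 0" | "n > 0" "i = 0" | j where "n > 0" "i = Suc j"
    using i by (cases i) auto
  then show "continuous_map (tuple_top G n) (gtop G) (\<lambda>gs. unit_cons G n gs ! i)"
  proof cases
    case 1
    then show ?thesis
      using continuous_nth[of 0 0] by (simp add: unit_cons_def)
  next
    case 2
    have "continuous_map (tuple_top G n) (gtop G) (rng G \<circ> (\<lambda>gs. gs ! 0))"
      by (rule continuous_map_compose[OF continuous_nth continuous_rng]) simp
    then show ?thesis
      by (rule continuous_map_eq)
        (use 2 in \<open>auto simp: unit_cons_def hd_conv_nth dest: tuples_nonempty\<close>)
  next
    case 3
    then show ?thesis
      using continuous_nth[of j n] i by (simp add: unit_cons_def)
  qed
qed

lemma tuple_tail_in: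
  assumes "gs \<in> tuples G (Suc n)"
  shows "tuple_tail G gs \<in> tuples G n" and "anchor G (tuple_tail G gs) = src G (hd gs)"
proof -
  obtain h hs where gs: "gs = h # hs"
    using tuples_nonempty[OF assms] list.exhaust by blast
  have "tuple_tail G gs \<in> tuples G n \<and> anchor G (tuple_tail G gs) = src G (hd gs)"
  proof (cases n)
    case 0
    then have "hs = []" "h \<in> arrows G"
      using assms gs by (auto simp: tuples_Suc)
    then show ?thesis
      using 0 by (simp add: tuple_tail_def gs tuples_def anchor_def src_in_units rng_unit)
  next
    case (Suc m)
    then have "hs \<in> tuples G (Suc m)" "src G h = anchor G hs"
      using assms gs tuples_Cons by auto
    then show ?thesis
      using Suc tuples_nonempty by (auto simp: tuple_tail_def gs)
  qed
  then show "tuple_tail G gs \<in> tuples G n" "anchor G (tuple_tail G gs) = src G (hd gs)"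
    by auto
qed

lemma continuous_tuple_tail: "continuous_map (tuple_top G (Suc n)) (tuple_top G n) (tuple_tail G)"
proof (rule continuous_into_tuple_top)
  show "tuple_tail G gs \<in> tuples G n" if "gs \<in> topspace (tuple_top G (Suc n))" for gs
    using that tuple_tail_in(1) by simp
  have len: "length gs = Suc n" if "gs \<in> tuples G (Suc n)" for gs
    using length_tuples[OF that] by simp
  fix i assume i: "i < max n 1"
  show "continuous_map (tuple_top G (Suc n)) (gtop G) (\<lambda>gs. tuple_tail G gs ! i)"
  proof (cases "n = 0")
    case True
    have "continuous_map (tuple_top G (Suc n)) (gtop G) (src G \<circ> (\<lambda>gs. gs ! 0))"
      by (rule continuous_map_compose[OF continuous_nth continuous_src]) simp
    then show ?thesis
    proof (rule continuous_map_eq)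
      fix gs assume "gs \<in> topspace (tuple_top G (Suc n))"
      then obtain h where "gs = [h]"
        using True len[of gs] by (auto simp: length_Suc_conv)
      then show "(src G \<circ> (\<lambda>gs. gs ! 0)) gs = tuple_tail G gs ! i"
        using True i by (simp add: tuple_tail_def)
    qed
  next
    case False
    have "continuous_map (tuple_top G (Suc n)) (gtop G) (\<lambda>gs. gs ! Suc i)"
      by (rule continuous_nth) (use False i in simp)
    then show ?thesis
      by (rule continuous_map_eq)
        (use False i in \<open>auto simp: tuple_tail_def nth_tl dest!: len length_Suc_conv[THEN iffD1]\<close>)
  qed
qed

lemma tuple_tail_unit_cons: "gs \<in> tuples G n \<Longrightarrow> tuple_tail G (unit_cons G n gs) = gs"
  by (cases n) (auto simp: tuple_tail_def unit_cons_def dest: tuples_nonempty,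
      auto simp: tuples_def src_unit)

lemma tuple_act_unit_cons:
  assumes gs: "gs \<in> tuples G (Suc n)"
  shows "tuple_act G (hd gs) (unit_cons G n (tuple_tail G gs)) = gs"
proof -
  obtain h hs where gs': "gs = h # hs"
    using tuples_nonempty[OF gs] list.exhaust by blast
  show ?thesis
  proof (cases n)
    case 0
    then show ?thesis
      using gs by (auto simp: gs' tuple_act_def unit_cons_def tuple_tail_def tuples_Suc mul_src_right)
  next
    case (Suc m)
    then have h: "h \<in> arrows G" "hs \<in> tuples G (Suc m)" "src G h = anchor G hs"
      using gs gs' tuples_Cons by auto
    then have "hs \<noteq> []" "mul G h (rng G (hd hs)) = h"
      using tuples_nonempty mul_src_right[OF h(1)] by (auto simp: anchor_def)
    then show ?thesis
      using Suc by (simp add: gs' tuple_act_def unit_cons_def tuple_tail_def)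
  qed
qed

end

section \<open>The sheaf associated to a module\<close>

locale ample_module = ample_groupoid G + groupoid_module G M
  for G :: "'g groupoid" and M :: "('g \<Rightarrow> int, 'm) module" (structure)
begin

abbreviation unit_co :: "'g set \<Rightarrow> bool" where
  "unit_co \<equiv> compact_open (unit_top G)"

abbreviation germ :: "'g \<Rightarrow> 'm \<Rightarrow> ('g, 'm) germ" where
  "germ \<equiv> germ_at G M"

section \<open>Indicators of bisections acting on the module, and local units\<close>

lemma smult_zero_left: assumes "m \<in> carrier M" shows "(\<lambda>_. 0) \<odot> m = \<zero>"
proof -
  have "(\<lambda>_. 0) \<odot> m \<oplus> (\<lambda>_. 0) \<odot> m = (\<lambda>_. 0) \<odot> m"
    using smult_l_distr[of "\<lambda>_. 0" "\<lambda>_. 0" m] assms by simp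
  then show ?thesis
    using smult_closed[of "\<lambda>_. 0" m] assms by (metis Cc_zero add.l_cancel_one')
qed

lemma smult_uminus_left:
  assumes "f \<in> Cc (gtop G)" "m \<in> carrier M" shows "(\<lambda>g. - f g) \<odot> m = \<ominus> (f \<odot> m)"
proof -
  have "(\<lambda>g. - f g) \<odot> m \<oplus> f \<odot> m = \<zero>"
    using smult_l_distr[of "\<lambda>g. - f g" f m] assms smult_zero_left by (simp add: Cc_uminus)
  then show ?thesis
    using assms by (intro minus_equality[symmetric]) (simp_all add: smult_closed Cc_uminus)
qed

lemma smult_zero_right: assumes "f \<in> Cc (gtop G)" shows "f \<odot> \<zero> = \<zero>"
proof -
  have "f \<odot> \<zero> \<oplus> f \<odot> \<zero> = f \<odot> \<zero>"
    using smult_r_distr[of f \<zero> \<zero>] assms by simp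
  then show ?thesis
    using smult_closed[of f \<zero>] assms by (metis zero_closed add.l_cancel_one')
qed

lemma smult_minus_right:
  assumes "f \<in> Cc (gtop G)" "m \<in> carrier M" shows "f \<odot> (\<ominus> m) = \<ominus> (f \<odot> m)"
proof -
  have "f \<odot> (\<ominus> m) \<oplus> f \<odot> m = \<zero>"
    using smult_r_distr[of f "\<ominus> m" m] assms smult_zero_right by (simp add: l_neg)
  then show ?thesis
    using assms by (intro minus_equality[symmetric]) (simp_all add: smult_closed)
qed

lemma indicator_smult_closed [simp, intro]:
  "bisection B \<Longrightarrow> m \<in> carrier M \<Longrightarrow> indicator B \<odot> m \<in> carrier M"
  by (simp add: smult_closed indicator_bisection_in_Cc)

lemma cut_closed [simp, intro]: "unit_co U \<Longrightarrow> m \<in> carrier M \<Longrightarrow> indicator U \<odot> m \<in> carrier M"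
  by (simp add: unit_bisection)

lemma indicator_smult_smult:
  assumes "bisection B" "bisection C" "m \<in> carrier M"
  shows "indicator B \<odot> (indicator C \<odot> m) = indicator (A.act_set B C) \<odot> m"
proof -
  have "indicator B \<odot> (indicator C \<odot> m) = convolution G (indicator B) (indicator C) \<odot> m"
    using assms by (simp add: smult_assoc indicator_bisection_in_Cc)
  also have "convolution G (indicator B) (indicator C) = indicator (A.act_set B C)"
    using assms by (simp add: convolution_eq_smul A.smul_indicators bisection_iff)
  finally show ?thesis .
qed

lemma act_set_units_left:
  assumes "U \<subseteq> units G" "B \<subseteq> arrows G" shows "A.act_set U B = {b \<in> B. rng G b \<in> U}"
proof -
  have "src G u = u" if "u \<in> U" for u
    using assms that src_unit by blast
  moreover have "mul G (rng G b) b = b" if "b \<in> B" for b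
    using assms that mul_rng_left by blast
  ultimately show ?thesis
    unfolding A.act_set_def by (auto, metis)
qed

lemma act_set_units_right:
  assumes "U \<subseteq> units G" "B \<subseteq> arrows G" shows "A.act_set B U = {b \<in> B. src G b \<in> U}"
proof -
  have "rng G u = u" if "u \<in> U" for u
    using assms that rng_unit by blast
  moreover have "mul G b (src G b) = b" if "b \<in> B" for b
    using assms that mul_src_right by blast
  ultimately show ?thesis
    unfolding A.act_set_def by (auto, metis)
qed

lemma unit_co_units: "unit_co U \<Longrightarrow> U \<subseteq> units G"
  using compact_open_subset by fastforce

lemma bisection_subset: "bisection B \<Longrightarrow> B \<subseteq> arrows G"
  using bisection_arrows by blast

lemma cut_bisection:
  "unit_co U \<Longrightarrow> bisection B \<Longrightarrow> m \<in> carrier M \<Longrightarrow>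
    indicator U \<odot> (indicator B \<odot> m) = indicator {b \<in> B. rng G b \<in> U} \<odot> m"
  by (simp add: indicator_smult_smult unit_bisection act_set_units_left unit_co_units bisection_subset)

lemma bisection_cut:
  "unit_co U \<Longrightarrow> bisection B \<Longrightarrow> m \<in> carrier M \<Longrightarrow>
    indicator B \<odot> (indicator U \<odot> m) = indicator {b \<in> B. src G b \<in> U} \<odot> m"
  by (simp add: indicator_smult_smult unit_bisection act_set_units_right unit_co_units bisection_subset)

lemma cut_cut:
  assumes "unit_co U" "unit_co W" "m \<in> carrier M"
  shows "indicator U \<odot> (indicator W \<odot> m) = indicator (U \<inter> W) \<odot> m"
proof -
  have "{b \<in> W. rng G b \<in> U} = U \<inter> W"
    using unit_co_units[OF assms(2)] rng_unit by auto
  then show ?thesis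
    using assms by (simp add: cut_bisection unit_bisection)
qed

lemma cut_disjoint_Un:
  assumes "unit_co U" "unit_co W" "U \<inter> W = {}" "m \<in> carrier M"
  shows "indicator (U \<union> W) \<odot> m = indicator U \<odot> m \<oplus> indicator W \<odot> m"
proof -
  have "indicator (U \<union> W) = (\<lambda>g. indicator U g + indicator W g :: int)"
    using assms(3) by (auto simp: indicator_def fun_eq_iff)
  then show ?thesis
    using assms smult_l_distr by (simp add: indicator_bisection_in_Cc unit_bisection)
qed

text \<open>For the indicator of a bisection \<open>B\<close> the ranges of \<open>B\<close> form
  such a set. Demanding the identity for all larger \<open>U'\<close> lets the sets for two summands
  be combined by taking their union.\<close>

lemma local_unit_Cc:
  "f \<in> Cc (gtop G) \<Longrightarrow> \<exists>U. unit_co U \<and> (\<forall>U'. unit_co U' \<longrightarrow> U \<subseteq> U' \<longrightarrow> convolution G (indicator U') f = f)"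
proof (induction rule: Cc_bisection_induct)
  case (indicator B)
  then have co: "unit_co (rng G ` B)"
    by (simp add: bisection_iff R.slice_image)
  have "convolution G (indicator U') (indicator B) = indicator B" if "unit_co U'" "rng G ` B \<subseteq> U'" for U'
  proof -
    have "A.act_set U' B = B"
      using that indicator act_set_units_left[of U' B] unit_co_units bisection_subset by auto
    then show ?thesis
      using that indicator A.smul_indicators[of U' B]
      by (simp add: convolution_eq_smul unit_bisection[unfolded bisection_iff] bisection_iff)
  qed
  then show ?case
    using co by blast
next
  case (add f h)
  then obtain U W where UW: "unit_co U" "unit_co W"
      "\<And>U'. unit_co U' \<Longrightarrow> U \<subseteq> U' \<Longrightarrow> convolution G (indicator U') f = f"
      "\<And>U'. unit_co U' \<Longrightarrow> W \<subseteq> U' \<Longrightarrow> convolution G (indicator U') h = h"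
    by blast
  show ?case
  proof (intro exI[of _ "U \<union> W"] conjI allI impI)
    show "unit_co (U \<union> W)"
      using UW by (simp add: compact_open_Un)
    fix U' assume "unit_co U'" "U \<union> W \<subseteq> U'"
    then show "convolution G (indicator U') (\<lambda>y. f y + h y) = (\<lambda>y. f y + h y)"
      using UW(3,4)[of U'] A.smul_add_right[of "indicator U'" f h]
      by (simp add: convolution_eq_smul indicator_bisection_in_Cc unit_bisection)
  qed
next
  case (uminus f)
  then show ?case
    by (metis A.smul_uminus_right convolution_eq_smul)
qed

text \<open>A local unit for \<open>f\<close> also fixes \<open>f \<odot> m\<close>, by
  associativity, and nondegeneracy says that such products generate the module.\<close>

lemma local_unit:
  assumes "m \<in> carrier M"
  shows "\<exists>U. unit_co U \<and> (\<forall>U'. unit_co U' \<longrightarrow> U \<subseteq> U' \<longrightarrow> indicator U' \<odot> m = m)"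
proof -
  let ?H = "{f \<odot> m | f m. f \<in> Cc (gtop G) \<and> m \<in> carrier M}"
  \<comment> \<open>Membership in the carrier is part of the induction property because the step for
    sums applies \<open>smult_r_distr\<close>.\<close>
  let ?P = "\<lambda>m. m \<in> carrier M \<and> (\<exists>U. unit_co U \<and> (\<forall>U'. unit_co U' \<longrightarrow> U \<subseteq> U' \<longrightarrow> indicator U' \<odot> m = m))"
  have H: "?P h" if h: "h \<in> ?H" for h
  proof -
    obtain f m where fm: "h = f \<odot> m" "f \<in> Cc (gtop G)" "m \<in> carrier M"
      using h by blast
    obtain U where "unit_co U" "\<forall>U'. unit_co U' \<longrightarrow> U \<subseteq> U' \<longrightarrow> convolution G (indicator U') f = f"
      using local_unit_Cc[OF fm(2)] by blast
    then have "indicator U' \<odot> h = h" if "unit_co U'" "U \<subseteq> U'" for U'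
      using fm that smult_assoc[of "indicator U'" f m]
      by (simp add: indicator_bisection_in_Cc unit_bisection)
    then show ?thesis
      using \<open>unit_co U\<close> fm smult_closed by blast
  qed
  have "m \<in> generate (add_monoid M) ?H"
    using assms nondegenerate by simp
  then have "?P m"
  proof (induction rule: generate.induct)
    case one
    then show ?case
      by (auto intro!: exI[of _ "{}"] simp: smult_zero_right indicator_bisection_in_Cc unit_bisection)
  next
    case (incl h)
    then show ?case by (rule H)
  next
    case (inv h)
    then have "?P h" by (rule H)
    moreover have "inv\<^bsub>add_monoid M\<^esub> h = \<ominus> h"
      by (simp add: a_inv_def)
    ultimately show ?case
      by (auto simp: smult_minus_right indicator_bisection_in_Cc unit_bisection)
  next
    case (eng h1 h2)
    then obtain U W where UW: "unit_co U" "unit_co W"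
      "\<And>U'. unit_co U' \<Longrightarrow> U \<subseteq> U' \<Longrightarrow> indicator U' \<odot> h1 = h1"
      "\<And>U'. unit_co U' \<Longrightarrow> W \<subseteq> U' \<Longrightarrow> indicator U' \<odot> h2 = h2"
      by blast
    have "indicator U' \<odot> (h1 \<oplus> h2) = h1 \<oplus> h2" if "unit_co U'" "U \<union> W \<subseteq> U'" for U'
      using that UW eng by (simp add: smult_r_distr indicator_bisection_in_Cc unit_bisection)
    then show ?case
      using UW eng by (auto intro!: exI[of _ "U \<union> W"] simp: compact_open_Un)
  qed
  then show ?thesis by blast
qed

section \<open>Germs and the fibre groups\<close>

lemma unit_nhds_iff: "U \<in> unit_nhds G x \<longleftrightarrow> unit_co U \<and> x \<in> U"
  by (auto simp: unit_nhds_def compact_open_def)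

lemma unit_nhds_nonempty: "x \<in> units G \<Longrightarrow> \<exists>U. unit_co U \<and> x \<in> U"
  using unit_base[of "units G" x] openin_topspace[of "unit_top G"] by auto

lemma unit_co_Int: "unit_co U \<Longrightarrow> unit_co W \<Longrightarrow> unit_co (U \<inter> W)"
  by (rule compact_open_Int[OF Hausdorff_unit_top])

text \<open>The indicator of \<open>U\<close> acts as an idempotent, so its image consists of the
  elements it fixes.\<close>

lemma cut_iff: "unit_co U \<Longrightarrow> m \<in> cut M U \<longleftrightarrow> m \<in> carrier M \<and> indicator U \<odot> m = m"
  by (auto simp: cut_def cut_cut) (metis imageI)

text \<open>Agreement after cutting to \<open>W\<close> passes to smaller sets, so \<open>W\<close>
  can be intersected with \<open>U\<close> and \<open>U'\<close>.\<close>

lemma germ_rel_iff: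
  "((U, m), (U', m')) \<in> germ_rel G M x \<longleftrightarrow> unit_co U \<and> x \<in> U \<and> m \<in> cut M U \<and>
    unit_co U' \<and> x \<in> U' \<and> m' \<in> cut M U' \<and>
    (\<exists>W. unit_co W \<and> x \<in> W \<and> indicator W \<odot> m = indicator W \<odot> m')" (is "?l \<longleftrightarrow> ?r")
proof
  assume ?r
  then obtain W where W: "unit_co U" "x \<in> U" "m \<in> cut M U" "unit_co U'" "x \<in> U'" "m' \<in> cut M U'"
      "unit_co W" "x \<in> W" "indicator W \<odot> m = indicator W \<odot> m'"
    by blast
  let ?W = "(U \<inter> U') \<inter> W"
  have "indicator ?W \<odot> m = indicator ?W \<odot> m'"
    using W cut_cut[of "U \<inter> U'" W m] cut_cut[of "U \<inter> U'" W m'] by (simp add: cut_iff unit_co_Int)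
  then show ?l
    using W unit_co_Int by (auto simp: germ_rel_def unit_nhds_iff intro!: bexI[of _ ?W])
qed (auto simp: germ_rel_def unit_nhds_iff)

lemma germ_rel_equiv: "equiv (SIGMA U:unit_nhds G x. cut M U) (germ_rel G M x)"
proof (rule equivI)
  show "germ_rel G M x \<subseteq> (SIGMA U:unit_nhds G x. cut M U) \<times> (SIGMA U:unit_nhds G x. cut M U)"
    by (auto simp: germ_rel_def)
  show "refl_on (SIGMA U:unit_nhds G x. cut M U) (germ_rel G M x)"
    by (auto simp: refl_on_def germ_rel_iff unit_nhds_iff)
  show "sym (germ_rel G M x)"
    by (auto simp: sym_def germ_rel_iff)
  show "trans (germ_rel G M x)"
  proof (rule transI, clarify)
    fix U m U' m' U'' m''
    assume 1: "((U, m), (U', m')) \<in> germ_rel G M x" and 2: "((U', m'), (U'', m'')) \<in> germ_rel G M x"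
    obtain W where W: "unit_co W" "x \<in> W" "indicator W \<odot> m = indicator W \<odot> m'"
      using 1 by (auto simp: germ_rel_iff)
    obtain W' where W': "unit_co W'" "x \<in> W'" "indicator W' \<odot> m' = indicator W' \<odot> m''"
      using 2 by (auto simp: germ_rel_iff)
    have m: "m \<in> carrier M" "m' \<in> carrier M" "m'' \<in> carrier M"
      using 1 2 by (auto simp: germ_rel_iff cut_iff)
    have "indicator (W' \<inter> W) \<odot> m = indicator (W' \<inter> W) \<odot> m'"
      using cut_cut[OF W'(1) W(1)] W(3) m by metis
    also have "\<dots> = indicator (W' \<inter> W) \<odot> m''"
      using cut_cut[OF W(1) W'(1)] W'(3) m by (metis Int_commute)
    finally have "indicator (W' \<inter> W) \<odot> m = indicator (W' \<inter> W) \<odot> m''" .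
    then show "((U, m), (U'', m'')) \<in> germ_rel G M x"
      using 1 2 W W' unit_co_Int[of W' W] unfolding germ_rel_iff by blast
  qed
qed

text \<open>The restrictions of \<open>m\<close> to two neighbourhoods agree on their intersection,
  so the union in \<open>germ_at\<close> is one equivalence class and may be computed from any
  single \<open>U\<close>.\<close>

lemma germ_class:
  assumes m: "m \<in> carrier M" and U: "unit_co U" "x \<in> U"
  shows "germ x m = (x, germ_rel G M x `` {(U, indicator U \<odot> m)})"
proof -
  have "germ_rel G M x `` {(V, indicator V \<odot> m)} = germ_rel G M x `` {(U, indicator U \<odot> m)}"
    if V: "V \<in> unit_nhds G x" for V
  proof (rule equiv_class_eq[OF germ_rel_equiv])
    have "indicator (V \<inter> U) \<odot> (indicator V \<odot> m) = indicator (V \<inter> U) \<odot> (indicator U \<odot> m)"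
      using U V m cut_cut[of "V \<inter> U"] unit_co_Int[of V U] unfolding unit_nhds_iff
      by (simp add: Int_absorb2)
    then show "((V, indicator V \<odot> m), U, indicator U \<odot> m) \<in> germ_rel G M x"
      using U V m unit_co_Int[of V U] unfolding unit_nhds_iff germ_rel_iff
      by (auto simp: cut_def)
  qed
  then have "germ_rel G M x `` {(V, indicator V \<odot> m) | V. V \<in> unit_nhds G x}
      = germ_rel G M x `` {(U, indicator U \<odot> m)}"
    using U by (fastforce simp: unit_nhds_iff)
  then show ?thesis
    by (simp add: germ_at_def)
qed

lemma germ_eq_iff:
  assumes x: "x \<in> units G" and m: "m \<in> carrier M" "m' \<in> carrier M"
  shows "germ x m = germ x m' \<longleftrightarrow> (\<exists>W. unit_co W \<and> x \<in> W \<and> indicator W \<odot> m = indicator W \<odot> m')"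
proof -
  obtain U where U: "unit_co U" "x \<in> U"
    using unit_nhds_nonempty[OF x] by blast
  have "germ x m = germ x m' \<longleftrightarrow>
      ((U, indicator U \<odot> m), (U, indicator U \<odot> m')) \<in> germ_rel G M x"
    using U m eq_equiv_class_iff[OF germ_rel_equiv]
    by (simp add: germ_class[of _ U] unit_nhds_iff cut_def)
  also have "\<dots> \<longleftrightarrow> (\<exists>W. unit_co W \<and> x \<in> W \<and> indicator W \<odot> m = indicator W \<odot> m')"
  proof
    assume "((U, indicator U \<odot> m), (U, indicator U \<odot> m')) \<in> germ_rel G M x"
    then obtain W where "unit_co W" "x \<in> W"
        "indicator W \<odot> (indicator U \<odot> m) = indicator W \<odot> (indicator U \<odot> m')"
      by (auto simp: germ_rel_iff)
    then show "\<exists>W. unit_co W \<and> x \<in> W \<and> indicator W \<odot> m = indicator W \<odot> m'"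
      using U m cut_cut by (intro exI[of _ "W \<inter> U"]) (auto simp: unit_co_Int)
  next
    assume "\<exists>W. unit_co W \<and> x \<in> W \<and> indicator W \<odot> m = indicator W \<odot> m'"
    then obtain W where W: "unit_co W" "x \<in> W" "indicator W \<odot> m = indicator W \<odot> m'"
      by blast
    have "indicator W \<odot> (indicator U \<odot> m) = indicator W \<odot> (indicator U \<odot> m')"
      using W U m cut_cut[of U W] cut_cut[of W U] by (metis Int_commute)
    then show "((U, indicator U \<odot> m), (U, indicator U \<odot> m')) \<in> germ_rel G M x"
      using U W m by (auto simp: germ_rel_iff cut_def)
  qed
  finally show ?thesis .
qed

lemma germ_eqI:
  "\<lbrakk>unit_co W; x \<in> W; m \<in> carrier M; m' \<in> carrier M; indicator W \<odot> m = indicator W \<odot> m'\<rbrakk>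
    \<Longrightarrow> germ x m = germ x m'"
  using germ_eq_iff unit_co_units by blast

text \<open>Addition in \<open>fiber\<close> and the action \<open>sheaf_act\<close> are unions over
  all representatives. Here every representative is seen to be a module element with the same germ,
  so that such unions are unions of one constant set.\<close>

lemma germ_rep:
  assumes x: "x \<in> units G" and m: "m \<in> carrier M" and um: "(U, m') \<in> snd (germ x m)"
  shows "unit_co U" "x \<in> U" "m' \<in> cut M U" "m' \<in> carrier M" "germ x m' = germ x m"
proof -
  obtain V where V: "unit_co V" "x \<in> V"
    using unit_nhds_nonempty[OF x] by blast
  have r: "((V, indicator V \<odot> m), (U, m')) \<in> germ_rel G M x"
    using um germ_class[OF m V] by simp
  then show "unit_co U" "x \<in> U" "m' \<in> cut M U" and m': "m' \<in> carrier M"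
    by (auto simp: germ_rel_iff cut_iff)
  obtain W where W: "unit_co W" "x \<in> W" "indicator W \<odot> (indicator V \<odot> m) = indicator W \<odot> m'"
    using r by (auto simp: germ_rel_iff)
  have "indicator (V \<inter> W) \<odot> m' = indicator V \<odot> (indicator W \<odot> (indicator V \<odot> m))"
    using cut_cut[OF V(1) W(1) m'] W(3) by simp
  also have "\<dots> = indicator (V \<inter> W \<inter> V) \<odot> m"
    using cut_cut[OF V(1) W(1), of "indicator V \<odot> m"] cut_cut[OF unit_co_Int[OF V(1) W(1)] V(1) m] V m
    by simp
  also have "V \<inter> W \<inter> V = V \<inter> W"
    by blast
  finally show "germ x m' = germ x m"
    using W V m m' by (intro germ_eqI[of "V \<inter> W"]) (auto simp: unit_co_Int)
qed

lemma germ_rep_exists: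
  assumes x: "x \<in> units G" and m: "m \<in> carrier M"
  shows "\<exists>U m'. (U, m') \<in> snd (germ x m)"
proof -
  obtain V where V: "unit_co V" "x \<in> V"
    using unit_nhds_nonempty[OF x] by blast
  have "(V, indicator V \<odot> m) \<in> germ_rel G M x `` {(V, indicator V \<odot> m)}"
    using V m by (auto simp: germ_rel_iff cut_def)
  then show ?thesis
    using germ_class[OF m V] by auto
qed

lemma fst_germ [simp]: "fst (germ x m) = x"
  by (simp add: germ_at_def)

lemma germ_in_fiber [intro]:
  assumes "x \<in> units G" "m \<in> carrier M" shows "germ x m \<in> carrier (fiber G M x)"
proof -
  obtain V where V: "unit_co V" "x \<in> V"
    using unit_nhds_nonempty[OF assms(1)] by blast
  then show ?thesis
    using assms(2) by (auto simp: fiber_def germ_class[OF assms(2) V] unit_nhds_iff cut_def intro!: quotientI)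
qed

lemma fiber_cases:
  assumes "a \<in> carrier (fiber G M x)"
  obtains U m where "unit_co U" "x \<in> U" "m \<in> cut M U" "m \<in> carrier M" "a = germ x m"
proof -
  obtain U m where Um: "unit_co U" "x \<in> U" "m \<in> cut M U" "a = (x, germ_rel G M x `` {(U, m)})"
    using assms by (auto simp: fiber_def quotient_def unit_nhds_iff)
  then have "m \<in> carrier M" "indicator U \<odot> m = m"
    by (auto simp: cut_iff)
  then show ?thesis
    using Um that germ_class[of m U x] by simp
qed

lemma germ_add_cong:
  assumes x: "x \<in> units G" and m: "m \<in> carrier M" "m' \<in> carrier M" "n \<in> carrier M" "n' \<in> carrier M"
    and eq: "germ x m = germ x m'" "germ x n = germ x n'"
  shows "germ x (m \<oplus> n) = germ x (m' \<oplus> n')"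
proof -
  obtain V W where VW: "unit_co V" "x \<in> V" "indicator V \<odot> m = indicator V \<odot> m'"
      "unit_co W" "x \<in> W" "indicator W \<odot> n = indicator W \<odot> n'"
    using eq germ_eq_iff x m by meson
  have "indicator (V \<inter> W) \<odot> m = indicator (V \<inter> W) \<odot> m'" "indicator (V \<inter> W) \<odot> n = indicator (V \<inter> W) \<odot> n'"
    using VW m cut_cut[of W V] cut_cut[of V W] by (metis Int_commute)+
  then show ?thesis
    using VW m by (intro germ_eqI[of "V \<inter> W"])
      (auto simp: unit_co_Int smult_r_distr indicator_bisection_in_Cc unit_bisection)
qed

lemma UN_const_eq: "\<lbrakk>S \<noteq> {}; \<And>a. a \<in> S \<Longrightarrow> F a = c\<rbrakk> \<Longrightarrow> (\<Union>a\<in>S. F a) = c"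
  by auto

lemma fiber_add:
  assumes x: "x \<in> units G" and m: "m \<in> carrier M" "n \<in> carrier M"
  shows "germ x m \<oplus>\<^bsub>fiber G M x\<^esub> germ x n = germ x (m \<oplus> n)"
proof -
  have "(\<Union>(U, m')\<in>snd (germ x m). \<Union>(U', n')\<in>snd (germ x n). snd (germ x (m' \<oplus> n')))
      = snd (germ x (m \<oplus> n))"
  proof (rule UN_const_eq)
    show "snd (germ x m) \<noteq> {}"
      using germ_rep_exists[OF x m(1)] by auto
    fix a assume a: "a \<in> snd (germ x m)"
    obtain U m' where am: "a = (U, m')"
      by (cases a)
    have "(\<Union>(U', n')\<in>snd (germ x n). snd (germ x (m' \<oplus> n'))) = snd (germ x (m \<oplus> n))"
    proof (rule UN_const_eq)
      show "snd (germ x n) \<noteq> {}"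
        using germ_rep_exists[OF x m(2)] by auto
      fix b assume b: "b \<in> snd (germ x n)"
      obtain U' n' where bn: "b = (U', n')"
        by (cases b)
      have "germ x (m' \<oplus> n') = germ x (m \<oplus> n)"
        using germ_rep[OF x m(1), of U m'] germ_rep[OF x m(2), of U' n'] a b m
        unfolding am bn by (intro germ_add_cong[OF x]) auto
      then show "(case b of (U', n') \<Rightarrow> snd (germ x (m' \<oplus> n'))) = snd (germ x (m \<oplus> n))"
        by (simp add: bn)
    qed
    then show "(case a of (U, m') \<Rightarrow> \<Union>(U', n')\<in>snd (germ x n). snd (germ x (m' \<oplus> n'))) = snd (germ x (m \<oplus> n))"
      by (simp add: am)
  qed
  then show ?thesis
    by (simp add: fiber_def prod_eq_iff)
qed

lemma fiber_zero: "\<zero>\<^bsub>fiber G M x\<^esub> = germ x \<zero>"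
  by (simp add: fiber_def)

lemma fiber_abelian_group: assumes x: "x \<in> units G" shows "abelian_group (fiber G M x)"
proof (rule abelian_groupI)
  fix a b c assume "a \<in> carrier (fiber G M x)" "b \<in> carrier (fiber G M x)" "c \<in> carrier (fiber G M x)"
  then obtain k m n where kmn: "k \<in> carrier M" "m \<in> carrier M" "n \<in> carrier M"
      "a = germ x k" "b = germ x m" "c = germ x n"
    by (metis fiber_cases)
  show "a \<oplus>\<^bsub>fiber G M x\<^esub> b \<in> carrier (fiber G M x)"
    "a \<oplus>\<^bsub>fiber G M x\<^esub> b \<oplus>\<^bsub>fiber G M x\<^esub> c = a \<oplus>\<^bsub>fiber G M x\<^esub> (b \<oplus>\<^bsub>fiber G M x\<^esub> c)"
    "a \<oplus>\<^bsub>fiber G M x\<^esub> b = b \<oplus>\<^bsub>fiber G M x\<^esub> a" "\<zero>\<^bsub>fiber G M x\<^esub> \<oplus>\<^bsub>fiber G M x\<^esub> a = a"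
    using kmn x by (auto simp: fiber_add fiber_zero a_ac)
  show "\<exists>y\<in>carrier (fiber G M x). y \<oplus>\<^bsub>fiber G M x\<^esub> a = \<zero>\<^bsub>fiber G M x\<^esub>"
    using kmn x by (intro bexI[of _ "germ x (\<ominus> k)"]) (auto simp: fiber_add fiber_zero l_neg)
next
  show "\<zero>\<^bsub>fiber G M x\<^esub> \<in> carrier (fiber G M x)"
    using x by (auto simp: fiber_zero)
qed

lemma fiber_minus:
  assumes x: "x \<in> units G" and m: "m \<in> carrier M"
  shows "\<ominus>\<^bsub>fiber G M x\<^esub> germ x m = germ x (\<ominus> m)"
proof -
  interpret F: abelian_group "fiber G M x"
    by (rule fiber_abelian_group[OF x])
  show ?thesis
    using m x by (intro F.minus_equality) (auto simp: fiber_add fiber_zero l_neg)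
qed

section \<open>Germs separate module elements, and sections glue\<close>

lemma germ_cut:
  assumes "unit_co U" "x \<in> U" "m \<in> carrier M"
  shows "germ x (indicator U \<odot> m) = germ x m"
  using assms by (intro germ_eqI[of U]) (auto simp: cut_cut)

text \<open>\<open>U\<close> is compact in a Hausdorff space and hence closed, so \<open>x\<close>
  has the compact open neighbourhood \<open>W - U\<close>, on which cutting by \<open>U\<close>
  leaves nothing.\<close>

lemma germ_cut_outside:
  assumes U: "unit_co U" and x: "x \<in> units G" "x \<notin> U" and m: "m \<in> carrier M"
  shows "germ x (indicator U \<odot> m) = germ x \<zero>"
proof -
  obtain W where W: "unit_co W" "x \<in> W"
    using unit_nhds_nonempty[OF x(1)] by blast
  have D: "unit_co (W - U)"
    by (rule compact_open_Diff[OF Hausdorff_unit_top W(1) U])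
  have "indicator (W - U) \<odot> (indicator U \<odot> m) = \<zero>"
    using D U m cut_cut[of "W - U" U m] smult_zero_left[OF m]
    by (simp add: Int_commute indicator_def[of "{}", abs_def])
  then show ?thesis
    using D W x U m by (intro germ_eqI[of "W - U"])
      (auto simp: smult_zero_right indicator_bisection_in_Cc unit_bisection)
qed

text \<open>Local units put both elements over one compact open set. Equality of germs gives
  equality after cutting to small sets, and this equality is inherited by subsets and by disjoint
  unions.\<close>

lemma germ_ext:
  assumes m: "m \<in> carrier M" "m' \<in> carrier M" and eq: "\<And>x. x \<in> units G \<Longrightarrow> germ x m = germ x m'"
  shows "m = m'"
proof -
  obtain U where "unit_co U" "\<forall>U'. unit_co U' \<longrightarrow> U \<subseteq> U' \<longrightarrow> indicator U' \<odot> m = m"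
    using local_unit[OF m(1)] by blast
  moreover obtain V where "unit_co V" "\<forall>U'. unit_co U' \<longrightarrow> V \<subseteq> U' \<longrightarrow> indicator U' \<odot> m' = m'"
    using local_unit[OF m(2)] by blast
  ultimately have UV: "unit_co (U \<union> V)" "indicator (U \<union> V) \<odot> m = m" "indicator (U \<union> V) \<odot> m' = m'"
    by (auto simp: compact_open_Un)
  have "indicator (U \<union> V) \<odot> m = indicator (U \<union> V) \<odot> m'"
    using Hausdorff_unit_top UV(1)
  proof (induction rule: compact_open_induct)
    case (local x)
    then show ?case
      using eq germ_eq_iff m unit_co_units[OF UV(1)] by blast
  next
    case empty
    show ?case
      using m smult_zero_left by (simp add: indicator_def[of "{}", abs_def])
  next
    case (subset P Q)
    have "indicator Q \<odot> n = indicator Q \<odot> (indicator P \<odot> n)" if "n \<in> carrier M" for n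
      using subset that cut_cut[of Q P n] by (simp add: Int_absorb2)
    then show ?case
      using subset m by metis
  next
    case (union P Q)
    then show ?case
      using m by (simp add: cut_disjoint_Un)
  qed
  then show ?thesis
    using UV by simp
qed

text \<open>Over disjoint sets \<open>V\<close> and \<open>W\<close> local solutions
  \<open>m\<close> and \<open>n\<close> are joined by cutting them to these sets and adding, without
  any condition of compatibility. Cutting the result to \<open>U\<close> makes the germs vanish
  elsewhere.\<close>

lemma germ_glue:
  assumes U: "unit_co U"
    and s: "\<And>x. x \<in> U \<Longrightarrow> \<exists>W m. unit_co W \<and> x \<in> W \<and> m \<in> carrier M \<and> (\<forall>y\<in>W. s y = germ y m)"
  shows "\<exists>m\<in>carrier M. (\<forall>y\<in>U. germ y m = s y) \<and> (\<forall>y\<in>units G - U. germ y m = germ y \<zero>)"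
proof -
  have "\<exists>m\<in>carrier M. \<forall>y\<in>U. germ y m = s y"
    using Hausdorff_unit_top U
  proof (induction rule: compact_open_induct)
    case (local x)
    then show ?case
      using s[of x] by metis
  next
    case (union V W)
    then obtain m n where mn: "m \<in> carrier M" "\<forall>y\<in>V. germ y m = s y" "n \<in> carrier M" "\<forall>y\<in>W. germ y n = s y"
      by blast
    have "germ y (indicator V \<odot> m \<oplus> indicator W \<odot> n) = s y" if "y \<in> V \<union> W" for y
    proof -
      have y: "y \<in> units G"
        using that union unit_co_units by blast
      then interpret F: abelian_group "fiber G M y"
        by (rule fiber_abelian_group)
      have eq: "germ y (indicator V \<odot> m \<oplus> indicator W \<odot> n)
          = germ y (indicator V \<odot> m) \<oplus>\<^bsub>fiber G M y\<^esub> germ y (indicator W \<odot> n)"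
        using y mn union by (simp add: fiber_add)
      show ?thesis
      proof (cases "y \<in> V")
        case True
        then have "germ y (indicator V \<odot> m) = s y" "germ y (indicator W \<odot> n) = germ y \<zero>"
          using union mn True germ_cut[of V y m] germ_cut_outside[of W y n, OF _ y] by auto
        then show ?thesis
          using eq F.r_zero[of "s y"] germ_in_fiber[OF y mn(1)] mn(2) True by (simp add: fiber_zero)
      next
        case False
        then have "germ y (indicator W \<odot> n) = s y" "germ y (indicator V \<odot> m) = germ y \<zero>"
          using that union mn False germ_cut[of W y n] germ_cut_outside[of V y m, OF _ y] by auto
        then show ?thesis
          using eq F.l_zero[of "s y"] germ_in_fiber[OF y mn(3)] mn(4) False that
          by (simp add: fiber_zero)
      qed
    qed
    then show ?case
      using mn union by (intro bexI[of _ "indicator V \<odot> m \<oplus> indicator W \<odot> n"]) auto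
  qed auto
  then obtain m where "m \<in> carrier M" "\<forall>y\<in>U. germ y m = s y"
    by blast
  then show ?thesis
    using U germ_cut germ_cut_outside by (intro bexI[of _ "indicator U \<odot> m"]) auto
qed

section \<open>The action of arrows on germs\<close>

lemma bisection_smult_germ_cong:
  assumes B: "bisection B" "bisection C" "g \<in> B" "g \<in> C" and m: "m \<in> carrier M" "m' \<in> carrier M"
    and eq: "germ (src G g) m = germ (src G g) m'"
  shows "germ (rng G g) (indicator B \<odot> m) = germ (rng G g) (indicator C \<odot> m')"
proof -
  have g: "g \<in> arrows G"
    using B bisection_arrows by blast
  then obtain W where W: "unit_co W" "src G g \<in> W" "indicator W \<odot> m = indicator W \<odot> m'"
    using eq germ_eq_iff m src_in_units by blast
  \<comment> \<open>\<open>D\<close> is a common smaller bisection through \<open>g\<close>, over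
    whose sources \<open>m\<close> and \<open>m'\<close> agree. Cut to the ranges of
    \<open>D\<close>, the actions of \<open>B\<close> on \<open>m\<close> and of \<open>C\<close> on
    \<open>m'\<close> both become the action of \<open>D\<close>.\<close>
  define D where "D = {b \<in> B \<inter> C. src G b \<in> W}"
  have D: "bisection D" "g \<in> D" "D \<subseteq> B" "D \<subseteq> C"
  proof -
    have "bisection (B \<inter> C)"
      using B bisection_Int by blast
    then show "bisection D"
      using S.slice_restrict[OF _ W(1), of "B \<inter> C"] bisection_mono[of "B \<inter> C" D] S.slice_compact_open
      by (auto simp: D_def bisection_iff)
  qed (use B W in \<open>auto simp: D_def\<close>)
  have U: "unit_co (rng G ` D)"
    using D(1) by (simp add: bisection_iff R.slice_image)
  have DB: "{b \<in> E. rng G b \<in> rng G ` D} = D" if "bisection E" "D \<subseteq> E" for E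
    using that R.slice_inj[of E] by (auto simp: bisection_iff)
  have DW: "{b \<in> D. src G b \<in> W} = D"
    by (auto simp: D_def)
  have "indicator (rng G ` D) \<odot> (indicator B \<odot> m) = indicator D \<odot> m"
    using cut_bisection[OF U B(1) m(1)] DB[OF B(1) D(3)] by simp
  also have "\<dots> = indicator D \<odot> (indicator W \<odot> m)"
    using bisection_cut[OF W(1) D(1) m(1)] DW by simp
  also have "\<dots> = indicator D \<odot> (indicator W \<odot> m')"
    using W(3) by simp
  also have "\<dots> = indicator D \<odot> m'"
    using bisection_cut[OF W(1) D(1) m(2)] DW by simp
  also have "\<dots> = indicator (rng G ` D) \<odot> (indicator C \<odot> m')"
    using cut_bisection[OF U B(2) m(2)] DB[OF B(2) D(4)] by simp
  finally show ?thesis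
    using U D(2) B m by (intro germ_eqI[of "rng G ` D"]) auto
qed

lemma act_germ:
  assumes B: "bisection B" "g \<in> B" and m: "m \<in> carrier M"
  shows "sheaf_act G M g (germ (src G g) m) = germ (rng G g) (indicator B \<odot> m)"
proof -
  have x: "src G g \<in> units G"
    using B bisection_arrows src_in_units by blast
  have "(\<Union>V\<in>{V. bisection V \<and> g \<in> V}. \<Union>(U, n)\<in>snd (germ (src G g) m).
      snd (germ (rng G g) (indicator V \<odot> n))) = snd (germ (rng G g) (indicator B \<odot> m))"
  proof (rule UN_const_eq)
    show "{V. bisection V \<and> g \<in> V} \<noteq> {}"
      using B by blast
    fix V assume V: "V \<in> {V. bisection V \<and> g \<in> V}"
    show "(\<Union>(U, n)\<in>snd (germ (src G g) m). snd (germ (rng G g) (indicator V \<odot> n)))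
        = snd (germ (rng G g) (indicator B \<odot> m))"
    proof (rule UN_const_eq)
      show "snd (germ (src G g) m) \<noteq> {}"
        using germ_rep_exists[OF x m] by auto
      fix a assume a: "a \<in> snd (germ (src G g) m)"
      obtain U n where an: "a = (U, n)"
        by (cases a)
      have "germ (rng G g) (indicator V \<odot> n) = germ (rng G g) (indicator B \<odot> m)"
        using V B m germ_rep[OF x m, of U n] a an by (intro bisection_smult_germ_cong) auto
      then show "(case a of (U, n) \<Rightarrow> snd (germ (rng G g) (indicator V \<odot> n)))
          = snd (germ (rng G g) (indicator B \<odot> m))"
        by (simp add: an)
    qed
  qed
  then show ?thesis
    by (simp add: sheaf_act_def prod_eq_iff)
qed

lemma bisection_exists: "g \<in> arrows G \<Longrightarrow> \<exists>B. bisection B \<and> g \<in> B"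
  using bisection_base[OF openin_topspace, of g] by auto

lemma act_mul_germ:
  assumes gh: "g \<in> arrows G" "h \<in> arrows G" "src G g = rng G h" and a: "a \<in> carrier (fiber G M (src G h))"
  shows "sheaf_act G M g (sheaf_act G M h a) = sheaf_act G M (mul G g h) a"
proof -
  obtain B where B: "bisection B" "g \<in> B"
    using bisection_exists gh by blast
  obtain C where C: "bisection C" "h \<in> C"
    using bisection_exists gh by blast
  obtain m where m: "m \<in> carrier M" "a = germ (src G h) m"
    using a fiber_cases by metis
  have "mul G g h \<in> A.act_set B C"
    using B C gh by (auto simp: A.act_set_def)
  moreover have "sheaf_act G M g (sheaf_act G M h a) = germ (rng G g) (indicator B \<odot> (indicator C \<odot> m))"
    using B C gh m act_germ[OF B] act_germ[OF C] by simp
  ultimately show ?thesis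
    using act_germ[OF bisection_act_set[OF B(1) C(1)], of "mul G g h" m] B C gh m
    by (simp add: indicator_smult_smult rng_mul src_mul)
qed

lemma act_unit_germ:
  assumes x: "x \<in> units G" and a: "a \<in> carrier (fiber G M x)"
  shows "sheaf_act G M x a = a"
proof -
  obtain U m where U: "unit_co U" "x \<in> U" "m \<in> carrier M" "a = germ x m"
    using a fiber_cases by metis
  then show ?thesis
    using act_germ[of U x m] germ_cut x by (simp add: unit_bisection src_unit rng_unit)
qed

lemma germ_bisection:
  "bisection B \<Longrightarrow> b \<in> B \<Longrightarrow> m \<in> carrier M \<Longrightarrow>
    germ (rng G b) (indicator B \<odot> m) = sheaf_act G M b (germ (src G b) m)"
  by (simp add: act_germ)

lemma germ_bisection_outside:
  assumes B: "bisection B" and x: "x \<in> units G" "x \<notin> rng G ` B" and m: "m \<in> carrier M"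
  shows "germ x (indicator B \<odot> m) = germ x \<zero>"
proof -
  have U: "unit_co (rng G ` B)"
    using B by (simp add: bisection_iff R.slice_image)
  have "{b \<in> B. rng G b \<in> rng G ` B} = B"
    by auto
  then have "indicator (rng G ` B) \<odot> (indicator B \<odot> m) = indicator B \<odot> m"
    using cut_bisection[OF U B m] by simp
  then show ?thesis
    using germ_cut_outside[OF U x, of "indicator B \<odot> m"] B m by auto
qed

text \<open>Continuity of a map to the sheaf that lies over \<open>p\<close>, expressed without the
  sheaf topology: nearby values are germs of one module element. \<open>continuous_sheaf_iff\<close>
  is the translation, and later arguments work with this form.\<close>

definition locally_germ :: "'y topology \<Rightarrow> ('y \<Rightarrow> 'g) \<Rightarrow> ('y \<Rightarrow> ('g, 'm) germ) \<Rightarrow> bool" where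
  "locally_germ Y p f \<longleftrightarrow> (\<forall>y\<in>topspace Y. \<exists>S m. openin Y S \<and> y \<in> S \<and> m \<in> carrier M \<and>
     (\<forall>z\<in>S. f z = germ (p z) m))"

lemma germ_eq_nbhd:
  assumes "x \<in> units G" "m \<in> carrier M" "m' \<in> carrier M" "germ x m = germ x m'"
  shows "\<exists>W. unit_co W \<and> x \<in> W \<and> (\<forall>y\<in>W. germ y m = germ y m')"
  using assms germ_eq_iff germ_eqI by metis

text \<open>A germ carries its base point, so on the preimage of the basic set of \<open>m\<close>
  the fibre condition forces \<open>f z\<close> to be the germ of \<open>m\<close> at
  \<open>p z\<close>. Conversely, elements with equal germs at a point have equal germs nearby,
  which makes preimages of basic sets open.\<close>

lemma continuous_sheaf_iff:
  assumes p: "continuous_map Y (unit_top G) p"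
  shows "continuous_map Y (sheaf_top G M) f \<and> (\<forall>y\<in>topspace Y. f y \<in> carrier (fiber G M (p y)))
    \<longleftrightarrow> locally_germ Y p f"
proof
  assume f: "continuous_map Y (sheaf_top G M) f \<and> (\<forall>y\<in>topspace Y. f y \<in> carrier (fiber G M (p y)))"
  show "locally_germ Y p f"
    unfolding locally_germ_def
  proof
    fix y assume y: "y \<in> topspace Y"
    then obtain U m where Um: "unit_co U" "p y \<in> U" "m \<in> cut M U" "m \<in> carrier M" "f y = germ (p y) m"
      using f fiber_cases by metis
    let ?S = "{z \<in> topspace Y. f z \<in> (\<lambda>x. germ x m) ` U}"
    have "f y \<in> (\<lambda>x. germ x m) ` U"
      using Um(2,5) by (simp add: image_iff) metis
    then have yS: "y \<in> ?S"
      using y by simp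
    have "openin (sheaf_top G M) ((\<lambda>x. germ x m) ` U)"
      unfolding sheaf_top_def using Um by (intro topology_generated_by_Basis) (auto simp: compact_open_def)
    then have "openin Y ?S"
      using f openin_continuous_map_preimage by blast
    moreover have "\<forall>z\<in>?S. f z = germ (p z) m"
    proof
      fix z assume "z \<in> ?S"
      then have z: "z \<in> topspace Y" "f z \<in> (\<lambda>x. germ x m) ` U"
        by blast+
      have "f z \<in> carrier (fiber G M (p z))"
        using f z by blast
      then have "fst (f z) = p z"
        by (auto simp: fiber_def)
      then show "f z = germ (p z) m"
        using z by auto
    qed
    ultimately show "\<exists>S m. openin Y S \<and> y \<in> S \<and> m \<in> carrier M \<and> (\<forall>z\<in>S. f z = germ (p z) m)"
      using yS Um(4) by blast
  qed
next
  assume f: "locally_germ Y p f"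
  have pu: "p y \<in> units G" if "y \<in> topspace Y" for y
    using p that by (auto simp: continuous_map_def)
  have rep: "\<exists>m\<in>carrier M. f y = germ (p y) m" if "y \<in> topspace Y" for y
    using f that unfolding locally_germ_def by blast
  have "continuous_map Y (sheaf_top G M) f"
    unfolding sheaf_top_def
  proof (rule continuous_on_generated_topo)
    fix N assume "N \<in> {(\<lambda>x. germ x m) ` U | U m. openin (unit_top G) U \<and> compactin (unit_top G) U \<and> m \<in> cut M U}"
    then obtain U m where Um: "N = (\<lambda>x. germ x m) ` U" "unit_co U" "m \<in> cut M U"
      by (auto simp: compact_open_def)
    then have m: "m \<in> carrier M"
      by (simp add: cut_iff)
    show "openin Y (f -` N \<inter> topspace Y)"
    proof (rule iffD2[OF openin_subopen], rule ballI)
      fix y assume "y \<in> f -` N \<inter> topspace Y"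
      then have y: "f y \<in> N" "y \<in> topspace Y"
        by auto
      obtain S m' where S: "openin Y S" "y \<in> S" "m' \<in> carrier M" "\<forall>z\<in>S. f z = germ (p z) m'"
        using f y unfolding locally_germ_def by blast
      then have fy: "f y = germ (p y) m'"
        by blast
      obtain x where x: "x \<in> U" "f y = germ x m"
        using y(1) Um(1) by blast
      then have "x = p y"
        using fy fst_germ by metis
      then have py: "p y \<in> U" "germ (p y) m' = germ (p y) m"
        using x fy by auto
      then obtain W where W: "unit_co W" "p y \<in> W" "\<forall>x\<in>W. germ x m' = germ x m"
        using germ_eq_nbhd[OF pu[OF y(2)] S(3) m py(2)] by blast
      have "openin (unit_top G) (W \<inter> U)"
        using W Um by (auto simp: compact_open_def)
      then have "openin Y (S \<inter> {z \<in> topspace Y. p z \<in> W \<inter> U})"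
        using S(1) p openin_continuous_map_preimage by blast
      moreover have "S \<inter> {z \<in> topspace Y. p z \<in> W \<inter> U} \<subseteq> f -` N \<inter> topspace Y"
        using S W Um by auto
      ultimately show "\<exists>T. openin Y T \<and> y \<in> T \<and> T \<subseteq> f -` N \<inter> topspace Y"
        using S(2) y(2) W(2) py(1) by blast
    qed
  next
    show "f ` topspace Y \<subseteq>
      \<Union>{(\<lambda>x. germ x m) ` U | U m. openin (unit_top G) U \<and> compactin (unit_top G) U \<and> m \<in> cut M U}"
    proof (rule image_subsetI)
      fix y assume y: "y \<in> topspace Y"
      obtain m where m: "m \<in> carrier M" "f y = germ (p y) m"
        using rep y by blast
      obtain U where U: "unit_co U" "p y \<in> U"
        using unit_nhds_nonempty pu y by blast
      \<comment> \<open>Basic sets are formed with elements of \<open>cut M U\<close>, so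
        \<open>m\<close> is replaced by its restriction, which has the same germs over
        \<open>U\<close>.\<close>
      have "f y \<in> (\<lambda>x. germ x (indicator U \<odot> m)) ` U"
        using m U germ_cut by auto
      moreover have "indicator U \<odot> m \<in> cut M U"
        using m by (auto simp: cut_def)
      ultimately show "f y \<in> \<Union>{(\<lambda>x. germ x m) ` U | U m. openin (unit_top G) U \<and> compactin (unit_top G) U \<and> m \<in> cut M U}"
        using U unfolding compact_open_def by blast
    qed
  qed
  then show "continuous_map Y (sheaf_top G M) f \<and> (\<forall>y\<in>topspace Y. f y \<in> carrier (fiber G M (p y)))"
    using rep pu germ_in_fiber by metis
qed

end

section \<open>Module homomorphisms and equivariant maps to the sheaf\<close>

locale groupoid_space_module = ample_module G M + groupoid_space G Y p act
  for G :: "'g groupoid" and M :: "('g \<Rightarrow> int, 'm) module" (structure)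
    and Y :: "'y topology" and p and act
begin

text \<open>Values outside \<open>Cc Y\<close> are left free, so that the notion applies both to the
  extensional maps in \<open>hom_cochains\<close> and to an unrestricted
  \<open>hom_of\<close>.\<close>

definition is_hom :: "(('y \<Rightarrow> int) \<Rightarrow> 'm) \<Rightarrow> bool" where
  "is_hom \<phi> \<longleftrightarrow> (\<forall>f\<in>Cc Y. \<phi> f \<in> carrier M) \<and>
    (\<forall>f\<in>Cc Y. \<forall>h\<in>Cc Y. \<phi> (\<lambda>y. f y + h y) = \<phi> f \<oplus> \<phi> h) \<and>
    (\<forall>f\<in>Cc (gtop G). \<forall>m\<in>Cc Y. \<phi> (smul f m) = f \<odot> \<phi> m)"

definition equivariant :: "('y \<Rightarrow> ('g, 'm) germ) \<Rightarrow> bool" where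
  "equivariant E \<longleftrightarrow> (\<forall>g\<in>arrows G. \<forall>y\<in>topspace Y. src G g = p y \<longrightarrow>
    E (act g y) = sheaf_act G M g (E y))"

definition stalk_map :: "(('y \<Rightarrow> int) \<Rightarrow> 'm) \<Rightarrow> 'y \<Rightarrow> ('g, 'm) germ" where
  "stalk_map \<phi> y = germ (p y) (\<phi> (indicator (SOME V. slice V \<and> y \<in> V)))"

lemma hom_closed: "is_hom \<phi> \<Longrightarrow> f \<in> Cc Y \<Longrightarrow> \<phi> f \<in> carrier M"
  and hom_add: "is_hom \<phi> \<Longrightarrow> f \<in> Cc Y \<Longrightarrow> h \<in> Cc Y \<Longrightarrow> \<phi> (\<lambda>y. f y + h y) = \<phi> f \<oplus> \<phi> h"
  and hom_smul: "is_hom \<phi> \<Longrightarrow> k \<in> Cc (gtop G) \<Longrightarrow> f \<in> Cc Y \<Longrightarrow> \<phi> (smul k f) = k \<odot> \<phi> f"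
  by (auto simp: is_hom_def)

lemma hom_zero: assumes "is_hom \<phi>" shows "\<phi> (\<lambda>_. 0) = \<zero>"
proof -
  have "\<phi> (\<lambda>_. 0) \<oplus> \<phi> (\<lambda>_. 0) = \<phi> (\<lambda>_. 0)"
    using hom_add[OF assms, of "\<lambda>_. 0" "\<lambda>_. 0"] by simp
  then show ?thesis
    using hom_closed[OF assms, of "\<lambda>_. 0"] by (metis Cc_zero add.l_cancel_one')
qed

lemma hom_uminus: assumes "is_hom \<phi>" "f \<in> Cc Y" shows "\<phi> (\<lambda>y. - f y) = \<ominus> \<phi> f"
proof -
  have "\<phi> (\<lambda>y. - f y) \<oplus> \<phi> f = \<zero>"
    using hom_add[OF assms(1), of "\<lambda>y. - f y" f] assms hom_zero by (simp add: Cc_uminus)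
  then show ?thesis
    using assms by (intro minus_equality[symmetric]) (simp_all add: hom_closed Cc_uminus)
qed

lemma act_set_units:
  assumes "U \<subseteq> units G" "V \<subseteq> topspace Y" shows "act_set U V = {v \<in> V. p v \<in> U}"
proof -
  have "src G u = u" if "u \<in> U" for u
    using assms that src_unit by blast
  moreover have "act (p v) v = v" if "v \<in> V" for v
    using assms that act_unit by blast
  ultimately show ?thesis
    unfolding act_set_def by (auto, metis)
qed

lemma hom_bisection:
  "is_hom \<phi> \<Longrightarrow> bisection B \<Longrightarrow> slice V \<Longrightarrow>
    \<phi> (indicator (act_set B V)) = indicator B \<odot> \<phi> (indicator V)"
  using hom_smul[of \<phi> "indicator B" "indicator V"]
  by (simp add: smul_indicators bisection_iff R.indicator_slice_in_Cc indicator_slice_in_Cc)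

lemma hom_cut:
  assumes "is_hom \<phi>" "unit_co U" "slice V"
  shows "indicator U \<odot> \<phi> (indicator V) = \<phi> (indicator {v \<in> V. p v \<in> U})"
  using hom_bisection[OF assms(1) unit_bisection[OF assms(2)] assms(3)]
    act_set_units[OF unit_co_units[OF assms(2)] slice_subset[OF assms(3)]] by simp

text \<open>For the chosen slice \<open>W\<close> and the given \<open>V\<close>, the points lying
  over the image of \<open>V \<inter> W\<close> are just \<open>V \<inter> W\<close>, by injectivity
  of \<open>p\<close>. Since \<open>\<phi>\<close> commutes with cutting, both indicators have the
  same image over this neighbourhood of \<open>p y\<close>.\<close>

lemma stalk_map_eq:
  assumes \<phi>: "is_hom \<phi>" and V: "slice V" "y \<in> V"
  shows "stalk_map \<phi> y = germ (p y) (\<phi> (indicator V))"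
proof -
  define W where "W = (SOME V. slice V \<and> y \<in> V)"
  have W: "slice W" "y \<in> W"
    using someI[of "\<lambda>V. slice V \<and> y \<in> V" V] V by (auto simp: W_def)
  let ?U = "p ` (V \<inter> W)"
  have U: "unit_co ?U"
    using V W by (simp add: slice_image slice_Int)
  have "{v \<in> V. p v \<in> ?U} = V \<inter> W" "{v \<in> W. p v \<in> ?U} = V \<inter> W"
    using slice_inj[OF V(1)] slice_inj[OF W(1)] by auto
  then have "indicator ?U \<odot> \<phi> (indicator W) = indicator ?U \<odot> \<phi> (indicator V)"
    using hom_cut[OF \<phi> U V(1)] hom_cut[OF \<phi> U W(1)] by simp
  then have "germ (p y) (\<phi> (indicator W)) = germ (p y) (\<phi> (indicator V))"
    using V W U by (intro germ_eqI[of ?U]) (auto intro!: hom_closed[OF \<phi>] indicator_slice_in_Cc)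
  then show ?thesis
    by (simp add: stalk_map_def W_def)
qed

text \<open>The indicator of \<open>V\<close> is fixed by cutting to the image of \<open>V\<close>
  in the base; hence so is its value under \<open>\<phi>\<close>, whose germs must vanish
  elsewhere.\<close>

lemma hom_outside:
  assumes \<phi>: "is_hom \<phi>" and V: "slice V" and x: "x \<in> units G" "x \<notin> p ` V"
  shows "germ x (\<phi> (indicator V)) = germ x \<zero>"
proof -
  have "{v \<in> V. p v \<in> p ` V} = V"
    by auto
  then have "indicator (p ` V) \<odot> \<phi> (indicator V) = \<phi> (indicator V)"
    using hom_cut[OF \<phi> slice_image[OF V] V] by simp
  then show ?thesis
    using germ_cut_outside[OF slice_image[OF V] x, of "\<phi> (indicator V)"]
      hom_closed[OF \<phi> indicator_slice_in_Cc[OF V]] by simp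
qed

lemma slice_exists: "y \<in> topspace Y \<Longrightarrow> \<exists>V. slice V \<and> y \<in> V"
  using slice_base[OF openin_topspace] by blast

lemma p_units: "y \<in> topspace Y \<Longrightarrow> p y \<in> units G"
  using p_in by simp

lemma stalk_map_locally_germ:
  assumes \<phi>: "is_hom \<phi>" shows "locally_germ Y p (stalk_map \<phi>)"
  unfolding locally_germ_def
proof
  fix y assume "y \<in> topspace Y"
  then obtain V where V: "slice V" "y \<in> V"
    using slice_exists by blast
  then show "\<exists>S m. openin Y S \<and> y \<in> S \<and> m \<in> carrier M \<and> (\<forall>z\<in>S. stalk_map \<phi> z = germ (p z) m)"
    using stalk_map_eq[OF \<phi>] slice_openin hom_closed[OF \<phi> indicator_slice_in_Cc[OF V(1)]]
    by (intro exI[of _ V] exI[of _ "\<phi> (indicator V)"]) auto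
qed

text \<open>The set of products of a bisection through \<open>g\<close> and a slice through
  \<open>y\<close> is a slice through \<open>act g y\<close>, and it may be used to compute the
  stalk map there.\<close>

lemma stalk_map_equivariant:
  assumes \<phi>: "is_hom \<phi>" shows "equivariant (stalk_map \<phi>)"
  unfolding equivariant_def
proof (intro ballI impI)
  fix g y assume g: "g \<in> arrows G" and y: "y \<in> topspace Y" and gy: "src G g = p y"
  obtain V where V: "slice V" "y \<in> V"
    using slice_exists y by blast
  obtain B where B: "bisection B" "g \<in> B"
    using bisection_exists g by blast
  have S: "slice (act_set B V)"
    using B V by (simp add: slice_act_set bisection_iff)
  have "act g y \<in> act_set B V"
    using B V gy by (auto simp: act_set_def)
  then have "stalk_map \<phi> (act g y) = germ (rng G g) (indicator B \<odot> \<phi> (indicator V))"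
    using stalk_map_eq[OF \<phi> S] hom_bisection[OF \<phi> B(1) V(1)] p_act[OF g y gy] by simp
  then show "stalk_map \<phi> (act g y) = sheaf_act G M g (stalk_map \<phi> y)"
    using act_germ[OF B, of "\<phi> (indicator V)"] hom_closed[OF \<phi> indicator_slice_in_Cc[OF V(1)]]
      stalk_map_eq[OF \<phi> V] gy by simp
qed

lemma hom_ext_slices:
  assumes "is_hom \<phi>" "is_hom \<psi>" and eq: "\<And>V. slice V \<Longrightarrow> \<phi> (indicator V) = \<psi> (indicator V)"
    and "f \<in> Cc Y"
  shows "\<phi> f = \<psi> f"
  using assms(4)
proof (induction rule: Cc_slice_induct)
  case (indicator V)
  then show ?case by (rule eq)
qed (simp_all add: hom_add[OF assms(1)] hom_add[OF assms(2)] hom_uminus[OF assms(1)] hom_uminus[OF assms(2)])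

text \<open>The stalk map describes the germs of \<open>\<phi> (indicator V)\<close> over the image
  of \<open>V\<close>. Elsewhere both germs are zero, on one side by \<open>hom_outside\<close> and
  on the other by \<open>out\<close>.\<close>

lemma hom_slice_ext:
  assumes \<phi>: "is_hom \<phi>" and V: "slice V" and m: "m \<in> carrier M"
    and eq: "\<And>y. y \<in> V \<Longrightarrow> stalk_map \<phi> y = germ (p y) m"
    and out: "\<And>x. x \<in> units G \<Longrightarrow> x \<notin> p ` V \<Longrightarrow> germ x m = germ x \<zero>"
  shows "\<phi> (indicator V) = m"
proof (rule germ_ext)
  show "\<phi> (indicator V) \<in> carrier M" "m \<in> carrier M"
    using hom_closed[OF \<phi> indicator_slice_in_Cc[OF V]] m by auto
  fix x assume x: "x \<in> units G"
  show "germ x (\<phi> (indicator V)) = germ x m"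
  proof (cases "x \<in> p ` V")
    case True
    then show ?thesis
      using eq stalk_map_eq[OF \<phi> V] by auto
  next
    case False
    then show ?thesis
      using out hom_outside[OF \<phi> V] x by simp
  qed
qed

lemma hom_ext:
  assumes \<phi>: "is_hom \<phi>" and \<psi>: "is_hom \<psi>"
    and eq: "\<And>y. y \<in> topspace Y \<Longrightarrow> stalk_map \<phi> y = stalk_map \<psi> y" and f: "f \<in> Cc Y"
  shows "\<phi> f = \<psi> f"
proof (rule hom_ext_slices[OF \<phi> \<psi> _ f])
  fix V assume V: "slice V"
  then show "\<phi> (indicator V) = \<psi> (indicator V)"
    using eq slice_subset[OF V] stalk_map_eq[OF \<psi> V] hom_outside[OF \<psi> V]
    by (intro hom_slice_ext[OF \<phi> V]) (auto intro!: hom_closed[OF \<psi>] indicator_slice_in_Cc)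
qed

section \<open>Homomorphisms from equivariant maps\<close>

definition fibre_sum :: "('y \<Rightarrow> ('g, 'm) germ) \<Rightarrow> ('y \<Rightarrow> int) \<Rightarrow> 'g \<Rightarrow> ('g, 'm) germ" where
  "fibre_sum E f x = (\<Oplus>\<^bsub>fiber G M x\<^esub>y\<in>{y. p y = x \<and> f y \<noteq> 0}. [f y] \<cdot>\<^bsub>fiber G M x\<^esub> E y)"

text \<open>The description is legitimate because \<open>fibre_sum_realised\<close> gives existence
  and \<open>germ_ext\<close> uniqueness.\<close>

definition hom_of :: "('y \<Rightarrow> ('g, 'm) germ) \<Rightarrow> ('y \<Rightarrow> int) \<Rightarrow> 'm" where
  "hom_of E f = (THE m. m \<in> carrier M \<and> (\<forall>x\<in>units G. germ x m = fibre_sum E f x))"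

context
  fixes E assumes E: "locally_germ Y p E"
begin

lemma E_fiber: assumes "y \<in> topspace Y" shows "E y \<in> carrier (fiber G M (p y))"
  using E assms p_units germ_in_fiber unfolding locally_germ_def by metis

text \<open>The index set of a fibre sum depends on the function. Padding it with zero terms lets
  sums for \<open>f\<close>, \<open>h\<close> and their sum run over one common finite set.\<close>

lemma fibre_sum_superset:
  assumes f: "f \<in> Cc Y" and x: "x \<in> units G"
    and T: "finite T" "{y. p y = x \<and> f y \<noteq> 0} \<subseteq> T" "\<And>y. y \<in> T \<Longrightarrow> y \<in> topspace Y \<and> p y = x"
  shows "fibre_sum E f x = (\<Oplus>\<^bsub>fiber G M x\<^esub>y\<in>T. [f y] \<cdot>\<^bsub>fiber G M x\<^esub> E y)"
proof -
  interpret F: abelian_group "fiber G M x"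
    by (rule fiber_abelian_group[OF x])
  have "E y \<in> carrier (fiber G M x)" if "y \<in> T" for y
    using E_fiber T(3) that by blast
  moreover have "[(0 :: int)] \<cdot>\<^bsub>fiber G M x\<^esub> E y = \<zero>\<^bsub>fiber G M x\<^esub>" for y
    by (simp add: add_pow_def int_pow_0)
  ultimately show ?thesis
    unfolding fibre_sum_def using T
    by (intro F.add.finprod_mono_neutral_cong_left) auto
qed

lemma fibre_sum_closed:
  assumes "f \<in> Cc Y" "x \<in> units G" shows "fibre_sum E f x \<in> carrier (fiber G M x)"
proof -
  interpret F: abelian_group "fiber G M x"
    by (rule fiber_abelian_group[OF assms(2)])
  have "E y \<in> carrier (fiber G M x)" if "p y = x" "f y \<noteq> 0" for y
    using E_fiber[of y] Cc_outside[OF assms(1)] that by blast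
  then show ?thesis
    unfolding fibre_sum_def by (intro F.finsum_closed) auto
qed

lemma fibre_sum_add:
  assumes f: "f \<in> Cc Y" "h \<in> Cc Y" and x: "x \<in> units G"
  shows "fibre_sum E (\<lambda>y. f y + h y) x = fibre_sum E f x \<oplus>\<^bsub>fiber G M x\<^esub> fibre_sum E h x"
proof -
  interpret F: abelian_group "fiber G M x"
    by (rule fiber_abelian_group[OF x])
  define T where "T = {y. p y = x \<and> f y \<noteq> 0} \<union> {y. p y = x \<and> h y \<noteq> 0}"
  have fin: "finite T"
    using finite_fibre f by (simp add: T_def)
  have T: "y \<in> topspace Y \<and> p y = x" if "y \<in> T" for y
    using that Cc_outside[OF f(1)] Cc_outside[OF f(2)] by (auto simp: T_def)
  have car: "E y \<in> carrier (fiber G M x)" if "y \<in> T" for y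
    using E_fiber T that by blast
  have "fibre_sum E (\<lambda>y. f y + h y) x = (\<Oplus>\<^bsub>fiber G M x\<^esub>y\<in>T. [(f y + h y)] \<cdot>\<^bsub>fiber G M x\<^esub> E y)"
    by (rule fibre_sum_superset[OF Cc_add[OF f] x fin _ T]) (auto simp: T_def)
  also have "\<dots> = (\<Oplus>\<^bsub>fiber G M x\<^esub>y\<in>T. [f y] \<cdot>\<^bsub>fiber G M x\<^esub> E y \<oplus>\<^bsub>fiber G M x\<^esub> [h y] \<cdot>\<^bsub>fiber G M x\<^esub> E y)"
    using car by (intro F.finsum_cong') (auto simp: F.add.int_pow_mult)
  also have "\<dots> = (\<Oplus>\<^bsub>fiber G M x\<^esub>y\<in>T. [f y] \<cdot>\<^bsub>fiber G M x\<^esub> E y)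
      \<oplus>\<^bsub>fiber G M x\<^esub> (\<Oplus>\<^bsub>fiber G M x\<^esub>y\<in>T. [h y] \<cdot>\<^bsub>fiber G M x\<^esub> E y)"
    using car by (intro F.finsum_addf) auto
  also have "(\<Oplus>\<^bsub>fiber G M x\<^esub>y\<in>T. [f y] \<cdot>\<^bsub>fiber G M x\<^esub> E y) = fibre_sum E f x"
    by (rule fibre_sum_superset[OF f(1) x fin _ T, symmetric]) (auto simp: T_def)
  also have "(\<Oplus>\<^bsub>fiber G M x\<^esub>y\<in>T. [h y] \<cdot>\<^bsub>fiber G M x\<^esub> E y) = fibre_sum E h x"
    by (rule fibre_sum_superset[OF f(2) x fin _ T, symmetric]) (auto simp: T_def)
  finally show ?thesis .
qed

lemma fibre_sum_uminus:
  assumes f: "f \<in> Cc Y" and x: "x \<in> units G"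
  shows "fibre_sum E (\<lambda>y. - f y) x = \<ominus>\<^bsub>fiber G M x\<^esub> fibre_sum E f x"
proof -
  interpret F: abelian_group "fiber G M x"
    by (rule fiber_abelian_group[OF x])
  have "fibre_sum E (\<lambda>y. - f y) x \<oplus>\<^bsub>fiber G M x\<^esub> fibre_sum E f x = fibre_sum E (\<lambda>_. 0) x"
    using fibre_sum_add[OF Cc_uminus[OF f] f x] by simp
  also have "\<dots> = \<zero>\<^bsub>fiber G M x\<^esub>"
    by (simp add: fibre_sum_def)
  finally show ?thesis
    using assms by (intro F.minus_equality[symmetric]) (simp_all add: fibre_sum_closed Cc_uminus)
qed

lemma fibre_sum_indicator:
  assumes V: "slice V"
  shows "y \<in> V \<Longrightarrow> fibre_sum E (indicator V) (p y) = E y"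
    and "x \<in> units G \<Longrightarrow> x \<notin> p ` V \<Longrightarrow> fibre_sum E (indicator V) x = \<zero>\<^bsub>fiber G M x\<^esub>"
proof -
  assume y: "y \<in> V"
  then have yY: "y \<in> topspace Y"
    using slice_subset[OF V] by blast
  interpret F: abelian_group "fiber G M (p y)"
    by (rule fiber_abelian_group[OF p_units[OF yY]])
  have "{z. p z = p y \<and> indicator V z \<noteq> (0 :: int)} = {y}"
    using y slice_inj[OF V _ y] by (auto simp: indicator_def)
  then show "fibre_sum E (indicator V) (p y) = E y"
    using E_fiber[OF yY] y by (simp add: fibre_sum_def)
next
  assume x: "x \<in> units G" "x \<notin> p ` V"
  interpret F: abelian_group "fiber G M x"
    by (rule fiber_abelian_group[OF x(1)])
  have e: "{z. p z = x \<and> indicator V z \<noteq> (0 :: int)} = {}"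
    using x by (auto simp: indicator_def)
  show "fibre_sum E (indicator V) x = \<zero>\<^bsub>fiber G M x\<^esub>"
    unfolding fibre_sum_def e by simp
qed

text \<open>Only indicators of slices require gluing: over \<open>p y\<close> with \<open>y\<close>
  in the slice \<open>V\<close> the sum is the single value \<open>E y\<close>, which is locally the
  germ of one element. Sums and negatives of realised functions are realised by sums and
  negatives.\<close>

lemma fibre_sum_realised:
  "f \<in> Cc Y \<Longrightarrow> \<exists>m\<in>carrier M. \<forall>x\<in>units G. germ x m = fibre_sum E f x"
proof (induction rule: Cc_slice_induct)
  case (indicator V)
  have "\<exists>m\<in>carrier M. (\<forall>x\<in>p ` V. germ x m = fibre_sum E (indicator V) x) \<and>
      (\<forall>x\<in>units G - p ` V. germ x m = germ x \<zero>)"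
  proof (rule germ_glue[OF slice_image[OF indicator]])
    fix x assume "x \<in> p ` V"
    then obtain y where y: "y \<in> V" "x = p y"
      by blast
    then have "y \<in> topspace Y"
      using slice_subset[OF indicator] by blast
    then obtain S m where S: "openin Y S" "y \<in> S" "m \<in> carrier M" "\<forall>z\<in>S. E z = germ (p z) m"
      using E unfolding locally_germ_def by blast
    obtain W where W: "slice W" "y \<in> W" "W \<subseteq> S \<inter> V"
      using slice_base[of "S \<inter> V" y] S y slice_openin[OF indicator] by blast
    have "fibre_sum E (indicator V) (p z) = germ (p z) m" if "z \<in> W" for z
    proof -
      have "z \<in> V" "z \<in> S"
        using that W(3) by auto
      then show ?thesis
        using fibre_sum_indicator(1)[OF indicator] S(4) by simp
    qed
    then have "\<forall>x\<in>p ` W. fibre_sum E (indicator V) x = germ x m"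
      by blast
    then show "\<exists>W m. unit_co W \<and> x \<in> W \<and> m \<in> carrier M \<and> (\<forall>y\<in>W. fibre_sum E (indicator V) y = germ y m)"
      using slice_image[OF W(1)] W(2) y S(3) by blast
  qed
  then show ?case
    using fibre_sum_indicator(2)[OF indicator] by (metis Diff_iff fiber_zero)
next
  case (add f h)
  then obtain m n where "m \<in> carrier M" "\<forall>x\<in>units G. germ x m = fibre_sum E f x"
    "n \<in> carrier M" "\<forall>x\<in>units G. germ x n = fibre_sum E h x" by blast
  then show ?case
    using add by (intro bexI[of _ "m \<oplus> n"]) (auto simp: fibre_sum_add fiber_add[symmetric])
next
  case (uminus f)
  then obtain m where "m \<in> carrier M" "\<forall>x\<in>units G. germ x m = fibre_sum E f x"
    by blast
  then show ?case
    using uminus by (intro bexI[of _ "\<ominus> m"]) (auto simp: fibre_sum_uminus fiber_minus[symmetric])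
qed

lemma hom_of:
  assumes "f \<in> Cc Y"
  shows "hom_of E f \<in> carrier M" "x \<in> units G \<Longrightarrow> germ x (hom_of E f) = fibre_sum E f x"
proof -
  have "\<exists>!m. m \<in> carrier M \<and> (\<forall>x\<in>units G. germ x m = fibre_sum E f x)"
    using fibre_sum_realised[OF assms] germ_ext by (metis (no_types, lifting))
  from theI'[OF this] show "hom_of E f \<in> carrier M" "x \<in> units G \<Longrightarrow> germ x (hom_of E f) = fibre_sum E f x"
    by (auto simp: hom_of_def)
qed

lemma hom_of_add:
  assumes "f \<in> Cc Y" "h \<in> Cc Y"
  shows "hom_of E (\<lambda>y. f y + h y) = hom_of E f \<oplus> hom_of E h"
  using assms by (intro germ_ext) (simp_all add: hom_of Cc_add fibre_sum_add fiber_add[symmetric])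

lemma hom_of_uminus:
  assumes "f \<in> Cc Y"
  shows "hom_of E (\<lambda>y. - f y) = \<ominus> hom_of E f"
  using assms by (intro germ_ext) (simp_all add: hom_of Cc_uminus fibre_sum_uminus fiber_minus[symmetric])

lemma germ_hom_of_slice:
  assumes V: "slice V"
  shows "y \<in> V \<Longrightarrow> germ (p y) (hom_of E (indicator V)) = E y"
    and "x \<in> units G \<Longrightarrow> x \<notin> p ` V \<Longrightarrow> germ x (hom_of E (indicator V)) = germ x \<zero>"
  using hom_of(2)[OF indicator_slice_in_Cc[OF V]] fibre_sum_indicator[OF V] slice_subset[OF V] p_units
  by (auto simp: fiber_zero)

text \<open>The germs are compared at each \<open>x\<close>. If \<open>x\<close> is the range of
  \<open>b\<close> in \<open>B\<close> and \<open>v\<close> in \<open>V\<close> lies over the source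
  of \<open>b\<close>, then \<open>act b v\<close> is the point of the product set over
  \<open>x\<close> and equivariance gives the claim. If there is no such \<open>b\<close>, or no
  such \<open>v\<close>, both germs are zero.\<close>

lemma hom_of_bisection:
  assumes eq: "equivariant E" and B: "bisection B" and V: "slice V"
  shows "hom_of E (smul (indicator B) (indicator V)) = indicator B \<odot> hom_of E (indicator V)"
proof (rule germ_ext)
  have R: "R.slice B"
    using B bisection_iff by blast
  have S: "slice (act_set B V)"
    by (rule slice_act_set[OF R V])
  have sm: "smul (indicator B) (indicator V) = indicator (act_set B V)"
    by (rule smul_indicators[OF R V])
  have car: "hom_of E (indicator V) \<in> carrier M"
    using hom_of(1) indicator_slice_in_Cc V by blast
  show "hom_of E (smul (indicator B) (indicator V)) \<in> carrier M"
    using hom_of(1) indicator_slice_in_Cc S sm by simp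
  show "indicator B \<odot> hom_of E (indicator V) \<in> carrier M"
    using B car by simp
  fix x assume x: "x \<in> units G"
  have pact: "p (act b v) = rng G b" if "b \<in> B" "v \<in> V" "src G b = p v" for b v
    using that p_act bisection_arrows[OF B] slice_subset[OF V] by blast
  show "germ x (hom_of E (smul (indicator B) (indicator V))) = germ x (indicator B \<odot> hom_of E (indicator V))"
  proof (cases "x \<in> rng G ` B")
    case False
    then have "x \<notin> p ` act_set B V"
      using pact by (auto simp: act_set_def)
    then show ?thesis
      using germ_hom_of_slice(2)[OF S x] germ_bisection_outside[OF B x False car] sm by simp
  next
    case True
    then obtain b where b: "b \<in> B" "x = rng G b"
      by blast
    then have bG: "b \<in> arrows G"
      using bisection_arrows[OF B] by blast
    have r: "germ x (indicator B \<odot> hom_of E (indicator V))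
        = sheaf_act G M b (germ (src G b) (hom_of E (indicator V)))"
      using germ_bisection[OF B b(1) car] b by simp
    show ?thesis
    proof (cases "src G b \<in> p ` V")
      case True
      then obtain v where v: "v \<in> V" "src G b = p v"
        by blast
      then have "act b v \<in> act_set B V"
        using b by (auto simp: act_set_def)
      then have "germ x (hom_of E (smul (indicator B) (indicator V))) = E (act b v)"
        using germ_hom_of_slice(1)[OF S] sm pact[OF b(1) v] b by metis
      also have "\<dots> = sheaf_act G M b (E v)"
        using eq bG v slice_subset[OF V] unfolding equivariant_def by blast
      finally show ?thesis
        using r germ_hom_of_slice(1)[OF V v(1)] v(2) by simp
    next
      case False
      have "x \<notin> p ` act_set B V"
      proof
        assume "x \<in> p ` act_set B V"
        then obtain c v where cv: "c \<in> B" "v \<in> V" "src G c = p v" "x = p (act c v)"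
          by (auto simp: act_set_def)
        then have "rng G c = rng G b"
          using pact b by metis
        then have "c = b"
          using R.slice_inj[OF R cv(1) b(1)] by blast
        then show False
          using cv False by auto
      qed
      then have l: "germ x (hom_of E (smul (indicator B) (indicator V))) = germ x \<zero>"
        using germ_hom_of_slice(2)[OF S x] sm by simp
      have "germ x (indicator B \<odot> hom_of E (indicator V)) = sheaf_act G M b (germ (src G b) \<zero>)"
        using r germ_hom_of_slice(2)[OF V _ False] src_in_units[OF bG] by simp
      also have "\<dots> = germ x (indicator B \<odot> \<zero>)"
        using act_germ[OF B b(1), of \<zero>] b(2) by simp
      finally show ?thesis
        using l B by (simp add: smult_zero_right indicator_bisection_in_Cc)
    qed
  qed
qed

lemma is_hom_hom_of:
  assumes eq: "equivariant E" shows "is_hom (hom_of E)"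
proof -
  have "hom_of E (smul f m) = f \<odot> hom_of E m" if f: "f \<in> Cc (gtop G)" and m: "m \<in> Cc Y" for f m
    using f
  proof (induction rule: Cc_bisection_induct)
    case (indicator B)
    then have B: "indicator B \<in> Cc (gtop G)"
      by (rule indicator_bisection_in_Cc)
    from m show ?case
    proof (induction rule: Cc_slice_induct)
      case (indicator V)
      then show ?case
        using hom_of_bisection[OF eq \<open>bisection B\<close>] by simp
    next
      case (add f h)
      then show ?case
        using B by (simp add: smul_add_right hom_of_add smul_in_Cc smult_r_distr hom_of(1))
    next
      case (uminus f)
      then show ?case
        using B by (simp add: smul_uminus_right hom_of_uminus smul_in_Cc smult_minus_right hom_of(1))
    qed
  next
    case (add f h)
    then show ?case
      using m by (simp add: smul_add_left hom_of_add smul_in_Cc smult_l_distr hom_of(1))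
  next
    case (uminus f)
    then show ?case
      using m by (simp add: smul_uminus_left hom_of_uminus smul_in_Cc smult_uminus_left hom_of(1))
  qed
  then show ?thesis
    by (simp add: is_hom_def hom_of(1) hom_of_add)
qed

lemma stalk_map_hom_of:
  assumes eq: "equivariant E" and y: "y \<in> topspace Y" shows "stalk_map (hom_of E) y = E y"
proof -
  obtain V where V: "slice V" "y \<in> V"
    using slice_exists y by blast
  then show ?thesis
    using stalk_map_eq[OF is_hom_hom_of[OF eq] V] germ_hom_of_slice(1)[OF V] by simp
qed

end

section \<open>Sums and signs of homomorphisms\<close>

lemma stalk_map_add:
  assumes \<phi>: "is_hom \<phi>" "is_hom \<psi>" "is_hom \<omega>" and eq: "\<And>f. f \<in> Cc Y \<Longrightarrow> \<omega> f = \<phi> f \<oplus> \<psi> f"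
    and y: "y \<in> topspace Y"
  shows "stalk_map \<omega> y = stalk_map \<phi> y \<oplus>\<^bsub>fiber G M (p y)\<^esub> stalk_map \<psi> y"
proof -
  obtain V where V: "slice V" "y \<in> V"
    using slice_exists y by blast
  then show ?thesis
    using stalk_map_eq[OF _ V] \<phi> eq[OF indicator_slice_in_Cc[OF V(1)]] p_units[OF y]
    by (simp add: fiber_add hom_closed indicator_slice_in_Cc)
qed

text \<open>Mediates between the integer coefficients of the boundary on functions and the integer
  multiples in the fibre group that occur in the coboundary of continuous cochains.\<close>

lemma signed_sum:
  assumes \<phi>: "is_hom \<phi>" and x: "x \<in> units G" and F: "\<And>i. i \<le> k \<Longrightarrow> F i \<in> Cc Y"
  shows "(\<lambda>y. \<Sum>i\<le>k. (-1) ^ i * F i y) \<in> Cc Y"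
    and "germ x (\<phi> (\<lambda>y. \<Sum>i\<le>k. (-1) ^ i * F i y)) =
      (\<Oplus>\<^bsub>fiber G M x\<^esub>i\<in>{..k}. [((-1) ^ i :: int)] \<cdot>\<^bsub>fiber G M x\<^esub> germ x (\<phi> (F i)))"
proof -
  interpret F: abelian_group "fiber G M x"
    by (rule fiber_abelian_group[OF x])
  have one: "germ x (\<phi> (\<lambda>y. (-1) ^ i * f y)) = [((-1) ^ i :: int)] \<cdot>\<^bsub>fiber G M x\<^esub> germ x (\<phi> f)"
    if f: "f \<in> Cc Y" for i f
  proof -
    have c: "germ x (\<phi> f) \<in> carrier (fiber G M x)"
      using hom_closed[OF \<phi> f] x by blast
    show ?thesis
    proof (cases "even i")
      case True
      then show ?thesis
        using c F.add.int_pow_1 by simp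
    next
      case False
      then show ?thesis
        using c F.add.int_pow_neg[OF c, of 1] hom_uminus[OF \<phi> f] fiber_minus[OF x hom_closed[OF \<phi> f]]
        by (simp add: F.add.int_pow_1 a_inv_def)
    qed
  qed
  have *: "(\<lambda>y. \<Sum>i\<le>j. (-1) ^ i * F i y) \<in> Cc Y \<and>
      germ x (\<phi> (\<lambda>y. \<Sum>i\<le>j. (-1) ^ i * F i y)) =
      (\<Oplus>\<^bsub>fiber G M x\<^esub>i\<in>{..j}. [((-1) ^ i :: int)] \<cdot>\<^bsub>fiber G M x\<^esub> germ x (\<phi> (F i)))" if "j \<le> k" for j
    using that
  proof (induction j)
    case 0
    have "germ x (\<phi> (F 0)) \<in> carrier (fiber G M x)"
      using F[of 0] hom_closed[OF \<phi>] x by blast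
    then have "(\<Oplus>\<^bsub>fiber G M x\<^esub>i\<in>{..0}. [((-1) ^ i :: int)] \<cdot>\<^bsub>fiber G M x\<^esub> germ x (\<phi> (F i)))
        = germ x (\<phi> (F 0))"
      by (subst F.finsum_0) (auto simp: F.add.int_pow_1)
    then show ?case
      using F[of 0] by simp
  next
    case (Suc j)
    let ?S = "\<lambda>y. \<Sum>i\<le>j. (-1) ^ i * F i y" and ?T = "\<lambda>y. (-1) ^ Suc j * F (Suc j) y"
    have S: "?S \<in> Cc Y" and T: "?T \<in> Cc Y"
      using Suc Cc_scale[OF F[of "Suc j"], of "(-1) ^ Suc j"] by auto
    have car: "germ x (\<phi> (F i)) \<in> carrier (fiber G M x)" if "i \<le> Suc j" for i
      by (intro germ_in_fiber x hom_closed[OF \<phi>] F) (use that Suc.prems in simp)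
    \<comment> \<open>The last summand is moved to the front, which is where
      \<open>F.finsum_Suc\<close> places it.\<close>
    have e: "(\<lambda>y. \<Sum>i\<le>Suc j. (-1) ^ i * F i y) = (\<lambda>y. ?T y + ?S y)"
      by (simp add: add.commute)
    have "germ x (\<phi> (\<lambda>y. ?T y + ?S y)) = germ x (\<phi> ?T) \<oplus>\<^bsub>fiber G M x\<^esub> germ x (\<phi> ?S)"
      using hom_add[OF \<phi> T S] hom_closed[OF \<phi>] S T x by (simp add: fiber_add)
    also have "germ x (\<phi> ?T) = [((-1) ^ Suc j :: int)] \<cdot>\<^bsub>fiber G M x\<^esub> germ x (\<phi> (F (Suc j)))"
      using one[of "F (Suc j)" "Suc j"] F Suc.prems by blast
    also have "germ x (\<phi> ?S) =
        (\<Oplus>\<^bsub>fiber G M x\<^esub>i\<in>{..j}. [((-1) ^ i :: int)] \<cdot>\<^bsub>fiber G M x\<^esub> germ x (\<phi> (F i)))"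
      using Suc by simp
    also have "[((-1) ^ Suc j :: int)] \<cdot>\<^bsub>fiber G M x\<^esub> germ x (\<phi> (F (Suc j))) \<oplus>\<^bsub>fiber G M x\<^esub>
        (\<Oplus>\<^bsub>fiber G M x\<^esub>i\<in>{..j}. [((-1) ^ i :: int)] \<cdot>\<^bsub>fiber G M x\<^esub> germ x (\<phi> (F i))) =
        (\<Oplus>\<^bsub>fiber G M x\<^esub>i\<in>{..Suc j}. [((-1) ^ i :: int)] \<cdot>\<^bsub>fiber G M x\<^esub> germ x (\<phi> (F i)))"
      by (rule F.finsum_Suc[symmetric]) (use car in \<open>auto simp del: power_Suc\<close>)
    finally have "germ x (\<phi> (\<lambda>y. ?T y + ?S y)) =
        (\<Oplus>\<^bsub>fiber G M x\<^esub>i\<in>{..Suc j}. [((-1) ^ i :: int)] \<cdot>\<^bsub>fiber G M x\<^esub> germ x (\<phi> (F i)))" .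
    then show ?case
      unfolding e using Cc_add[OF T S] by blast
  qed
  then show "(\<lambda>y. \<Sum>i\<le>k. (-1) ^ i * F i y) \<in> Cc Y"
    and "germ x (\<phi> (\<lambda>y. \<Sum>i\<le>k. (-1) ^ i * F i y)) =
      (\<Oplus>\<^bsub>fiber G M x\<^esub>i\<in>{..k}. [((-1) ^ i :: int)] \<cdot>\<^bsub>fiber G M x\<^esub> germ x (\<phi> (F i)))"
    by blast+
qed

lemma is_hom_cong: "\<lbrakk>is_hom \<phi>; \<And>f. f \<in> Cc Y \<Longrightarrow> \<psi> f = \<phi> f\<rbrakk> \<Longrightarrow> is_hom \<psi>"
  by (simp add: is_hom_def Cc_add smul_in_Cc)

lemma is_hom_restrict: "is_hom \<phi> \<Longrightarrow> is_hom (restrict \<phi> (Cc Y))"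
  by (rule is_hom_cong) auto

lemma is_hom_zero: "is_hom (\<lambda>_. \<zero>)"
  by (simp add: is_hom_def smult_zero_right)

lemma is_hom_minus: "is_hom \<phi> \<Longrightarrow> is_hom (\<lambda>f. \<ominus> \<phi> f)"
  by (simp add: is_hom_def smult_minus_right minus_add)

lemma is_hom_add: "is_hom \<phi> \<Longrightarrow> is_hom \<psi> \<Longrightarrow> is_hom (\<lambda>f. \<phi> f \<oplus> \<psi> f)"
  by (simp add: is_hom_def smult_r_distr a_ac)

lemma stalk_map_cong:
  "\<lbrakk>is_hom \<phi>; \<And>f. f \<in> Cc Y \<Longrightarrow> \<psi> f = \<phi> f; y \<in> topspace Y\<rbrakk> \<Longrightarrow> stalk_map \<psi> y = stalk_map \<phi> y"
  using slice_exists[of y] is_hom_cong[of \<phi> \<psi>] stalk_map_eq indicator_slice_in_Cc by metis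

end

context ample_module
begin

section \<open>Pointwise operations and pullbacks for maps to the sheaf\<close>

lemma locally_germ_fiber:
  assumes "locally_germ Y p f" "y \<in> topspace Y" "p y \<in> units G"
  shows "f y \<in> carrier (fiber G M (p y))"
  using assms germ_in_fiber unfolding locally_germ_def by metis

lemma locally_germ_cong:
  "\<lbrakk>locally_germ Y p f; \<And>y. y \<in> topspace Y \<Longrightarrow> f' y = f y\<rbrakk> \<Longrightarrow> locally_germ Y p f'"
  unfolding locally_germ_def by (metis openin_subset subsetD)

lemma locally_germ_zero: "locally_germ Y p (\<lambda>y. \<zero>\<^bsub>fiber G M (p y)\<^esub>)"
  unfolding locally_germ_def fiber_zero
proof
  fix y assume "y \<in> topspace Y"
  then show "\<exists>S m. openin Y S \<and> y \<in> S \<and> m \<in> carrier M \<and> (\<forall>z\<in>S. germ (p z) \<zero> = germ (p z) m)"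
    by (intro exI[of _ "topspace Y"] exI[of _ \<zero>]) auto
qed

lemma locally_germ_add:
  assumes f: "locally_germ Y p f" and h: "locally_germ Y p h"
    and p: "\<And>y. y \<in> topspace Y \<Longrightarrow> p y \<in> units G"
  shows "locally_germ Y p (\<lambda>y. f y \<oplus>\<^bsub>fiber G M (p y)\<^esub> h y)"
  unfolding locally_germ_def
proof
  fix y assume y: "y \<in> topspace Y"
  obtain S m where S: "openin Y S" "y \<in> S" "m \<in> carrier M" "\<forall>z\<in>S. f z = germ (p z) m"
    using f y unfolding locally_germ_def by blast
  obtain T n where T: "openin Y T" "y \<in> T" "n \<in> carrier M" "\<forall>z\<in>T. h z = germ (p z) n"
    using h y unfolding locally_germ_def by blast
  have "f z \<oplus>\<^bsub>fiber G M (p z)\<^esub> h z = germ (p z) (m \<oplus> n)" if "z \<in> S \<inter> T" for z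
    using that S T p openin_subset[OF S(1)] by (auto simp: fiber_add)
  then show "\<exists>S m. openin Y S \<and> y \<in> S \<and> m \<in> carrier M \<and> (\<forall>z\<in>S. f z \<oplus>\<^bsub>fiber G M (p z)\<^esub> h z = germ (p z) m)"
    using S T by (intro exI[of _ "S \<inter> T"] exI[of _ "m \<oplus> n"]) auto
qed

lemma locally_germ_minus:
  assumes f: "locally_germ Y p f" and p: "\<And>y. y \<in> topspace Y \<Longrightarrow> p y \<in> units G"
  shows "locally_germ Y p (\<lambda>y. \<ominus>\<^bsub>fiber G M (p y)\<^esub> f y)"
  unfolding locally_germ_def
proof
  fix y assume y: "y \<in> topspace Y"
  obtain S m where S: "openin Y S" "y \<in> S" "m \<in> carrier M" "\<forall>z\<in>S. f z = germ (p z) m"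
    using f y unfolding locally_germ_def by blast
  have "\<ominus>\<^bsub>fiber G M (p z)\<^esub> f z = germ (p z) (\<ominus> m)" if "z \<in> S" for z
    using that S p openin_subset[OF S(1)] by (auto simp: fiber_minus)
  then show "\<exists>S m. openin Y S \<and> y \<in> S \<and> m \<in> carrier M \<and> (\<forall>z\<in>S. \<ominus>\<^bsub>fiber G M (p z)\<^esub> f z = germ (p z) m)"
    using S by (intro exI[of _ S] exI[of _ "\<ominus> m"]) auto
qed

lemma locally_germ_compose:
  assumes f: "locally_germ Y p f" and \<tau>: "continuous_map Z Y \<tau>"
    and q: "\<And>z. z \<in> topspace Z \<Longrightarrow> p (\<tau> z) = q z"
  shows "locally_germ Z q (\<lambda>z. f (\<tau> z))"
  unfolding locally_germ_def
proof
  fix z assume z: "z \<in> topspace Z"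
  then have "\<tau> z \<in> topspace Y"
    using \<tau> by (auto simp: continuous_map_def)
  then obtain S m where S: "openin Y S" "\<tau> z \<in> S" "m \<in> carrier M" "\<forall>y\<in>S. f y = germ (p y) m"
    using f unfolding locally_germ_def by blast
  have "openin Z {w \<in> topspace Z. \<tau> w \<in> S}"
    using \<tau> S(1) by (rule openin_continuous_map_preimage)
  then show "\<exists>S m. openin Z S \<and> z \<in> S \<and> m \<in> carrier M \<and> (\<forall>z\<in>S. f (\<tau> z) = germ (q z) m)"
    using S z q by (intro exI[of _ "{w \<in> topspace Z. \<tau> w \<in> S}"] exI[of _ m]) auto
qed

section \<open>The two cochain complexes\<close>

sublocale TM: groupoid_space_module G M "tuple_top G (Suc n)" "anchor G" "tuple_act G" for n
  by (intro groupoid_space_module.intro T.groupoid_space_axioms) unfold_locales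

abbreviation tuple_Cc :: "nat \<Rightarrow> ('g list \<Rightarrow> int) set" where
  "tuple_Cc n \<equiv> Cc (tuple_top G n)"

lemma carrier_tuple_module [simp]: "carrier (tuple_module G n) = tuple_Cc n"
  and add_tuple_module [simp]: "add (tuple_module G n) = (\<lambda>f h gs. f gs + h gs)"
  by (simp_all add: tuple_module_def)

lemma hom_cochains_carrier:
  "\<phi> \<in> carrier (hom_cochains G M n) \<longleftrightarrow> \<phi> \<in> extensional (tuple_Cc (Suc n)) \<and> TM.is_hom n \<phi>"
  by (auto simp: hom_cochains_def module_homs_def hom_def TM.is_hom_def smult_tuple_module)

lemma hom_cochains_mult:
  "\<phi> \<otimes>\<^bsub>hom_cochains G M n\<^esub> \<psi> = (\<lambda>f\<in>tuple_Cc (Suc n). \<phi> f \<oplus> \<psi> f)"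
  by (simp add: hom_cochains_def module_homs_def)

lemma hom_cochains_one: "\<one>\<^bsub>hom_cochains G M n\<^esub> = (\<lambda>f\<in>tuple_Cc (Suc n). \<zero>)"
  by (simp add: hom_cochains_def module_homs_def)

lemma hom_cochains_comm_group: "comm_group (hom_cochains G M n)"
proof (rule comm_groupI)
  let ?K = "hom_cochains G M n" and ?Cc = "tuple_Cc (Suc n)"
  fix \<phi> \<psi> \<omega> assume "\<phi> \<in> carrier ?K" "\<psi> \<in> carrier ?K" "\<omega> \<in> carrier ?K"
  then have h: "TM.is_hom n \<phi>" "TM.is_hom n \<psi>" "TM.is_hom n \<omega>"
    and e: "\<phi> \<in> extensional ?Cc" "\<psi> \<in> extensional ?Cc"
    by (auto simp: hom_cochains_carrier)
  show "\<phi> \<otimes>\<^bsub>?K\<^esub> \<psi> \<in> carrier ?K"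
    using TM.is_hom_restrict[OF TM.is_hom_add[OF h(1,2)]]
    by (simp add: hom_cochains_carrier hom_cochains_mult)
  show "\<phi> \<otimes>\<^bsub>?K\<^esub> \<psi> \<otimes>\<^bsub>?K\<^esub> \<omega> = \<phi> \<otimes>\<^bsub>?K\<^esub> (\<psi> \<otimes>\<^bsub>?K\<^esub> \<omega>)"
    using h by (auto simp: hom_cochains_mult restrict_def fun_eq_iff a_assoc TM.hom_closed)
  show "\<phi> \<otimes>\<^bsub>?K\<^esub> \<psi> = \<psi> \<otimes>\<^bsub>?K\<^esub> \<phi>"
    using h by (auto simp: hom_cochains_mult restrict_def fun_eq_iff a_comm TM.hom_closed)
  show "\<one>\<^bsub>?K\<^esub> \<otimes>\<^bsub>?K\<^esub> \<phi> = \<phi>"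
    using h e by (auto simp: hom_cochains_mult hom_cochains_one restrict_def fun_eq_iff
        TM.hom_closed extensional_def)
  have m: "TM.is_hom n (\<lambda>f\<in>?Cc. \<ominus> \<phi> f)"
    using h by (intro TM.is_hom_restrict TM.is_hom_minus)
  have "(\<lambda>f\<in>?Cc. \<ominus> \<phi> f) \<otimes>\<^bsub>?K\<^esub> \<phi> = \<one>\<^bsub>?K\<^esub>"
    using h by (auto simp: hom_cochains_mult hom_cochains_one restrict_def fun_eq_iff
        TM.hom_closed l_neg)
  then show "\<exists>\<psi>\<in>carrier ?K. \<psi> \<otimes>\<^bsub>?K\<^esub> \<phi> = \<one>\<^bsub>?K\<^esub>"
    using m by (intro bexI[of _ "\<lambda>f\<in>?Cc. \<ominus> \<phi> f"]) (auto simp: hom_cochains_carrier)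
next
  show "\<one>\<^bsub>hom_cochains G M n\<^esub> \<in> carrier (hom_cochains G M n)"
    using TM.is_hom_restrict[OF TM.is_hom_zero] by (simp add: hom_cochains_carrier hom_cochains_one)
qed

lemma continuous_cochains_carrier:
  "f \<in> carrier (continuous_cochains G M n) \<longleftrightarrow>
    f \<in> extensional (tuples G n) \<and> locally_germ (tuple_top G n) (anchor G) f"
  unfolding continuous_cochains_def using continuous_sheaf_iff[OF continuous_anchor, of n f] by auto

lemma continuous_cochains_mult:
  "f \<otimes>\<^bsub>continuous_cochains G M n\<^esub> h = (\<lambda>gs\<in>tuples G n. f gs \<oplus>\<^bsub>fiber G M (anchor G gs)\<^esub> h gs)"
  by (simp add: continuous_cochains_def)

lemma continuous_cochains_one:
  "\<one>\<^bsub>continuous_cochains G M n\<^esub> = (\<lambda>gs\<in>tuples G n. \<zero>\<^bsub>fiber G M (anchor G gs)\<^esub>)"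
  by (simp add: continuous_cochains_def)

lemma locally_germ_restrict:
  "locally_germ (tuple_top G n) p f \<Longrightarrow> locally_germ (tuple_top G n) p (restrict f (tuples G n))"
  by (rule locally_germ_cong) auto

lemma cochain_fiber:
  "f \<in> carrier (continuous_cochains G M n) \<Longrightarrow> gs \<in> tuples G n \<Longrightarrow> f gs \<in> carrier (fiber G M (anchor G gs))"
  using locally_germ_fiber[of "tuple_top G n" "anchor G" f gs] anchor_in_units
  by (simp add: continuous_cochains_carrier)

lemma continuous_cochains_comm_group: "comm_group (continuous_cochains G M n)"
proof (rule comm_groupI)
  let ?C = "continuous_cochains G M n" and ?T = "tuples G n"
  fix f h k assume fhk: "f \<in> carrier ?C" "h \<in> carrier ?C" "k \<in> carrier ?C"
  have ab: "abelian_group (fiber G M (anchor G gs))" if "gs \<in> ?T" for gs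
    using that anchor_in_units fiber_abelian_group by blast
  have car: "f gs \<in> carrier (fiber G M (anchor G gs))" "h gs \<in> carrier (fiber G M (anchor G gs))"
      "k gs \<in> carrier (fiber G M (anchor G gs))" if "gs \<in> ?T" for gs
    using that fhk cochain_fiber by auto
  have f: "f \<in> extensional ?T" "locally_germ (tuple_top G n) (anchor G) f"
    and h: "locally_germ (tuple_top G n) (anchor G) h"
    using fhk by (auto simp: continuous_cochains_carrier)
  show "f \<otimes>\<^bsub>?C\<^esub> h \<in> carrier ?C"
    using locally_germ_restrict[OF locally_germ_add[OF f(2) h]] anchor_in_units
    by (simp add: continuous_cochains_carrier continuous_cochains_mult)
  show "f \<otimes>\<^bsub>?C\<^esub> h \<otimes>\<^bsub>?C\<^esub> k = f \<otimes>\<^bsub>?C\<^esub> (h \<otimes>\<^bsub>?C\<^esub> k)"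
    unfolding continuous_cochains_mult
    by (rule restrict_ext) (use car abelian_group.axioms(1)[OF ab] in \<open>simp add: abelian_monoid.a_assoc\<close>)
  show "f \<otimes>\<^bsub>?C\<^esub> h = h \<otimes>\<^bsub>?C\<^esub> f"
    unfolding continuous_cochains_mult
    by (rule restrict_ext) (use car abelian_group.axioms(1)[OF ab] in \<open>simp add: abelian_monoid.a_comm\<close>)
  show "\<one>\<^bsub>?C\<^esub> \<otimes>\<^bsub>?C\<^esub> f = f"
  proof (rule extensionalityI[OF _ f(1)])
    show "\<one>\<^bsub>?C\<^esub> \<otimes>\<^bsub>?C\<^esub> f \<in> extensional ?T"
      by (simp add: continuous_cochains_mult)
    fix gs assume gs: "gs \<in> ?T"
    then show "(\<one>\<^bsub>?C\<^esub> \<otimes>\<^bsub>?C\<^esub> f) gs = f gs"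
      using abelian_monoid.l_zero[OF abelian_group.axioms(1)[OF ab[OF gs]] car(1)[OF gs]]
      by (simp add: continuous_cochains_mult continuous_cochains_one)
  qed
  let ?m = "\<lambda>gs\<in>?T. \<ominus>\<^bsub>fiber G M (anchor G gs)\<^esub> f gs"
  have "?m \<otimes>\<^bsub>?C\<^esub> f = \<one>\<^bsub>?C\<^esub>"
    unfolding continuous_cochains_mult continuous_cochains_one
    by (rule restrict_ext) (use car abelian_group.l_neg[OF ab] in simp)
  moreover have "?m \<in> carrier ?C"
    using locally_germ_restrict[OF locally_germ_minus[OF f(2)]] anchor_in_units
    by (simp add: continuous_cochains_carrier)
  ultimately show "\<exists>m\<in>carrier ?C. m \<otimes>\<^bsub>?C\<^esub> f = \<one>\<^bsub>?C\<^esub>"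
    by blast
next
  show "\<one>\<^bsub>continuous_cochains G M n\<^esub> \<in> carrier (continuous_cochains G M n)"
    using locally_germ_restrict[OF locally_germ_zero]
    by (simp add: continuous_cochains_carrier continuous_cochains_one)
qed

section \<open>Mutually inverse isomorphisms in each degree\<close>

definition theta :: "nat \<Rightarrow> (('g list \<Rightarrow> int) \<Rightarrow> 'm) \<Rightarrow> 'g list \<Rightarrow> ('g, 'm) germ" where
  "theta n \<phi> = (\<lambda>gs\<in>tuples G n. TM.stalk_map n \<phi> (unit_cons G n gs))"

text \<open>The equivariant map that corresponds to a cochain.\<close>

definition translate :: "('g list \<Rightarrow> ('g, 'm) germ) \<Rightarrow> 'g list \<Rightarrow> ('g, 'm) germ" where
  "translate f hs = sheaf_act G M (hd hs) (f (tuple_tail G hs))"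

definition rho :: "nat \<Rightarrow> ('g list \<Rightarrow> ('g, 'm) germ) \<Rightarrow> ('g list \<Rightarrow> int) \<Rightarrow> 'm" where
  "rho n f = restrict (TM.hom_of (translate f)) (tuple_Cc (Suc n))"

text \<open>Near a given tuple the first entries lie in one bisection \<open>B\<close> and the tails
  in an open set on which \<open>f\<close> is the germ of one \<open>m\<close>; there the translate
  is the germ of \<open>indicator B \<odot> m\<close>.\<close>

lemma translate_locally_germ:
  assumes f: "f \<in> carrier (continuous_cochains G M n)"
  shows "locally_germ (tuple_top G (Suc n)) (anchor G) (translate f)"
  unfolding locally_germ_def
proof
  let ?Y = "tuple_top G (Suc n)"
  fix hs assume "hs \<in> topspace ?Y"
  then have hs: "hs \<in> tuples G (Suc n)"
    by simp
  obtain S m where S: "openin (tuple_top G n) S" "tuple_tail G hs \<in> S" "m \<in> carrier M"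
      "\<forall>gs\<in>S. f gs = germ (anchor G gs) m"
    using f tuple_tail_in(1)[OF hs] unfolding continuous_cochains_carrier locally_germ_def by auto
  obtain B where B: "bisection B" "hd hs \<in> B"
    using bisection_exists hd_tuples[OF hs] by blast
  have hd0: "hd gs = gs ! 0" if "gs \<in> tuples G (Suc n)" for gs
    using tuples_nonempty[OF that] by (simp add: hd_conv_nth)
  let ?N = "{gs \<in> topspace ?Y. gs ! 0 \<in> B} \<inter> {gs \<in> topspace ?Y. tuple_tail G gs \<in> S}"
  have "openin ?Y ?N"
    using B S(1) by (intro openin_Int openin_continuous_map_preimage[OF continuous_nth]
        openin_continuous_map_preimage[OF continuous_tuple_tail])
      (auto simp: compact_open_bisection_def)
  moreover have "translate f gs = germ (anchor G gs) (indicator B \<odot> m)" if gs: "gs \<in> ?N" for gs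
  proof -
    have gT: "gs \<in> tuples G (Suc n)" and "hd gs \<in> B"
      using gs hd0 by auto
    then have "germ (rng G (hd gs)) (indicator B \<odot> m) = sheaf_act G M (hd gs) (germ (src G (hd gs)) m)"
      using act_germ[OF B(1) _ S(3)] by simp
    then show ?thesis
      using gs S(4) tuple_tail_in(2)[OF gT] by (simp add: translate_def anchor_def)
  qed
  ultimately show "\<exists>S m. openin ?Y S \<and> hs \<in> S \<and> m \<in> carrier M \<and> (\<forall>gs\<in>S. translate f gs = germ (anchor G gs) m)"
    using B S hs hd0 by (intro exI[of _ ?N] exI[of _ "indicator B \<odot> m"]) auto
qed

lemma tuple_tail_act:
  "\<lbrakk>g \<in> arrows G; gs \<in> tuples G (Suc n); src G g = anchor G gs\<rbrakk> \<Longrightarrow>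
    tuple_tail G (tuple_act G g gs) = tuple_tail G gs"
  using hd_tuples by (auto simp: tuple_tail_def tuple_act_def anchor_def src_mul)

text \<open>The action multiplies the first entry and leaves the tail alone, so this is
  functoriality of the action on germs.\<close>

lemma translate_equivariant:
  assumes f: "f \<in> carrier (continuous_cochains G M n)"
  shows "TM.equivariant n (translate f)"
  unfolding TM.equivariant_def
proof (intro ballI impI)
  fix g hs assume g: "g \<in> arrows G" and "hs \<in> topspace (tuple_top G (Suc n))" and gh: "src G g = anchor G hs"
  then have hs: "hs \<in> tuples G (Suc n)"
    by simp
  have "f (tuple_tail G hs) \<in> carrier (fiber G M (src G (hd hs)))"
    using cochain_fiber[OF f] tuple_tail_in[OF hs] by metis
  then have "sheaf_act G M g (sheaf_act G M (hd hs) (f (tuple_tail G hs)))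
      = sheaf_act G M (mul G g (hd hs)) (f (tuple_tail G hs))"
    using g gh hd_tuples[OF hs] by (intro act_mul_germ) (auto simp: anchor_def)
  then show "translate f (tuple_act G g hs) = sheaf_act G M g (translate f hs)"
    using tuple_tail_act[OF g hs gh] by (simp add: translate_def tuple_act_def)
qed

lemma theta_closed:
  assumes "\<phi> \<in> carrier (hom_cochains G M n)"
  shows "theta n \<phi> \<in> carrier (continuous_cochains G M n)"
proof -
  have "locally_germ (tuple_top G (Suc n)) (anchor G) (TM.stalk_map n \<phi>)"
    using assms TM.stalk_map_locally_germ by (simp add: hom_cochains_carrier)
  then have "locally_germ (tuple_top G n) (anchor G) (\<lambda>gs. TM.stalk_map n \<phi> (unit_cons G n gs))"
    by (rule locally_germ_compose[OF _ continuous_unit_cons]) (simp add: anchor_unit_cons)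
  then show ?thesis
    using locally_germ_restrict by (simp add: theta_def continuous_cochains_carrier)
qed

lemma rho_closed:
  assumes "f \<in> carrier (continuous_cochains G M n)"
  shows "rho n f \<in> carrier (hom_cochains G M n)"
  using TM.is_hom_restrict[OF TM.is_hom_hom_of[OF translate_locally_germ[OF assms] translate_equivariant[OF assms]]]
  by (simp add: rho_def hom_cochains_carrier)

lemma stalk_map_rho:
  assumes f: "f \<in> carrier (continuous_cochains G M n)" and hs: "hs \<in> tuples G (Suc n)"
  shows "TM.stalk_map n (rho n f) hs = translate f hs"
proof -
  have "TM.stalk_map n (rho n f) hs = TM.stalk_map n (TM.hom_of (translate f)) hs"
    using hs by (intro TM.stalk_map_cong TM.is_hom_hom_of translate_locally_germ[OF f]
        translate_equivariant[OF f]) (auto simp: rho_def)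
  then show ?thesis
    using TM.stalk_map_hom_of[OF translate_locally_germ[OF f] translate_equivariant[OF f]] hs by simp
qed

lemma stalk_map_theta:
  assumes \<phi>: "\<phi> \<in> carrier (hom_cochains G M n)" and hs: "hs \<in> tuples G (Suc n)"
  shows "TM.stalk_map n \<phi> hs = translate (theta n \<phi>) hs"
proof -
  let ?u = "unit_cons G n (tuple_tail G hs)"
  have tail: "tuple_tail G hs \<in> tuples G n" "anchor G (tuple_tail G hs) = src G (hd hs)"
    using tuple_tail_in[OF hs] by auto
  have "TM.stalk_map n \<phi> (tuple_act G (hd hs) ?u) = sheaf_act G M (hd hs) (TM.stalk_map n \<phi> ?u)"
    using TM.stalk_map_equivariant[of n \<phi>] \<phi> hd_tuples[OF hs] unit_cons_in[OF tail(1)]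
      anchor_unit_cons[OF tail(1)] tail(2)
    unfolding hom_cochains_carrier TM.equivariant_def by simp
  then show ?thesis
    using tail(1) by (simp add: tuple_act_unit_cons[OF hs] translate_def theta_def)
qed

text \<open>The first entry of \<open>unit_cons G n gs\<close> is the unit
  \<open>anchor G gs\<close>, which acts trivially on its fibre.\<close>

lemma theta_rho:
  assumes f: "f \<in> carrier (continuous_cochains G M n)" shows "theta n (rho n f) = f"
proof (rule extensionalityI[of _ "tuples G n"])
  show "theta n (rho n f) \<in> extensional (tuples G n)" "f \<in> extensional (tuples G n)"
    using f by (auto simp: theta_def continuous_cochains_carrier)
  fix gs assume gs: "gs \<in> tuples G n"
  have hd: "hd (unit_cons G n gs) = anchor G gs"
    using gs by (cases n) (auto simp: unit_cons_def anchor_def tuples_def rng_unit)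
  have "theta n (rho n f) gs = sheaf_act G M (anchor G gs) (f gs)"
    using gs stalk_map_rho[OF f unit_cons_in[OF gs]] tuple_tail_unit_cons[OF gs] hd
    by (simp add: theta_def translate_def)
  then show "theta n (rho n f) gs = f gs"
    using act_unit_germ[OF anchor_in_units[OF gs] cochain_fiber[OF f gs]] by simp
qed

text \<open>Both homomorphisms have the translate of \<open>theta n \<phi>\<close> as their stalk
  map, and homomorphisms are determined by stalk maps.\<close>

lemma rho_theta:
  assumes \<phi>: "\<phi> \<in> carrier (hom_cochains G M n)" shows "rho n (theta n \<phi>) = \<phi>"
proof (rule extensionalityI[of _ "tuple_Cc (Suc n)"])
  show "rho n (theta n \<phi>) \<in> extensional (tuple_Cc (Suc n))" "\<phi> \<in> extensional (tuple_Cc (Suc n))"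
    using \<phi> by (auto simp: rho_def hom_cochains_carrier)
  have h: "TM.is_hom n (rho n (theta n \<phi>))" "TM.is_hom n \<phi>"
    using \<phi> rho_closed[OF theta_closed[OF \<phi>]] by (auto simp: hom_cochains_carrier)
  fix f assume "f \<in> tuple_Cc (Suc n)"
  then show "rho n (theta n \<phi>) f = \<phi> f"
    using TM.hom_ext[OF h] stalk_map_rho[OF theta_closed[OF \<phi>]] stalk_map_theta[OF \<phi>] by simp
qed

lemma theta_mult:
  assumes \<phi>: "\<phi> \<in> carrier (hom_cochains G M n)" and \<psi>: "\<psi> \<in> carrier (hom_cochains G M n)"
  shows "theta n (\<phi> \<otimes>\<^bsub>hom_cochains G M n\<^esub> \<psi>)
    = theta n \<phi> \<otimes>\<^bsub>continuous_cochains G M n\<^esub> theta n \<psi>"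
proof -
  interpret K: comm_group "hom_cochains G M n"
    by (rule hom_cochains_comm_group)
  have h: "TM.is_hom n \<phi>" "TM.is_hom n \<psi>" "TM.is_hom n (\<phi> \<otimes>\<^bsub>hom_cochains G M n\<^esub> \<psi>)"
    using \<phi> \<psi> K.m_closed[OF \<phi> \<psi>] by (auto simp: hom_cochains_carrier)
  have "TM.stalk_map n (\<phi> \<otimes>\<^bsub>hom_cochains G M n\<^esub> \<psi>) (unit_cons G n gs)
    = TM.stalk_map n \<phi> (unit_cons G n gs) \<oplus>\<^bsub>fiber G M (anchor G gs)\<^esub> TM.stalk_map n \<psi> (unit_cons G n gs)"
    if gs: "gs \<in> tuples G n" for gs
    using TM.stalk_map_add[OF h, of "unit_cons G n gs"] unit_cons_in[OF gs] anchor_unit_cons[OF gs]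
    by (simp add: hom_cochains_mult)
  then show ?thesis
    unfolding theta_def continuous_cochains_mult by (intro restrict_ext) simp
qed

lemma theta_rho_isomorphisms:
  "group_isomorphisms (hom_cochains G M n) (continuous_cochains G M n) (theta n) (rho n)"
proof -
  interpret K: comm_group "hom_cochains G M n"
    by (rule hom_cochains_comm_group)
  have "rho n (f \<otimes>\<^bsub>continuous_cochains G M n\<^esub> h) = rho n f \<otimes>\<^bsub>hom_cochains G M n\<^esub> rho n h"
    if "f \<in> carrier (continuous_cochains G M n)" "h \<in> carrier (continuous_cochains G M n)" for f h
    using that theta_mult[of "rho n f" n "rho n h"] theta_rho rho_closed rho_theta K.m_closed by metis
  then show ?thesis
    by (auto simp: group_isomorphisms_def hom_def theta_closed rho_closed theta_mult theta_rho rho_theta)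
qed

end

section \<open>Compatibility with the boundary maps\<close>

context groupoid_space
begin

lemma smul_signed_sum:
  assumes k: "k \<in> Cc (gtop G)"
  shows "smul k (\<lambda>y. \<Sum>i\<le>j. (-1) ^ i * F i y) = (\<lambda>y. \<Sum>i\<le>j. (-1) ^ i * smul k (F i) y)"
proof -
  have sign: "smul k (\<lambda>y. (-1) ^ i * m y) = (\<lambda>y. (-1) ^ i * smul k m y)" for i m
    by (cases "even i") (simp_all add: smul_uminus_right)
  show ?thesis
  proof (induction j)
    case 0
    then show ?case by simp
  next
    case (Suc j)
    then show ?case
      using smul_add_right[OF k, of "\<lambda>y. \<Sum>i\<le>j. (-1) ^ i * F i y" "\<lambda>y. (-1) ^ Suc j * F (Suc j) y"]
        sign[of "Suc j" "F (Suc j)"]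
      by (simp del: power_Suc)
  qed
qed

end

context ample_groupoid
begin

lemma bar_face_act_set:
  assumes B: "B \<subseteq> arrows G" and V: "V \<subseteq> tuples G (Suc (Suc n))" and i: "i \<le> Suc n"
  shows "bar_face G (Suc n) i ` T.act_set B V = T.act_set B (bar_face G (Suc n) i ` V)"
proof (intro subset_antisym subsetI)
  fix hs assume "hs \<in> bar_face G (Suc n) i ` T.act_set B V"
  then obtain b v where bv: "hs = bar_face G (Suc n) i (tuple_act G b v)" "b \<in> B" "v \<in> V" "src G b = anchor G v"
    by (auto simp: T.act_set_def)
  then have "hs = tuple_act G b (bar_face G (Suc n) i v)" "src G b = anchor G (bar_face G (Suc n) i v)"
    using bar_face_act anchor_bar_face B V i by (auto simp: subset_iff)
  then show "hs \<in> T.act_set B (bar_face G (Suc n) i ` V)"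
    using bv unfolding T.act_set_def by blast
next
  fix hs assume "hs \<in> T.act_set B (bar_face G (Suc n) i ` V)"
  then obtain b v where bv: "hs = tuple_act G b (bar_face G (Suc n) i v)" "b \<in> B" "v \<in> V"
      "src G b = anchor G (bar_face G (Suc n) i v)"
    by (auto simp: T.act_set_def)
  then have "src G b = anchor G v"
    using anchor_bar_face V i by auto
  then have "hs = bar_face G (Suc n) i (tuple_act G b v)" "tuple_act G b v \<in> T.act_set B V"
    using bv bar_face_act B V by (auto simp: T.act_set_def subset_iff)
  then show "hs \<in> bar_face G (Suc n) i ` T.act_set B V"
    by blast
qed

text \<open>Additivity in \<open>k\<close> and \<open>f\<close> reduces this to indicators, where it
  says that the face map commutes with forming the set of products, that is, that it is
  equivariant.\<close>

lemma pushforward_smul: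
  assumes i: "i \<le> Suc n" and k: "k \<in> Cc (gtop G)" and f: "f \<in> Cc (tuple_top G (Suc (Suc n)))"
  shows "pushforward (tuples G (Suc (Suc n))) (bar_face G (Suc n) i) (T.smul (Suc n) k f)
    = T.smul n k (pushforward (tuples G (Suc (Suc n))) (bar_face G (Suc n) i) f)"
proof -
  interpret B: etale_morphism "unit_top G" "tuple_top G (Suc n)" "anchor G"
      "tuple_top G (Suc (Suc n))" "anchor G" "bar_face G (Suc n) i"
    by (rule bar_face_morphism[OF i])
  note push = B.pushforward_add[unfolded topspace_tuple_top] pushforward_uminus
    B.pushforward_indicator[unfolded topspace_tuple_top]
  from k show ?thesis
  proof (induction rule: Cc_bisection_induct)
    case (indicator B)
    then have iB: "indicator B \<in> Cc (gtop G)" and R: "R.slice B"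
      by (auto simp: indicator_bisection_in_Cc bisection_iff)
    from f show ?case
    proof (induction rule: T.Cc_slice_induct)
      case (indicator V)
      have "bar_face G (Suc n) i ` T.act_set B V = T.act_set B (bar_face G (Suc n) i ` V)"
        using R.slice_subset[OF R] T.slice_subset[OF indicator] i by (intro bar_face_act_set) auto
      then show ?case
        using indicator R B.slice_image[OF indicator]
        by (simp add: T.smul_indicators push T.slice_act_set)
    qed (simp_all add: push T.smul_add_right[OF iB] T.smul_uminus_right T.smul_in_Cc iB)
  qed (simp_all add: push T.smul_add_left T.smul_uminus_left T.smul_in_Cc f)
qed

text \<open>A unit in front shifts the faces by one. Face \<open>0\<close> absorbs the unit and
  gives the term with the action, face \<open>i\<close> merges at \<open>i - 1\<close> in the
  original tuple, and the last face drops its last entry. For \<open>n = 0\<close> this last face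
  leaves the range alone, which accounts for the separate formula in degree zero.\<close>

lemma bar_face_rng_Cons:
  assumes gs: "gs \<in> tuples G (Suc n)"
  shows "bar_face G (Suc n) 0 (rng G (hd gs) # gs) = gs"
    and "\<lbrakk>1 \<le> i; i \<le> n\<rbrakk> \<Longrightarrow> merge_at G (i - 1) gs \<in> tuples G n \<and>
      bar_face G (Suc n) i (rng G (hd gs) # gs) = unit_cons G n (merge_at G (i - 1) gs)"
    and "n = 0 \<Longrightarrow> bar_face G (Suc n) (Suc n) (rng G (hd gs) # gs) = unit_cons G n [rng G (hd gs)]"
    and "n > 0 \<Longrightarrow> butlast gs \<in> tuples G n \<and>
      bar_face G (Suc n) (Suc n) (rng G (hd gs) # gs) = unit_cons G n (butlast gs)"
proof -
  obtain h hs where gh: "gs = h # hs"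
    using tuples_nonempty[OF gs] list.exhaust by blast
  have "h \<in> arrows G"
    using hd_tuples[OF gs] gh by simp
  then show "bar_face G (Suc n) 0 (rng G (hd gs) # gs) = gs"
    by (simp add: gh bar_face_def merge_at_def mul_rng_left)
  show "merge_at G (i - 1) gs \<in> tuples G n \<and>
      bar_face G (Suc n) i (rng G (hd gs) # gs) = unit_cons G n (merge_at G (i - 1) gs)"
    if i: "1 \<le> i" "i \<le> n"
  proof -
    obtain m j where m: "n = Suc m" and j: "i = Suc j"
      using i by (metis One_nat_def Suc_le_D le_trans)
    \<comment> \<open>Since \<open>n\<close> is positive here, the merge is itself a face one degree
      lower, so the facts about \<open>bar_face\<close> provide its membership and its
      anchor.\<close>
    have e: "bar_face G (Suc m) j gs = merge_at G j gs"
      using i m j by (simp add: bar_face_def)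
    have "merge_at G j gs \<in> tuples G n" "rng G (hd (merge_at G j gs)) = rng G (hd gs)"
      using bar_face_in[of gs m j] anchor_bar_face[of gs m j] gs i m j e by (auto simp: anchor_def)
    moreover have "merge_at G i (rng G (hd gs) # gs) = rng G (hd gs) # merge_at G j gs"
      by (simp add: merge_at_def j)
    ultimately show ?thesis
      using i m j by (simp add: bar_face_def unit_cons_def)
  qed
  show "bar_face G (Suc n) (Suc n) (rng G (hd gs) # gs) = unit_cons G n [rng G (hd gs)]" if "n = 0"
  proof -
    have "hs = []"
      using gs gh that by (simp add: tuples_Suc)
    then show ?thesis
      using that by (simp add: bar_face_def unit_cons_def gh)
  qed
  show "butlast gs \<in> tuples G n \<and>
      bar_face G (Suc n) (Suc n) (rng G (hd gs) # gs) = unit_cons G n (butlast gs)" if n: "n > 0"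
  proof -
    obtain m where m: "n = Suc m"
      using n gr0_conv_Suc by blast
    have e: "bar_face G (Suc m) (Suc m) gs = butlast gs"
      by (simp add: bar_face_def)
    have "butlast gs \<in> tuples G n" "rng G (hd (butlast gs)) = rng G (hd gs)"
      using bar_face_in[of gs m "Suc m"] anchor_bar_face[of gs m "Suc m"] gs m e by (auto simp: anchor_def)
    then show ?thesis
      using m gh by (simp add: bar_face_def unit_cons_def)
  qed
qed

end

context ample_module
begin

lemma hom_coboundary_eq:
  "hom_coboundary G n \<phi> = (\<lambda>f\<in>tuple_Cc (Suc (Suc n)). \<phi> (bar_boundary G (Suc n) f))"
  by (simp add: hom_coboundary_def compose_def)

lemma pushforward_bar_face:
  assumes i: "i \<le> Suc n"
  shows "f \<in> tuple_Cc (Suc (Suc n)) \<Longrightarrow>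
      pushforward (tuples G (Suc (Suc n))) (bar_face G (Suc n) i) f \<in> tuple_Cc (Suc n)"
    and "T.slice (Suc n) V \<Longrightarrow>
      pushforward (tuples G (Suc (Suc n))) (bar_face G (Suc n) i) (indicator V) = indicator (bar_face G (Suc n) i ` V)"
    and "T.slice (Suc n) V \<Longrightarrow> T.slice n (bar_face G (Suc n) i ` V)"
    and "\<lbrakk>f \<in> tuple_Cc (Suc (Suc n)); h \<in> tuple_Cc (Suc (Suc n))\<rbrakk> \<Longrightarrow>
      pushforward (tuples G (Suc (Suc n))) (bar_face G (Suc n) i) (\<lambda>gs. f gs + h gs) =
      (\<lambda>gs. pushforward (tuples G (Suc (Suc n))) (bar_face G (Suc n) i) f gs +
        pushforward (tuples G (Suc (Suc n))) (bar_face G (Suc n) i) h gs)"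
proof -
  interpret B: etale_morphism "unit_top G" "tuple_top G (Suc n)" "anchor G"
      "tuple_top G (Suc (Suc n))" "anchor G" "bar_face G (Suc n) i"
    by (rule bar_face_morphism[OF i])
  show "f \<in> tuple_Cc (Suc (Suc n)) \<Longrightarrow>
      pushforward (tuples G (Suc (Suc n))) (bar_face G (Suc n) i) f \<in> tuple_Cc (Suc n)"
    by (rule B.pushforward_in_Cc[unfolded topspace_tuple_top])
  show "T.slice (Suc n) V \<Longrightarrow>
      pushforward (tuples G (Suc (Suc n))) (bar_face G (Suc n) i) (indicator V) = indicator (bar_face G (Suc n) i ` V)"
    by (rule B.pushforward_indicator[unfolded topspace_tuple_top])
  show "T.slice (Suc n) V \<Longrightarrow> T.slice n (bar_face G (Suc n) i ` V)"
    by (rule B.slice_image)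
  show "\<lbrakk>f \<in> tuple_Cc (Suc (Suc n)); h \<in> tuple_Cc (Suc (Suc n))\<rbrakk> \<Longrightarrow>
      pushforward (tuples G (Suc (Suc n))) (bar_face G (Suc n) i) (\<lambda>gs. f gs + h gs) =
      (\<lambda>gs. pushforward (tuples G (Suc (Suc n))) (bar_face G (Suc n) i) f gs +
        pushforward (tuples G (Suc (Suc n))) (bar_face G (Suc n) i) h gs)"
    by (rule B.pushforward_add[unfolded topspace_tuple_top])
qed

lemma germ_bar_boundary:
  assumes \<phi>: "TM.is_hom n \<phi>" and x: "x \<in> units G" and f: "f \<in> tuple_Cc (Suc (Suc n))"
  shows "germ x (\<phi> (bar_boundary G (Suc n) f)) = (\<Oplus>\<^bsub>fiber G M x\<^esub>i\<in>{..Suc n}. [((-1) ^ i :: int)] \<cdot>\<^bsub>fiber G M x\<^esub>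
      germ x (\<phi> (pushforward (tuples G (Suc (Suc n))) (bar_face G (Suc n) i) f)))"
  unfolding bar_boundary_def
  by (rule TM.signed_sum(2)[OF \<phi> x]) (rule pushforward_bar_face(1)[OF _ f])

lemma bar_boundary_in_Cc:
  assumes f: "f \<in> tuple_Cc (Suc (Suc n))"
  shows "bar_boundary G (Suc n) f \<in> tuple_Cc (Suc n)"
proof -
  have *: "(\<lambda>gs. \<Sum>i\<le>j. (-1) ^ i * pushforward (tuples G (Suc (Suc n))) (bar_face G (Suc n) i) f gs)
      \<in> tuple_Cc (Suc n)" if "j \<le> Suc n" for j
    using that
  proof (induction j)
    case 0
    then show ?case
      using pushforward_bar_face(1)[OF _ f, of 0] by simp
  next
    case (Suc j)
    have "(\<lambda>gs. (-1) ^ Suc j * pushforward (tuples G (Suc (Suc n))) (bar_face G (Suc n) (Suc j)) f gs)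
        \<in> tuple_Cc (Suc n)"
      by (rule Cc_scale[OF pushforward_bar_face(1)[OF Suc.prems f]])
    then show ?case
      using Cc_add Suc by (simp del: power_Suc)
  qed
  then show ?thesis
    unfolding bar_boundary_def by blast
qed

lemma hom_coboundary_closed:
  assumes \<phi>: "\<phi> \<in> carrier (hom_cochains G M n)"
  shows "hom_coboundary G n \<phi> \<in> carrier (hom_cochains G M (Suc n))"
proof -
  let ?push = "\<lambda>i. pushforward (tuples G (Suc (Suc n))) (bar_face G (Suc n) i)"
  have h: "TM.is_hom n \<phi>"
    using \<phi> by (simp add: hom_cochains_carrier)
  have add: "bar_boundary G (Suc n) (\<lambda>gs. f gs + k gs)
      = (\<lambda>gs. bar_boundary G (Suc n) f gs + bar_boundary G (Suc n) k gs)"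
    if "f \<in> tuple_Cc (Suc (Suc n))" "k \<in> tuple_Cc (Suc (Suc n))" for f k
    unfolding bar_boundary_def
    by (intro ext, subst sum.distrib[symmetric], intro sum.cong refl)
      (simp add: pushforward_bar_face(4) that distrib_left)
  have smul: "bar_boundary G (Suc n) (T.smul (Suc n) k f) = T.smul n k (bar_boundary G (Suc n) f)"
    if "k \<in> Cc (gtop G)" "f \<in> tuple_Cc (Suc (Suc n))" for k f
    unfolding bar_boundary_def using pushforward_smul that
    by (subst T.smul_signed_sum) simp_all
  have "TM.is_hom (Suc n) (\<lambda>f. \<phi> (bar_boundary G (Suc n) f))"
    unfolding TM.is_hom_def
    using add smul h bar_boundary_in_Cc by (simp add: TM.hom_closed TM.hom_add TM.hom_smul)
  then show ?thesis
    unfolding hom_coboundary_eq hom_cochains_carrier using TM.is_hom_restrict by blast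
qed

text \<open>A single slice \<open>V\<close> through the tuple with the unit in front serves for all
  summands: its image under each face map is a slice through the corresponding face, and the
  pushforward of its indicator is the indicator of that image.\<close>

lemma theta_hom_coboundary_sum:
  assumes \<phi>: "\<phi> \<in> carrier (hom_cochains G M n)" and gs: "gs \<in> tuples G (Suc n)"
  defines "A \<equiv> fiber G M (anchor G gs)"
  shows "theta (Suc n) (hom_coboundary G n \<phi>) gs =
    (\<Oplus>\<^bsub>A\<^esub>i\<in>{..Suc n}. [((-1) ^ i :: int)] \<cdot>\<^bsub>A\<^esub> TM.stalk_map n \<phi> (bar_face G (Suc n) i (rng G (hd gs) # gs)))"
proof -
  let ?y = "rng G (hd gs) # gs"
  have h: "TM.is_hom n \<phi>" "TM.is_hom (Suc n) (hom_coboundary G n \<phi>)"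
    using \<phi> hom_coboundary_closed[OF \<phi>] by (auto simp: hom_cochains_carrier)
  have y: "unit_cons G (Suc n) gs = ?y" "?y \<in> tuples G (Suc (Suc n))" "anchor G ?y = anchor G gs"
    using unit_cons_in[OF gs] anchor_unit_cons[OF gs] by (auto simp: unit_cons_def)
  obtain V where V: "T.slice (Suc n) V" "?y \<in> V"
    using TM.slice_exists[of ?y "Suc n"] y by auto
  have x: "anchor G gs \<in> units G"
    by (rule anchor_in_units[OF gs])
  interpret F: abelian_group A
    unfolding A_def by (rule fiber_abelian_group[OF x])
  have st: "germ (anchor G gs) (\<phi> (pushforward (tuples G (Suc (Suc n))) (bar_face G (Suc n) i) (indicator V)))
      = TM.stalk_map n \<phi> (bar_face G (Suc n) i ?y)" if i: "i \<le> Suc n" for i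
    using TM.stalk_map_eq[OF h(1) pushforward_bar_face(3)[OF i V(1)], of "bar_face G (Suc n) i ?y"]
      V(2) pushforward_bar_face(2)[OF i V(1)] anchor_bar_face[OF y(2) i] y(3) by simp
  have "theta (Suc n) (hom_coboundary G n \<phi>) gs = TM.stalk_map (Suc n) (hom_coboundary G n \<phi>) ?y"
    using gs y by (simp add: theta_def)
  also have "\<dots> = germ (anchor G gs) (\<phi> (bar_boundary G (Suc n) (indicator V)))"
    using TM.stalk_map_eq[OF h(2) V] y(3) T.indicator_slice_in_Cc[OF V(1)] by (simp add: hom_coboundary_eq)
  also have "\<dots> = (\<Oplus>\<^bsub>A\<^esub>i\<in>{..Suc n}. [((-1) ^ i :: int)] \<cdot>\<^bsub>A\<^esub>
      germ (anchor G gs) (\<phi> (pushforward (tuples G (Suc (Suc n))) (bar_face G (Suc n) i) (indicator V))))"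
    unfolding A_def by (rule germ_bar_boundary[OF h(1) x T.indicator_slice_in_Cc[OF V(1)]])
  also have "\<dots> = (\<Oplus>\<^bsub>A\<^esub>i\<in>{..Suc n}. [((-1) ^ i :: int)] \<cdot>\<^bsub>A\<^esub> TM.stalk_map n \<phi> (bar_face G (Suc n) i ?y))"
  proof (rule F.finsum_cong'[OF refl])
    have "TM.stalk_map n \<phi> (bar_face G (Suc n) i ?y) \<in> carrier A" if i: "i \<le> Suc n" for i
      using locally_germ_fiber[OF TM.stalk_map_locally_germ[OF h(1)], of "bar_face G (Suc n) i ?y"]
        bar_face_in[OF y(2) i] anchor_bar_face[OF y(2) i] y(3) x by (simp add: A_def)
    then show "(\<lambda>i. [((-1) ^ i :: int)] \<cdot>\<^bsub>A\<^esub> TM.stalk_map n \<phi> (bar_face G (Suc n) i ?y)) \<in> {..Suc n} \<rightarrow> carrier A"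
      by (auto simp del: power_Suc)
  qed (simp add: st)
  finally show ?thesis .
qed

text \<open>The summands of the preceding formula match those of the coboundary one by one; what
  remains is to reorder them, with the first and the last separated from the rest.\<close>

lemma continuous_coboundary_theta:
  assumes \<phi>: "\<phi> \<in> carrier (hom_cochains G M n)"
  shows "continuous_coboundary G M n (theta n \<phi>) = theta (Suc n) (hom_coboundary G n \<phi>)"
proof (rule extensionalityI[of _ "tuples G (Suc n)"])
  show "continuous_coboundary G M n (theta n \<phi>) \<in> extensional (tuples G (Suc n))"
    "theta (Suc n) (hom_coboundary G n \<phi>) \<in> extensional (tuples G (Suc n))"
    by (auto simp: continuous_coboundary_def theta_def)
  fix gs assume gs: "gs \<in> tuples G (Suc n)"
  define A where "A = fiber G M (anchor G gs)"
  define y where "y = rng G (hd gs) # gs"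
  have x: "anchor G gs \<in> units G"
    by (rule anchor_in_units[OF gs])
  interpret F: abelian_group A
    unfolding A_def by (rule fiber_abelian_group[OF x])
  let ?s = "\<lambda>i. TM.stalk_map n \<phi> (bar_face G (Suc n) i y)"
  have yT: "y \<in> tuples G (Suc (Suc n))" "anchor G y = anchor G gs"
    using unit_cons_in[OF gs] anchor_unit_cons[OF gs] by (auto simp: unit_cons_def y_def)
  have car: "?s i \<in> carrier A" if i: "i \<le> Suc n" for i
    using locally_germ_fiber[OF TM.stalk_map_locally_germ, of n \<phi> "bar_face G (Suc n) i y"] \<phi>
      bar_face_in[OF yT(1) i] anchor_bar_face[OF yT(1) i] yT(2) x
    by (simp add: A_def hom_cochains_carrier)
  have sum: "theta (Suc n) (hom_coboundary G n \<phi>) gs = (\<Oplus>\<^bsub>A\<^esub>i\<in>{..Suc n}. [((-1) ^ i :: int)] \<cdot>\<^bsub>A\<^esub> ?s i)"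
    unfolding A_def y_def by (rule theta_hom_coboundary_sum[OF \<phi> gs])
  have "\<dots> = [((-1) ^ Suc n :: int)] \<cdot>\<^bsub>A\<^esub> ?s (Suc n) \<oplus>\<^bsub>A\<^esub> (\<Oplus>\<^bsub>A\<^esub>i\<in>{..n}. [((-1) ^ i :: int)] \<cdot>\<^bsub>A\<^esub> ?s i)"
    by (rule F.finsum_Suc) (use car in \<open>auto simp del: power_Suc\<close>)
  also have "{..n} = insert 0 {1..n}"
    by auto
  also have "(\<Oplus>\<^bsub>A\<^esub>i\<in>insert 0 {1..n}. [((-1) ^ i :: int)] \<cdot>\<^bsub>A\<^esub> ?s i)
      = ?s 0 \<oplus>\<^bsub>A\<^esub> (\<Oplus>\<^bsub>A\<^esub>i\<in>{1..n}. [((-1) ^ i :: int)] \<cdot>\<^bsub>A\<^esub> ?s i)"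
    using car by (subst F.finsum_insert) (auto simp: F.add.int_pow_1)
  finally have sum': "theta (Suc n) (hom_coboundary G n \<phi>) gs =
      [((-1) ^ Suc n :: int)] \<cdot>\<^bsub>A\<^esub> ?s (Suc n) \<oplus>\<^bsub>A\<^esub>
      (?s 0 \<oplus>\<^bsub>A\<^esub> (\<Oplus>\<^bsub>A\<^esub>i\<in>{1..n}. [((-1) ^ i :: int)] \<cdot>\<^bsub>A\<^esub> ?s i))"
    using sum by simp
  \<comment> \<open>Face \<open>0\<close> returns \<open>gs\<close>, which in general does not start
    with a unit. Equivariance rewrites the stalk map there, and this produces the action of the
    first arrow.\<close>
  have s0: "?s 0 = sheaf_act G M (hd gs) (theta n \<phi> (tuple_tail G gs))"
    using bar_face_rng_Cons(1)[OF gs] stalk_map_theta[OF \<phi> gs] by (simp add: y_def translate_def)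
  have si: "?s i = theta n \<phi> (merge_at G (i - 1) gs)" if "i \<in> {1..n}" for i
    using bar_face_rng_Cons(2)[OF gs, of i] that by (simp add: y_def theta_def)
  have mid: "(\<Oplus>\<^bsub>A\<^esub>i\<in>{1..n}. [((-1) ^ i :: int)] \<cdot>\<^bsub>A\<^esub> ?s i)
      = (\<Oplus>\<^bsub>A\<^esub>i\<in>{1..n}. [((-1) ^ i :: int)] \<cdot>\<^bsub>A\<^esub> theta n \<phi> (merge_at G (i - 1) gs))"
  proof (rule F.finsum_cong'[OF refl])
    have "theta n \<phi> (merge_at G (i - 1) gs) \<in> carrier A" if "i \<in> {1..n}" for i
      using car[of i] si[OF that] that by simp
    then show "(\<lambda>i. [((-1) ^ i :: int)] \<cdot>\<^bsub>A\<^esub> theta n \<phi> (merge_at G (i - 1) gs)) \<in> {1..n} \<rightarrow> carrier A"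
      by (intro Pi_I F.add.int_pow_closed)
  qed (simp add: si)
  show "continuous_coboundary G M n (theta n \<phi>) gs = theta (Suc n) (hom_coboundary G n \<phi>) gs"
  proof (cases "n = 0")
    case True
    have "tl gs = []"
      using gs True length_tuples[OF gs] by (cases gs) auto
    then have s0': "?s 0 = sheaf_act G M (hd gs) (theta n \<phi> [src G (hd gs)])"
      using s0 by (simp add: tuple_tail_def)
    have "[rng G (hd gs)] \<in> tuples G n"
      using True hd_tuples[OF gs] rng_in_units by (simp add: tuples_def)
    then have sl: "?s (Suc n) = theta n \<phi> [rng G (hd gs)]"
      using bar_face_rng_Cons(3)[OF gs True] by (simp add: y_def theta_def)
    have c: "?s (Suc n) \<in> carrier A" "?s 0 \<in> carrier A"
      using car by auto
    \<comment> \<open>In degree zero the coboundary is written as a difference, so the coefficient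
      has to be turned into a negation.\<close>
    have "[(-1 :: int)] \<cdot>\<^bsub>A\<^esub> ?s (Suc n) = \<ominus>\<^bsub>A\<^esub> ?s (Suc n)"
      using F.add.int_pow_neg[OF c(1), of 1] c by (simp add: F.add.int_pow_1 a_inv_def)
    then have "theta (Suc n) (hom_coboundary G n \<phi>) gs = \<ominus>\<^bsub>A\<^esub> ?s (Suc n) \<oplus>\<^bsub>A\<^esub> ?s 0"
      using sum' c True by simp
    also have "\<dots> = ?s 0 \<ominus>\<^bsub>A\<^esub> ?s (Suc n)"
      using c by (simp add: a_minus_def F.a_comm)
    finally show ?thesis
      using gs True s0' sl by (simp add: continuous_coboundary_def A_def Let_def)
  next
    case False
    have tail: "tuple_tail G gs = tl gs"
      using False length_tuples[OF gs] by (cases gs) (auto simp: tuple_tail_def)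
    have sl: "?s (Suc n) = theta n \<phi> (butlast gs)"
      using bar_face_rng_Cons(4)[OF gs] False by (simp add: y_def theta_def)
    let ?S = "\<Oplus>\<^bsub>A\<^esub>i\<in>{1..n}. [((-1) ^ i :: int)] \<cdot>\<^bsub>A\<^esub> ?s i"
    have S: "?S \<in> carrier A"
      using car by (intro F.finsum_closed) auto
    have "theta (Suc n) (hom_coboundary G n \<phi>) gs = ?s 0 \<oplus>\<^bsub>A\<^esub> ?S \<oplus>\<^bsub>A\<^esub> [((-1) ^ Suc n :: int)] \<cdot>\<^bsub>A\<^esub> ?s (Suc n)"
      unfolding sum' using S car by (intro F.a_comm) (auto simp del: power_Suc)
    then show ?thesis
      using gs False s0 sl mid tail by (simp add: continuous_coboundary_def A_def Let_def del: power_Suc)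
  qed
qed

section \<open>The formulas that determine the two maps\<close>

lemma slice_through_unit_cons:
  assumes gs: "gs \<in> tuples G n" shows "\<exists>V. compact_open_slice G (Suc n) V \<and> unit_cons G n gs \<in> V"
  using TM.slice_exists[of "unit_cons G n gs" n] unit_cons_in[OF gs] by (simp add: compact_open_slice_iff)

text \<open>Left to right, the formula holds for every admissible \<open>V\<close>, not only for the
  slice chosen in \<open>stalk_map\<close>. Right to left, it determines the cochain; this direction
  rests on the existence of a slice through each \<open>unit_cons G n gs\<close>, without which the
  condition could be vacuous.\<close>

lemma theta_eq_iff:
  assumes \<phi>: "\<phi> \<in> carrier (hom_cochains G M n)" and f: "f \<in> carrier (continuous_cochains G M n)"
  shows "theta n \<phi> = f \<longleftrightarrow>
    (\<forall>gs\<in>tuples G n. \<forall>V. compact_open_slice G (Suc n) V \<and> unit_cons G n gs \<in> V \<longrightarrow>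
      f gs = as_section G M (\<phi> (indicator V)) (anchor G gs))"
proof -
  have \<theta>: "theta n \<phi> gs = as_section G M (\<phi> (indicator V)) (anchor G gs)"
    if "gs \<in> tuples G n" "compact_open_slice G (Suc n) V" "unit_cons G n gs \<in> V" for gs V
    using that TM.stalk_map_eq[of n \<phi> V "unit_cons G n gs"] \<phi> anchor_unit_cons anchor_in_units
    by (simp add: theta_def as_section_def compact_open_slice_iff hom_cochains_carrier)
  show ?thesis
  proof
    assume "theta n \<phi> = f"
    then show "\<forall>gs\<in>tuples G n. \<forall>V. compact_open_slice G (Suc n) V \<and> unit_cons G n gs \<in> V \<longrightarrow>
        f gs = as_section G M (\<phi> (indicator V)) (anchor G gs)"
      using \<theta> by blast
  next
    assume r: "\<forall>gs\<in>tuples G n. \<forall>V. compact_open_slice G (Suc n) V \<and> unit_cons G n gs \<in> V \<longrightarrow>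
        f gs = as_section G M (\<phi> (indicator V)) (anchor G gs)"
    show "theta n \<phi> = f"
    proof (rule extensionalityI[of _ "tuples G n"])
      show "theta n \<phi> \<in> extensional (tuples G n)" "f \<in> extensional (tuples G n)"
        using f by (auto simp: theta_def continuous_cochains_carrier)
      show "theta n \<phi> gs = f gs" if "gs \<in> tuples G n" for gs
        using r \<theta> slice_through_unit_cons that by metis
    qed
  qed
qed

text \<open>Over a slice the formula prescribes the stalk map at each of its points. As slices cover
  the tuple space, the condition fixes the whole stalk map and with it the homomorphism.\<close>

lemma rho_eq_iff:
  assumes f: "f \<in> carrier (continuous_cochains G M n)" and \<psi>: "\<psi> \<in> carrier (hom_cochains G M n)"
  shows "rho n f = \<psi> \<longleftrightarrow>
    (\<forall>W. compact_open_slice G (Suc n) W \<longrightarrow>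
      (\<forall>hs\<in>W. as_section G M (\<psi> (indicator W)) (anchor G hs) = sheaf_act G M (hd hs) (f (tuple_tail G hs))) \<and>
      (\<forall>x\<in>units G - anchor G ` W. as_section G M (\<psi> (indicator W)) x = \<zero>\<^bsub>fiber G M x\<^esub>))"
    (is "_ \<longleftrightarrow> ?r")
proof -
  have h: "TM.is_hom n \<psi>" "TM.is_hom n (rho n f)"
    using \<psi> rho_closed[OF f] by (auto simp: hom_cochains_carrier)
  have sec: "as_section G M (\<psi> (indicator W)) (anchor G hs) = TM.stalk_map n \<psi> hs" and T: "hs \<in> tuples G (Suc n)"
    if W: "T.slice n W" "hs \<in> W" for W hs
  proof -
    show "hs \<in> tuples G (Suc n)"
      using T.slice_subset[OF W(1)] W(2) by auto
    then show "as_section G M (\<psi> (indicator W)) (anchor G hs) = TM.stalk_map n \<psi> hs"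
      using TM.stalk_map_eq[OF h(1) W] anchor_in_units by (simp add: as_section_def)
  qed
  show ?thesis
  proof
    assume eq: "rho n f = \<psi>"
    show ?r
    proof (intro allI impI conjI ballI)
      fix W assume "compact_open_slice G (Suc n) W"
      then have W: "T.slice n W"
        by (simp add: compact_open_slice_iff)
      show "as_section G M (\<psi> (indicator W)) (anchor G hs) = sheaf_act G M (hd hs) (f (tuple_tail G hs))"
        if "hs \<in> W" for hs
        using sec[OF W that] stalk_map_rho[OF f T[OF W that]] eq by (simp add: translate_def)
      show "as_section G M (\<psi> (indicator W)) x = \<zero>\<^bsub>fiber G M x\<^esub>" if "x \<in> units G - anchor G ` W" for x
        using TM.hom_outside[OF h(1) W, of x] that by (simp add: as_section_def fiber_zero)
    qed
  next
    assume r: ?r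
    show "rho n f = \<psi>"
    proof (rule extensionalityI[of _ "tuple_Cc (Suc n)"])
      show "rho n f \<in> extensional (tuple_Cc (Suc n))" "\<psi> \<in> extensional (tuple_Cc (Suc n))"
        using \<psi> by (auto simp: rho_def hom_cochains_carrier)
      fix k assume k: "k \<in> tuple_Cc (Suc n)"
      have "TM.stalk_map n (rho n f) hs = TM.stalk_map n \<psi> hs" if hs: "hs \<in> topspace (tuple_top G (Suc n))" for hs
      proof -
        obtain W where W: "T.slice n W" "hs \<in> W"
          using TM.slice_exists[OF hs] by blast
        then have "as_section G M (\<psi> (indicator W)) (anchor G hs) = translate f hs"
          using r by (simp add: compact_open_slice_iff translate_def)
        then show ?thesis
          using sec[OF W] stalk_map_rho[OF f T[OF W]] by simp
      qed
      then show "rho n f k = \<psi> k"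
        by (rule TM.hom_ext[OF h(2,1) _ k])
    qed
  qed
qed

end

section \<open>Isomorphic cochain complexes\<close>

lemma cohomology_carrier: "carrier (cohomology C d n) = cohomology_class C d n ` cocycles C d n"
  by (auto simp: cohomology_def FactGroup_def RCOSETS_def cohomology_class_def r_coset_def)

lemma cohomology_mult: "a \<otimes>\<^bsub>cohomology C d n\<^esub> b = a <#>\<^bsub>C n\<^esub> b"
  by (simp add: cohomology_def FactGroup_def set_mult_def)

locale cochain_isomorphism =
  fixes K :: "nat \<Rightarrow> 'a monoid" and C :: "nat \<Rightarrow> 'b monoid" and d e \<theta> \<rho>
  assumes group_K: "group (K n)" and group_C: "group (C n)"
    and iso: "group_isomorphisms (K n) (C n) (\<theta> n) (\<rho> n)"
    and d_closed: "\<phi> \<in> carrier (K n) \<Longrightarrow> d n \<phi> \<in> carrier (K (Suc n))"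
    and compat: "\<phi> \<in> carrier (K n) \<Longrightarrow> e n (\<theta> n \<phi>) = \<theta> (Suc n) (d n \<phi>)"
begin

lemma \<theta>_hom: "\<theta> n \<in> hom (K n) (C n)" and \<rho>_hom: "\<rho> n \<in> hom (C n) (K n)"
  and \<rho>_\<theta>: "\<phi> \<in> carrier (K n) \<Longrightarrow> \<rho> n (\<theta> n \<phi>) = \<phi>" and \<theta>_\<rho>: "f \<in> carrier (C n) \<Longrightarrow> \<theta> n (\<rho> n f) = f"
  using iso[of n] by (auto simp: group_isomorphisms_def)

lemma \<theta>_closed: "\<phi> \<in> carrier (K n) \<Longrightarrow> \<theta> n \<phi> \<in> carrier (C n)"
  and \<rho>_closed: "f \<in> carrier (C n) \<Longrightarrow> \<rho> n f \<in> carrier (K n)"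
  using \<theta>_hom[of n] \<rho>_hom[of n] by (auto simp: hom_def)

lemma \<theta>_one: "\<theta> n \<one>\<^bsub>K n\<^esub> = \<one>\<^bsub>C n\<^esub>"
  by (rule hom_one[OF \<theta>_hom group_K group_C])

text \<open>On cochains \<open>e\<close> is the conjugate of \<open>d\<close> by the isomorphisms,
  which yields its codomain and its compatibility with \<open>\<rho>\<close>. Every later fact
  proved for \<open>\<theta>\<close> is thereby available for \<open>\<rho>\<close>.\<close>

lemma cochain_isomorphism_sym: "cochain_isomorphism C K e d \<rho> \<theta>"
proof (rule cochain_isomorphism.intro)
  fix n f assume f: "f \<in> carrier (C n)"
  have e: "e n f = \<theta> (Suc n) (d n (\<rho> n f))"
    using compat[OF \<rho>_closed[OF f]] \<theta>_\<rho>[OF f] by simp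
  then show "e n f \<in> carrier (C (Suc n))"
    using d_closed \<rho>_closed f \<theta>_closed by simp
  show "d n (\<rho> n f) = \<rho> (Suc n) (e n f)"
    using e d_closed \<rho>_closed f \<rho>_\<theta> by simp
qed (simp_all add: group_K group_C iso group_isomorphisms_sym)

lemma cocycles_subset: "cocycles K d n \<subseteq> carrier (K n)"
  by (auto simp: cocycles_def kernel_def)

lemma coboundaries_subset: "coboundaries K d n \<subseteq> carrier (K n)"
  using group.is_monoid[OF group_K] d_closed
  by (auto simp: coboundaries_def monoid.one_closed split: nat.splits)

lemma \<theta>_cocycles: "\<phi> \<in> cocycles K d n \<Longrightarrow> \<theta> n \<phi> \<in> cocycles C e n"
  by (simp add: cocycles_def kernel_def \<theta>_closed compat \<theta>_one)

text \<open>Equality, and not just an inclusion, comes from surjectivity of \<open>\<theta>\<close>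
  one degree lower. It is the reason why \<open>\<theta>\<close> maps cosets of coboundaries onto
  cosets.\<close>

lemma \<theta>_coboundaries: "\<theta> n ` coboundaries K d n = coboundaries C e n"
proof (cases n)
  case 0
  then show ?thesis
    by (simp add: coboundaries_def \<theta>_one)
next
  case (Suc k)
  have "\<theta> n ` coboundaries K d n = e k ` \<theta> k ` carrier (K k)"
    using compat[of _ k] by (auto simp: Suc coboundaries_def image_image)
  moreover have "\<theta> k ` carrier (K k) = carrier (C k)"
    using \<theta>_closed \<rho>_closed \<theta>_\<rho> by (auto simp: image_iff) metis
  ultimately show ?thesis
    by (simp add: Suc coboundaries_def)
qed

lemma \<theta>_cohomology_class:
  assumes "\<phi> \<in> cocycles K d n"
  shows "\<theta> n ` cohomology_class K d n \<phi> = cohomology_class C e n (\<theta> n \<phi>)"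
proof -
  have "\<theta> n ` cohomology_class K d n \<phi> = (\<lambda>b. \<theta> n (b \<otimes>\<^bsub>K n\<^esub> \<phi>)) ` coboundaries K d n"
    by (auto simp: cohomology_class_def r_coset_def)
  also have "\<dots> = (\<lambda>b. \<theta> n b \<otimes>\<^bsub>C n\<^esub> \<theta> n \<phi>) ` coboundaries K d n"
    using assms cocycles_subset coboundaries_subset \<theta>_hom[of n]
    by (intro image_cong) (auto simp: hom_def subset_iff)
  also have "\<dots> = cohomology_class C e n (\<theta> n \<phi>)"
    by (auto simp: cohomology_class_def r_coset_def simp flip: \<theta>_coboundaries)
  finally show ?thesis .
qed

lemma cohomology_class_subset:
  "\<phi> \<in> cocycles K d n \<Longrightarrow> cohomology_class K d n \<phi> \<subseteq> carrier (K n)"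
  using cocycles_subset coboundaries_subset group.is_monoid[OF group_K]
  by (fastforce simp: cohomology_class_def r_coset_def intro: monoid.m_closed)

lemma \<theta>_cohomology_hom: "(`) (\<theta> n) \<in> hom (cohomology K d n) (cohomology C e n)"
proof (rule homI)
  fix S assume S: "S \<in> carrier (cohomology K d n)"
  then show "\<theta> n ` S \<in> carrier (cohomology C e n)"
    using \<theta>_cohomology_class \<theta>_cocycles by (force simp: cohomology_carrier)
  fix T assume T: "T \<in> carrier (cohomology K d n)"
  have sub: "S \<subseteq> carrier (K n)" "T \<subseteq> carrier (K n)"
    using S T cohomology_class_subset by (auto simp: cohomology_carrier)
  have "\<theta> n ` (S <#>\<^bsub>K n\<^esub> T) = \<theta> n ` S <#>\<^bsub>C n\<^esub> \<theta> n ` T"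
  proof -
    have "\<theta> n ` (S <#>\<^bsub>K n\<^esub> T) = (\<Union>h\<in>S. \<Union>k\<in>T. {\<theta> n (h \<otimes>\<^bsub>K n\<^esub> k)})"
      by (auto simp: set_mult_def)
    also have "\<dots> = (\<Union>h\<in>S. \<Union>k\<in>T. {\<theta> n h \<otimes>\<^bsub>C n\<^esub> \<theta> n k})"
      using sub \<theta>_hom[of n] by (intro SUP_cong refl) (auto simp: hom_def subset_iff)
    also have "\<dots> = \<theta> n ` S <#>\<^bsub>C n\<^esub> \<theta> n ` T"
      by (auto simp: set_mult_def)
    finally show ?thesis .
  qed
  then show "\<theta> n ` (S \<otimes>\<^bsub>cohomology K d n\<^esub> T) = \<theta> n ` S \<otimes>\<^bsub>cohomology C e n\<^esub> \<theta> n ` T"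
    by (simp add: cohomology_mult)
qed

lemma \<rho>_\<theta>_image: "S \<in> carrier (cohomology K d n) \<Longrightarrow> \<rho> n ` \<theta> n ` S = S"
  using cohomology_class_subset \<rho>_\<theta> by (force simp: cohomology_carrier image_image subset_iff)

end

lemma (in cochain_isomorphism) cohomology_isomorphisms:
  "group_isomorphisms (cohomology K d n) (cohomology C e n) ((`) (\<theta> n)) ((`) (\<rho> n))"
proof -
  interpret sym: cochain_isomorphism C K e d \<rho> \<theta>
    by (rule cochain_isomorphism_sym)
  show ?thesis
    using \<theta>_cohomology_hom sym.\<theta>_cohomology_hom \<rho>_\<theta>_image sym.\<rho>_\<theta>_image
    by (simp add: group_isomorphisms_def)
qed

theorem theorem3p12:
  fixes G :: "'g groupoid" and M :: "('g \<Rightarrow> int, 'm) module"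
  assumes "ample_groupoid G" and "groupoid_module G M"
  defines "K \<equiv> hom_cochains G M" and "\<delta> \<equiv> hom_coboundary G"
    and "C \<equiv> continuous_cochains G M" and "\<delta>c \<equiv> continuous_coboundary G M"
  shows "\<exists>\<theta> \<rho>. \<forall>n.
    comm_group (K n) \<and> comm_group (C n) \<and> \<theta> n \<in> iso (K n) (C n) \<and>
    (\<forall>gs\<in>tuples G n. \<exists>V. compact_open_slice G (Suc n) V \<and> unit_cons G n gs \<in> V) \<and>
    (\<forall>\<phi>\<in>carrier (K n). \<forall>f\<in>carrier (C n).
       \<theta> n \<phi> = f \<longleftrightarrow>
       (\<forall>gs\<in>tuples G n. \<forall>V. compact_open_slice G (Suc n) V \<and> unit_cons G n gs \<in> V \<longrightarrow>
          f gs = as_section G M (\<phi> (indicator V)) (anchor G gs))) \<and>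
    (\<forall>\<phi>\<in>carrier (K n). \<delta>c n (\<theta> n \<phi>) = \<theta> (Suc n) (\<delta> n \<phi>)) \<and>
    (\<forall>f\<in>carrier (C n). \<forall>\<psi>\<in>carrier (K n).
       \<rho> n f = \<psi> \<longleftrightarrow>
       (\<forall>W. compact_open_slice G (Suc n) W \<longrightarrow>
          (\<forall>hs\<in>W. as_section G M (\<psi> (indicator W)) (anchor G hs)
                    = sheaf_act G M (hd hs) (f (tuple_tail G hs))) \<and>
          (\<forall>x\<in>units G - anchor G ` W.
             as_section G M (\<psi> (indicator W)) x = \<zero>\<^bsub>fiber G M x\<^esub>))) \<and>
    group_isomorphisms (K n) (C n) (\<theta> n) (\<rho> n) \<and>
    (\<exists>\<Theta> P. group_isomorphisms (cohomology K \<delta> n) (cohomology C \<delta>c n) \<Theta> P \<and>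
       (\<forall>\<phi>\<in>cocycles K \<delta> n.
          \<theta> n \<phi> \<in> cocycles C \<delta>c n \<and>
          \<Theta> (cohomology_class K \<delta> n \<phi>) = cohomology_class C \<delta>c n (\<theta> n \<phi>)) \<and>
       (\<forall>f\<in>cocycles C \<delta>c n.
          \<rho> n f \<in> cocycles K \<delta> n \<and>
          P (cohomology_class C \<delta>c n f) = cohomology_class K \<delta> n (\<rho> n f)))"
proof -
  interpret ample_module G M
    by (rule ample_module.intro[OF assms(1,2)])
  interpret cochain_isomorphism K C \<delta> \<delta>c theta rho
    unfolding K_def C_def \<delta>_def \<delta>c_def
    by (rule cochain_isomorphism.intro)
      (simp_all add: comm_group.axioms(2) hom_cochains_comm_group continuous_cochains_comm_group
        theta_rho_isomorphisms hom_coboundary_closed continuous_coboundary_theta)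
  interpret sym: cochain_isomorphism C K \<delta>c \<delta> rho theta
    by (rule cochain_isomorphism_sym)
  show ?thesis
  proof (intro exI[of _ theta] exI[of _ rho] allI conjI)
    fix n
    show "comm_group (K n)" "comm_group (C n)"
      by (simp_all add: K_def C_def hom_cochains_comm_group continuous_cochains_comm_group)
    show "theta n \<in> Group.iso (K n) (C n)" "group_isomorphisms (K n) (C n) (theta n) (rho n)"
      using iso group_isomorphisms_imp_iso by blast+
    show "\<forall>gs\<in>tuples G n. \<exists>V. compact_open_slice G (Suc n) V \<and> unit_cons G n gs \<in> V"
      by (simp add: slice_through_unit_cons)
    show "\<forall>\<phi>\<in>carrier (K n). \<forall>f\<in>carrier (C n). theta n \<phi> = f \<longleftrightarrow>
       (\<forall>gs\<in>tuples G n. \<forall>V. compact_open_slice G (Suc n) V \<and> unit_cons G n gs \<in> V \<longrightarrow>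
          f gs = as_section G M (\<phi> (indicator V)) (anchor G gs))"
      unfolding K_def C_def by (intro ballI theta_eq_iff)
    show "\<forall>\<phi>\<in>carrier (K n). \<delta>c n (theta n \<phi>) = theta (Suc n) (\<delta> n \<phi>)"
      using compat by blast
    show "\<forall>f\<in>carrier (C n). \<forall>\<psi>\<in>carrier (K n). rho n f = \<psi> \<longleftrightarrow>
       (\<forall>W. compact_open_slice G (Suc n) W \<longrightarrow>
          (\<forall>hs\<in>W. as_section G M (\<psi> (indicator W)) (anchor G hs)
                    = sheaf_act G M (hd hs) (f (tuple_tail G hs))) \<and>
          (\<forall>x\<in>units G - anchor G ` W.
             as_section G M (\<psi> (indicator W)) x = \<zero>\<^bsub>fiber G M x\<^esub>))"
      unfolding K_def C_def by (intro ballI rho_eq_iff)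
    show "\<exists>\<Theta> P. group_isomorphisms (cohomology K \<delta> n) (cohomology C \<delta>c n) \<Theta> P \<and>
       (\<forall>\<phi>\<in>cocycles K \<delta> n.
          theta n \<phi> \<in> cocycles C \<delta>c n \<and>
          \<Theta> (cohomology_class K \<delta> n \<phi>) = cohomology_class C \<delta>c n (theta n \<phi>)) \<and>
       (\<forall>f\<in>cocycles C \<delta>c n.
          rho n f \<in> cocycles K \<delta> n \<and>
          P (cohomology_class C \<delta>c n f) = cohomology_class K \<delta> n (rho n f))"
    \<comment> \<open>Cohomology classes are cosets, hence sets of cochains, and the induced maps
      are the direct images under \<open>theta n\<close> and \<open>rho n\<close>.\<close>
    proof (intro exI[of _ "(`) (theta n)"] exI[of _ "(`) (rho n)"] conjI ballI)
      show "group_isomorphisms (cohomology K \<delta> n) (cohomology C \<delta>c n) ((`) (theta n)) ((`) (rho n))"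
        by (rule cohomology_isomorphisms)
      show "theta n \<phi> \<in> cocycles C \<delta>c n"
        "theta n ` cohomology_class K \<delta> n \<phi> = cohomology_class C \<delta>c n (theta n \<phi>)"
        if "\<phi> \<in> cocycles K \<delta> n" for \<phi>
        using that by (rule \<theta>_cocycles \<theta>_cohomology_class)+
      show "rho n f \<in> cocycles K \<delta> n"
        "rho n ` cohomology_class C \<delta>c n f = cohomology_class K \<delta> n (rho n f)"
        if "f \<in> cocycles C \<delta>c n" for f
        using that by (rule sym.\<theta>_cocycles sym.\<theta>_cohomology_class)+
    qed
  qed
qed

end
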